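(* Let $\varepsilon>0$ and a positive integer $n$ be fixed, and let $p$ be a sufficiently large prime. Assume that a real number $\Delta\ge 1$ and integers $h,k$ with $p/2>h\ge 1$ and $1\le k\le n$ satisfy $$h^k>\Delta p^{\varepsilon}\qquad\text{and}\qquad \Delta<p^{1-\varepsilon}.$$ Then there exist an integer $d$, depending only on $n$ and $\varepsilon$, and a deterministic polynomial time algorithm $\mathcal{A}$ with the following property. For any polynomial $$f(X)=\sum_{j=k}^{n}a_jX^j\in\mathbb{F}_p[X],$$ when $\mathcal{A}$ is given integers $t_1,\ldots,t_d\in[-h,h]$ and $s_1,\ldots,s_d\in\mathbb{F}_p$ with $$|f(t_i)-s_i|_p\le\Delta,\qquad i=1,\ldots,d,$$ its output satisfies $$\Pr_{t_1,\ldots,t_d\in[-h,h]}\left[\mathcal{A}(t_1,\ldots,t_d;s_1,\ldots,s_d)=(a_k,\ldots,a_n)\right]\ge 1-\frac1p,$$ where $t_1,\ldots,t_d$ are chosen uniformly and independently at random from the integers in $[-h,h]$.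
   Context: Elements of $\mathbb{F}_p$ are identified with $\{0,\ldots,p-1\}$. For integers $s$ and $m\ge1$, $|s|_m=\min_{j\in\mathbb{Z}}|s-jm|$ denotes the distance from $s$ to the nearest multiple of $m$. "Polynomial time" means polynomial in $\log p$. *)

theory Defs
  imports
    "HOL-Probability.Probability"
    "HOL-Computational_Algebra.Computational_Algebra"
    "HOL-Library.Log_Nat"
begin

section \<open>Residues modulo a prime\<close>

text \<open>Distance from \<open>s\<close> to the nearest multiple of \<open>m\<close>. The infimum, taken over a nonempty set
  of nonnegative integers, is a minimum.\<close>

definition mult_dist :: "int \<Rightarrow> nat \<Rightarrow> int" where
  "mult_dist s m = (INF j::int. \<bar>s - j * int m\<bar>)"

text \<open>Elements of the field with \<open>p\<close> elements are the integers in \<open>{0..<p}\<close>. This is the value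
  at \<open>t\<close>, in that field, of the polynomial with coefficient \<open>a j\<close> at \<open>X ^ j\<close> for \<open>k \<le> j \<le> n\<close>.\<close>

definition poly_mod_eval :: "nat \<Rightarrow> nat \<Rightarrow> nat \<Rightarrow> (nat \<Rightarrow> int) \<Rightarrow> int \<Rightarrow> int" where
  "poly_mod_eval p k n a t = (\<Sum>j = k..n. a j * t ^ j) mod int p"


section \<open>Deterministic algorithms and their running time\<close>

text \<open>The machine model is the random access machine with the four integer operations under the
  logarithmic cost criterion, programmed by structured (while) programs. Cells and addresses hold
  arbitrary integers; \<open>Mem e\<close> reads the cell whose address is the value of \<open>e\<close> (so there is
  indirect addressing). Every step is charged according to the binary lengths of all the integers
  involved, and an arithmetic operation is charged the product of the lengths of its operands, as
  for schoolbook multiplication and division. Hence running time is, up to a polynomial, the number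
  of bit operations (equivalently, of Turing machine steps); in particular numbers that are too
  long for the time bound cannot be produced by repeated squaring.\<close>

type_synonym mem = "int \<Rightarrow> int"

datatype exp =
    Const int
  | Mem exp
  | Add exp exp
  | Sub exp exp
  | Mul exp exp
  | Div exp exp

datatype prog =
    Skip
  | Store exp exp
  | Seq prog prog
  | IfPos exp prog prog
  | WhilePos exp prog

definition bits :: "int \<Rightarrow> nat" where
  "bits x = 1 + nat (bitlen \<bar>x\<bar>)"

text \<open>Division rounds towards minus infinity, and division by zero yields zero.\<close>

primrec aval :: "exp \<Rightarrow> mem \<Rightarrow> int" where
  "aval (Const c) M = c"
| "aval (Mem a) M = M (aval a M)"
| "aval (Add a b) M = aval a M + aval b M"
| "aval (Sub a b) M = aval a M - aval b M"
| "aval (Mul a b) M = aval a M * aval b M"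
| "aval (Div a b) M = aval a M div aval b M"

primrec acost :: "exp \<Rightarrow> mem \<Rightarrow> nat" where
  "acost (Const c) M = bits c"
| "acost (Mem a) M = acost a M + bits (aval a M) + bits (M (aval a M))"
| "acost (Add a b) M = acost a M + acost b M + bits (aval a M) * bits (aval b M)"
| "acost (Sub a b) M = acost a M + acost b M + bits (aval a M) * bits (aval b M)"
| "acost (Mul a b) M = acost a M + acost b M + bits (aval a M) * bits (aval b M)"
| "acost (Div a b) M = acost a M + acost b M + bits (aval a M) * bits (aval b M)"

text \<open>\<open>exec c M T M'\<close>: started in memory \<open>M\<close>, the program \<open>c\<close> halts after time \<open>T\<close> in memory \<open>M'\<close>.
  Conditionals and loops test whether an expression is positive.\<close>

inductive exec :: "prog \<Rightarrow> mem \<Rightarrow> nat \<Rightarrow> mem \<Rightarrow> bool" where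
  Skip: "exec Skip M 1 M"
| Store: "exec (Store a e) M
    (acost a M + acost e M + bits (aval a M) + bits (aval e M)) (M(aval a M := aval e M))"
| Seq: "exec c1 M T1 M1 \<Longrightarrow> exec c2 M1 T2 M2 \<Longrightarrow> exec (Seq c1 c2) M (T1 + T2) M2"
| IfTrue: "aval b M > 0 \<Longrightarrow> exec c1 M T M' \<Longrightarrow>
    exec (IfPos b c1 c2) M (acost b M + bits (aval b M) + T) M'"
| IfFalse: "\<not> aval b M > 0 \<Longrightarrow> exec c2 M T M' \<Longrightarrow>
    exec (IfPos b c1 c2) M (acost b M + bits (aval b M) + T) M'"
| WhileFalse: "\<not> aval b M > 0 \<Longrightarrow>
    exec (WhilePos b c) M (acost b M + bits (aval b M)) M"
| WhileTrue: "aval b M > 0 \<Longrightarrow> exec c M T1 M1 \<Longrightarrow> exec (WhilePos b c) M1 T2 M2 \<Longrightarrow>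
    exec (WhilePos b c) M (acost b M + bits (aval b M) + T1 + T2) M2"

inductive_cases SkipE: "exec Skip M T M'"
inductive_cases StoreE: "exec (Store a e) M T M'"
inductive_cases SeqE: "exec (Seq c1 c2) M T M'"
inductive_cases IfPosE: "exec (IfPos b c1 c2) M T M'"
inductive_cases WhilePosE: "exec (WhilePos b c) M T M'"

lemma exec_deterministic:
  assumes "exec c M T M'" and "exec c M U N'"
  shows "T = U \<and> M' = N'"
  using assms
proof (induction arbitrary: U N' rule: exec.induct)
  case (Skip M)
  then show ?case by (auto elim: SkipE)
next
  case (Store a e M)
  then show ?case by (auto elim: StoreE)
next
  case (Seq c1 M T1 M1 c2 T2 M2)
  from Seq.prems obtain U1 N1 U2 where
    "exec c1 M U1 N1" "exec c2 N1 U2 N'" "U = U1 + U2" by (rule SeqE)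
  with Seq.IH(1)[of U1 N1] Seq.IH(2)[of U2 N'] show ?case by simp
next
  case (IfTrue b M c1 T M' c2)
  from IfTrue.prems show ?case
    by (rule IfPosE) (use IfTrue.hyps in \<open>auto dest: IfTrue.IH\<close>)
next
  case (IfFalse b M c2 T M' c1)
  from IfFalse.prems show ?case
    by (rule IfPosE) (use IfFalse.hyps in \<open>auto dest: IfFalse.IH\<close>)
next
  case (WhileFalse b M c)
  from WhileFalse.prems show ?case
    by (rule WhilePosE) (use WhileFalse.hyps in auto)
next
  case (WhileTrue b M c T1 M1 T2 M2)
  from WhileTrue.prems show ?case
  proof (rule WhilePosE)
    fix U1 N1 U2
    assume U: "U = acost b M + bits (aval b M) + U1 + U2"
      and "exec c M U1 N1" "exec (WhilePos b c) N1 U2 N'"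
    with WhileTrue.IH(1)[of U1 N1] WhileTrue.IH(2)[of U2 N'] show ?case by simp
  qed (use WhileTrue.hyps in simp)
qed

text \<open>Inputs are placed in the cells 0, 1, 2, ...; all other cells are initially 0.
  Outputs are read from the cells 0, 1, 2, ... .\<close>

definition load :: "int list \<Rightarrow> mem" where
  "load xs = (\<lambda>i. if 0 \<le> i \<and> i < int (length xs) then xs ! nat i else 0)"

definition halts_within :: "prog \<Rightarrow> int list \<Rightarrow> real \<Rightarrow> bool" where
  "halts_within A xs B \<longleftrightarrow> (\<exists>T M'. exec A (load xs) T M' \<and> real T \<le> B)"

definition outputs :: "prog \<Rightarrow> int list \<Rightarrow> int list \<Rightarrow> bool" where
  "outputs A xs ys \<longleftrightarrow>
     (\<exists>T M'. exec A (load xs) T M' \<and> (\<forall>i < length ys. M' (int i) = ys ! i))"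


section \<open>Noisy interpolation algorithms\<close>

text \<open>The algorithm works with given parameters \<open>p\<close>, \<open>h\<close>, \<open>k\<close> and \<open>\<Delta>\<close>, so a program that is uniform
  in \<open>p\<close> gets them as part of its input. The real number \<open>\<Delta>\<close> is represented by \<open>D = \<lfloor>\<Delta>\<rfloor>\<close>: it only
  serves as a bound for integers.\<close>

definition interp_input :: "nat \<Rightarrow> nat \<Rightarrow> nat \<Rightarrow> int \<Rightarrow> int list \<Rightarrow> int list \<Rightarrow> int list" where
  "interp_input p h k D ts ss = [int p, int h, int k, D] @ ts @ ss"

text \<open>Worst-case running time polynomial in \<open>log p\<close>, on all inputs of the right format; the values
  \<open>ss\<close> need not be close to those of any polynomial.\<close>

definition poly_time_interp :: "nat \<Rightarrow> nat \<Rightarrow> prog \<Rightarrow> bool" where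
  "poly_time_interp n d A \<longleftrightarrow>
     (\<exists>q :: real poly. \<forall>p h k D ts ss.
        prime p \<and> 1 \<le> h \<and> 2 * h < p \<and> 1 \<le> k \<and> k \<le> n \<and> 1 \<le> D \<and> D < int p \<and>
        length ts = d \<and> set ts \<subseteq> {- int h..int h} \<and>
        length ss = d \<and> set ss \<subseteq> {0..<int p} \<longrightarrow>
        halts_within A (interp_input p h k D ts ss) (poly q (log 2 (real p))))"

text \<open>The points \<open>ts\<close> for which the algorithm recovers the coefficients from every admissible vector
  of approximations \<open>ss\<close>. Since the approximations may depend on \<open>ts\<close> in an arbitrary way, the
  algorithm has to succeed for all of them.\<close>

definition recovery_event ::
    "prog \<Rightarrow> nat \<Rightarrow> nat \<Rightarrow> nat \<Rightarrow> nat \<Rightarrow> real \<Rightarrow> (nat \<Rightarrow> int) \<Rightarrow> int list set" where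
  "recovery_event A n p h k \<Delta> a =
     {ts. \<forall>ss. length ss = length ts \<and> set ss \<subseteq> {0..<int p} \<and>
            (\<forall>i < length ts. real_of_int (mult_dist (poly_mod_eval p k n a (ts ! i) - ss ! i) p) \<le> \<Delta>)
          \<longrightarrow> outputs A (interp_input p h k \<lfloor>\<Delta>\<rfloor> ts ss) (map a [k..<Suc n])}"

end

(*
  Suppose that a polynomial g of degree e, with leading coefficient b not divisible by p, is at
  distance at most E from a multiple of p on a set of density 1/R in [-h, h]. For many u the
  difference g(t + u) - g(t), whose leading coefficient is e u b, has the same property, so by
  induction on e some q, bounded by a power of R, makes q b congruent to a number of size at most
  R^O(1) E / h^e. For E about Delta, h^e >= h^k > Delta p^epsilon and R a small power of p this is
  less than 1, so p divides q b, a contradiction. Hence a fixed nonzero polynomial with exponents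
  in [k, n] has values of size O(Delta) at all of t_1, ..., t_d with probability at most
  p^(-delta d), and there are fewer than p^n such polynomials: for large d the approximations
  determine the coefficients, even with a loss of a constant factor in Delta.

  With such a factor they are found by lattice basis reduction (with Siegel's condition
  B_i <= 2 B_(i+1) on the squared Gram-Schmidt norms B_i) and nearest plane decoding in the fixed
  dimension n - k + 1 + d. The Gram-Schmidt data are recomputed from the basis
  in every round, so that the state of the program consists of integers bounded by a power of p.
  All B_i stay between the initial minimum and maximum, which bounds the number of swaps by
  O(log p) without any determinants.
*)
theory Submission
  imports Defs
begin

section \<open>Small values of polynomials modulo \<open>p\<close>\<close>

text \<open>The approximations may depend on the points, so it is not enough to study one
  polynomial. The union bound runs over all nonzero differences of coefficient vectors, and outside
  one exceptional set of points, which depends neither on the approximations nor on the true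
  polynomial, every admissible input is decoded correctly.

  In the induction on the degree each differencing step must gain a full factor 1/h, since only the
  product of these factors reaches h^e. The box principle alone does not give it, and the linear
  case is where it is won.

  On the algorithmic side only the numbers kept between two rounds need a bound. The dimension
  depends on \<open>n\<close> and \<epsilon> alone, so one round is a fixed arithmetic expression,
  and the unreduced fractions inside it exceed the state in length by at most a constant factor. The
  number of rounds is fixed in advance by a counter, and surplus rounds do no harm; hence the time
  bound holds for arbitrary approximations, close to a polynomial or not.\<close>

definition near :: "nat \<Rightarrow> real \<Rightarrow> int \<Rightarrow> bool" where
  "near p E s \<longleftrightarrow> (\<exists>j::int. \<bar>real_of_int (s - j * int p)\<bar> \<le> E)"

lemma near_diff:
  assumes "near p E s" and "near p E' s'"
  shows "near p (E + E') (s - s')"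
proof -
  from assms obtain j j' where j: "\<bar>real_of_int (s - j * int p)\<bar> \<le> E" "\<bar>real_of_int (s' - j' * int p)\<bar> \<le> E'"
    unfolding near_def by blast
  have "real_of_int (s - s' - (j - j') * int p) = real_of_int (s - j * int p) - real_of_int (s' - j' * int p)"
    by (simp add: algebra_simps)
  then have "\<bar>real_of_int (s - s' - (j - j') * int p)\<bar> \<le> E + E'"
    using j by linarith
  then show ?thesis unfolding near_def by blast
qed

lemma near_mono: "near p E s \<Longrightarrow> E \<le> E' \<Longrightarrow> near p E' s"
  unfolding near_def by (meson order_trans)

lemma near_cong: "near p E s \<Longrightarrow> int p dvd s' - s \<Longrightarrow> near p E s'"
proof -
  assume "near p E s" and "int p dvd s' - s"
  then obtain j i where j: "\<bar>real_of_int (s - j * int p)\<bar> \<le> E" and i: "s' - s = int p * i"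
    unfolding near_def dvd_def by blast
  have "s' - (j + i) * int p = s - j * int p" using i by (simp add: algebra_simps)
  then show ?thesis using j unfolding near_def by metis
qed

lemma near_less_1:
  assumes "near p E s" and "E < 1"
  shows "int p dvd s"
proof -
  obtain j where j: "\<bar>real_of_int (s - j * int p)\<bar> \<le> E" using assms(1) unfolding near_def by blast
  then have "s - j * int p = 0" using assms(2) by linarith
  then show ?thesis by simp
qed

text \<open>A dense set on which a linear function is small modulo \<open>p\<close> contains two close points, whose
  difference \<open>q\<close> makes \<open>q c\<close> congruent to a small \<open>r\<close>. A window short enough that
  multiples of \<open>r\<close> do not wrap around modulo \<open>p\<close> then shows that \<open>r\<close> is much smaller still.\<close>

lemma linear_small_values:
  fixes U :: "nat set" and c :: int and D R :: real
  assumes U: "U \<subseteq> {1..H}" and dense: "real H \<le> R * card U" and R: "2 \<le> R" and D: "0 \<le> D"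
    and small: "\<And>u. u \<in> U \<Longrightarrow> near p D (c * int u)"
    and H: "R ^ 11 \<le> real H" and p: "R ^ 11 * D < real p"
  shows "\<exists>q::nat. 1 \<le> q \<and> real q \<le> R ^ 11 \<and> near p (R ^ 11 * D / H) (int q * c)"
proof -
  have fU: "finite U" using U finite_subset by blast
  have Hdiv: "u div m \<le> H div m" if "u \<in> U" for u m
    using that U by (intro div_le_mono) auto
  have pow: "R ^ i \<le> R ^ j" if "i \<le> j" for i j using R that by (intro power_increasing) auto
  have R3: "4 \<le> R\<^sup>2" "8 \<le> R ^ 3"
    using power_mono[of 2 R 2] power_mono[of 2 R 3] R by simp_all
  have R4: "16 \<le> R ^ 4" "256 \<le> R ^ 8" "128 \<le> R ^ 7"
    using power_mono[of 2 R 4] power_mono[of 2 R 8] power_mono[of 2 R 7] R by simp_all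
  have Rpos: "0 < R" using R by simp
  have H0: "0 < real H" using H zero_less_power[OF Rpos, of 11] by linarith
  \<comment> \<open>There are at most H/(2R) + 1 blocks of length \<open>L\<close>, fewer than the
    H/R points guaranteed in \<open>U\<close>; so two points share a block and differ by less than
    \<open>L\<close> \<le> 3R.\<close>
  define L where "L = nat \<lceil>2 * R\<rceil>"
  have L: "2 * R \<le> real L" "real L \<le> 3 * R" "0 < L"
    unfolding L_def using R by linarith+
  have "\<not> inj_on (\<lambda>u. u div L) U"
  proof (rule pigeonhole)
    have "(\<lambda>u. u div L) ` U \<subseteq> {0..H div L}"
      using Hdiv by auto
    then have "card ((\<lambda>u. u div L) ` U) \<le> H div L + 1"
      using card_mono[of "{0..H div L}"] by simp
    moreover have "real (H div L + 1) < real (card U)"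
    proof -
      have "real (H div L) \<le> real H / real L" by (rule of_nat_div_le_of_nat)
      also have "\<dots> \<le> real H / (2 * R)" using L R H0 by (intro divide_left_mono) auto
      finally have "real (H div L + 1) \<le> real H / (2 * R) + 1" by simp
      moreover have "2 * R < real H"
      proof -
        have "2 * R < R ^ 3" using R3(1) Rpos by (simp add: power3_eq_cube power2_eq_square)
        also have "\<dots> \<le> R ^ 11" by (intro pow) simp
        finally show ?thesis using H by simp
      qed
      then have "real H / (2 * R) + 1 < real H / R" using Rpos by (simp add: field_simps)
      moreover have "real H / R \<le> card U" using dense Rpos by (simp add: field_simps)
      ultimately show ?thesis by linarith
    qed
    ultimately show "card ((\<lambda>u. u div L) ` U) < card U" by simp
  qed
  then obtain u u' where uu: "u \<in> U" "u' \<in> U" "u < u'" "u div L = u' div L"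
    unfolding inj_on_def by (metis linorder_neqE_nat)
  define q where "q = u' - u"
  have q1: "1 \<le> q" using uu by (simp add: q_def)
  have "u' = u' div L * L + u' mod L" "u = u' div L * L + u mod L"
    using uu(4) by (simp, metis div_mult_mod_eq)
  moreover have "u' mod L < L" using L by simp
  ultimately have "q < L" unfolding q_def using uu(3) by linarith
  then have qL: "real q \<le> 3 * R" using L by linarith
  have "near p (D + D) (c * int u' - c * int u)"
    using small uu by (intro near_diff) auto
  then have "near p (2 * D) (int q * c)"
    using uu by (simp add: q_def of_nat_diff algebra_simps)
  then obtain j where j: "\<bar>real_of_int (int q * c - j * int p)\<bar> \<le> 2 * D"
    unfolding near_def by blast
  define r where "r = int q * c - j * int p"
  have q11: "real q \<le> R ^ 11"
  proof -
    have "real q \<le> R * 4" using qL R by simp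
    also have "\<dots> \<le> R * R\<^sup>2" using R3 Rpos by (intro mult_left_mono) auto
    also have "\<dots> = R ^ 3" by (simp add: power3_eq_cube power2_eq_square)
    also have "\<dots> \<le> R ^ 11" by (intro pow) simp
    finally show ?thesis .
  qed
  have "\<bar>real_of_int r\<bar> * real H \<le> R ^ 11 * D"
  proof (cases "r = 0")
    case True
    then show ?thesis using D R by simp
  next
    case False
    define \<rho> where "\<rho> = nat \<bar>r\<bar>"
    have \<rho>: "1 \<le> \<rho>" "\<bar>real_of_int r\<bar> = real \<rho>" "\<bar>r\<bar> = int \<rho>"
      using False by (auto simp: \<rho>_def)
    have \<rho>D: "real \<rho> \<le> 2 * D" using j \<rho> by (simp add: r_def)
    \<comment> \<open>The second case at the end reaches p < 168 D R^3, and 168 < 256 \<le> R^8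
      because R \<ge> 2: this accounts for the exponent 11 = 8 + 3.\<close>
    have pD: "256 * D * R ^ 3 < real p"
    proof -
      have "256 * D * R ^ 3 \<le> R ^ 8 * D * R ^ 3"
        using R4 D Rpos by (intro mult_right_mono) auto
      also have "\<dots> = R ^ 11 * D" by (simp add: power_add[symmetric] flip: mult.assoc)
      finally show ?thesis using p by simp
    qed
    have D8: "256 * D * 8 \<le> 256 * D * R ^ 3" using R3(2) D by (intro mult_left_mono) auto
    \<comment> \<open>For w \<le> \<open>L2\<close> the product \<rho> w is at most p/2. Two points
      in one window of this length and in one residue class modulo \<open>q\<close> differ by a
      multiple q w with such a \<open>w\<close>; then c q w is congruent to r w, which can be near a
      multiple of \<open>p\<close> only by being small itself.\<close>
    define L2 where "L2 = min H (p div (2 * \<rho>))"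
    have "2 * \<rho> \<le> p" using \<rho>D pD D8 D by linarith
    then have L2: "1 \<le> L2" "L2 \<le> H" "L2 \<le> p div (2 * \<rho>)"
      using H0 \<rho> by (auto simp: L2_def div_greater_zero_iff Suc_le_eq)
    define f where "f = (\<lambda>u. (u div L2, u mod q))"
    have "f \<in> U \<rightarrow> {0..H div L2} \<times> {0..<q}"
      using Hdiv q1 by (auto simp: f_def)
    then obtain y where y: "y \<in> {0..H div L2} \<times> {0..<q}"
        "card U \<le> card (f -` {y} \<inter> U) * card ({0..H div L2} \<times> {0..<q})"
      using pigeonhole_card[of f U "{0..H div L2} \<times> {0..<q}"] fU q1 by auto
    define V where "V = f -` {y} \<inter> U"
    have cU: "real (card U) \<le> real (card V) * (2 * real H / real L2 * real q)"
    proof -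
      have "real (card U) \<le> real (card V) * real (card ({0..H div L2} \<times> {0..<q}))"
        using y(2) unfolding V_def[symmetric] by (metis of_nat_le_iff of_nat_mult)
      also have "real (card ({0..H div L2} \<times> {0..<q})) = (real (H div L2) + 1) * real q"
        by (simp add: algebra_simps)
      also have "real (H div L2) + 1 \<le> real H / real L2 + real H / real L2"
        using L2 by (intro add_mono of_nat_div_le_of_nat) auto
      finally show ?thesis by (simp add: mult_left_mono mult_right_mono)
    qed
    have card_V: "real L2 \<le> real (card V) * (2 * R * real q)"
    proof -
      have "real H * real L2 \<le> R * card U * real L2" using dense by (intro mult_right_mono) auto
      also have "\<dots> \<le> R * (real (card V) * (2 * real H / real L2 * real q)) * real L2"
        using cU Rpos by (intro mult_right_mono mult_left_mono) auto
      also have "\<dots> = real H * (real (card V) * (2 * R * real q))"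
        using L2 by simp
      finally show ?thesis using H0 by simp
    qed
    have V: "finite V" "V \<noteq> {}"
      using fU card_V L2 unfolding V_def by auto
    define s where "s = Max V - Min V"
    have mm: "Max V \<in> V" "Min V \<in> V" "Min V \<le> Max V"
      using V by (auto intro: Max_in Min_in)
    have "V \<subseteq> {Min V..Max V}" using V by auto
    then have "card V \<le> Suc (Max V) - Min V" using card_mono[of "{Min V..Max V}" V] by simp
    \<comment> \<open>The points of \<open>V\<close> are even spaced by multiples of
      \<open>q\<close>; ignoring this costs a factor \<open>q\<close>, which is only O(R).\<close>
    then have cs: "real (card V) \<le> real s + 1" using mm by (simp add: s_def)
    have fm: "Max V div L2 = Min V div L2" "Max V mod q = Min V mod q"
    proof -
      have "f (Max V) = f (Min V)" using mm unfolding V_def by simp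
      then show "Max V div L2 = Min V div L2" "Max V mod q = Min V mod q" by (auto simp: f_def)
    qed
    have "q dvd s" unfolding s_def using fm(2) mm(3) by (metis mod_eq_dvd_iff_nat)
    then obtain w where w: "s = q * w" by blast
    have "s < L2"
    proof -
      have "Max V = Min V div L2 * L2 + Max V mod L2" using fm(1) by (metis div_mult_mod_eq)
      moreover have "Min V = Min V div L2 * L2 + Min V mod L2" by simp
      moreover have "Max V mod L2 < L2" using L2 by simp
      ultimately show ?thesis unfolding s_def using mm(3) by linarith
    qed
    have "near p (D + D) (c * int (Max V) - c * int (Min V))"
      using small mm unfolding V_def by (intro near_diff) auto
    then have "near p (2 * D) (c * int s)" using mm by (simp add: s_def of_nat_diff algebra_simps)
    moreover have "c * int s = r * int w + (j * int w) * int p"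
      unfolding w r_def by (simp add: algebra_simps)
    ultimately have "near p (2 * D) (r * int w + (j * int w) * int p)" by simp
    then have "near p (2 * D) (r * int w)"
      by (rule near_cong) simp
    then obtain i where i: "\<bar>real_of_int (r * int w - i * int p)\<bar> \<le> 2 * D"
      unfolding near_def by blast
    have rw: "2 * (\<rho> * w) \<le> p"
    proof -
      have "w \<le> s" using w q1 by simp
      then have "2 * \<rho> * w \<le> 2 * \<rho> * (p div (2 * \<rho>))"
        using \<open>s < L2\<close> L2 by (intro mult_le_mono2) simp
      also have "\<dots> \<le> p" by simp
      finally show ?thesis by simp
    qed
    have "i = 0"
    proof (rule ccontr)
      assume "i \<noteq> 0"
      have "\<bar>r * int w\<bar> = int (\<rho> * w)" using \<rho>(3) by (simp add: abs_mult)
      moreover have "int p * 1 \<le> int p * \<bar>i\<bar>" using \<open>i \<noteq> 0\<close> by (intro mult_left_mono) auto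
      then have "int p \<le> \<bar>i * int p\<bar>" by (simp add: abs_mult mult.commute)
      ultimately have "int p \<le> 2 * \<bar>r * int w - i * int p\<bar>"
        using abs_triangle_ineq3[of "i * int p" "r * int w"] zle_int[THEN iffD2, OF rw]
        unfolding of_nat_mult abs_minus_commute[of "i * int p"] by simp
      then have "real p \<le> 2 * \<bar>real_of_int (r * int w - i * int p)\<bar>" by linarith
      also have "\<dots> \<le> 2 * (2 * D)" using i by (intro mult_left_mono) auto
      finally have "real p \<le> 2 * (2 * D)" .
      then show False using pD D8 D by linarith
    qed
    with i \<rho> have rwD: "real \<rho> * real w \<le> 2 * D" by (simp add: abs_mult)
    have main: "real \<rho> * real L2 \<le> 6 * R * D * (2 * R * real q) + real \<rho> * (2 * R * real q)"
    proof -
      have "real \<rho> * real s = real \<rho> * real w * real q" by (simp add: w)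
      also have "\<dots> \<le> 2 * D * real q" using rwD by (intro mult_right_mono) auto
      also have "\<dots> \<le> 2 * D * (3 * R)" using qL D by (intro mult_left_mono) auto
      finally have *: "real \<rho> * real s \<le> 6 * R * D" by (simp add: mult_ac)
      have "real \<rho> * real L2 \<le> real \<rho> * (real (card V) * (2 * R * real q))"
        using card_V by (intro mult_left_mono) auto
      also have "\<dots> \<le> real \<rho> * ((real s + 1) * (2 * R * real q))"
        using cs Rpos by (intro mult_left_mono mult_right_mono) auto
      also have "\<dots> = (real \<rho> * real s) * (2 * R * real q) + real \<rho> * (2 * R * real q)"
        by (simp add: algebra_simps)
      also have "\<dots> \<le> (6 * R * D) * (2 * R * real q) + real \<rho> * (2 * R * real q)"
        using * Rpos by (intro add_mono mult_right_mono) auto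
      finally show ?thesis .
    qed
    have q6: "2 * R * real q \<le> 6 * R\<^sup>2"
      using qL Rpos mult_left_mono[OF qL, of "2 * R"] by (simp add: power2_eq_square)
    \<comment> \<open>If the window is the whole range, \<open>main\<close> turns into the claim.
      Otherwise \<rho> \<open>L2\<close> exceeds p/4, and \<open>main\<close> would bound
      \<open>p\<close> by O(D R^3).\<close>
    show ?thesis
    proof (cases "H \<le> p div (2 * \<rho>)")
      case True
      then have "L2 = H" by (simp add: L2_def)
      have "12 * R\<^sup>2 \<le> R ^ 11"
      proof -
        have "12 * R\<^sup>2 \<le> R ^ 4 * R\<^sup>2" using R4 by (intro mult_right_mono) auto
        also have "\<dots> = R ^ 6" by (simp flip: power_add)
        also have "\<dots> \<le> R ^ 11" by (intro pow) simp
        finally show ?thesis .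
      qed
      then have "2 * R * real q \<le> real H / 2" using q6 H by linarith
      then have "real \<rho> * (2 * R * real q) \<le> real \<rho> * (real H / 2)" by (intro mult_left_mono) auto
      then have "real \<rho> * real H \<le> 2 * (6 * R * D * (2 * R * real q))"
        using main \<open>L2 = H\<close> by simp
      also have "\<dots> \<le> 2 * (6 * R * D * (6 * R\<^sup>2))"
        using q6 D Rpos by (intro mult_left_mono) auto
      also have "\<dots> = 72 * (R ^ 3 * D)" by (simp add: power3_eq_cube power2_eq_square)
      also have "\<dots> \<le> R ^ 7 * (R ^ 3 * D)" using R4 D Rpos by (intro mult_right_mono) auto
      also have "\<dots> = R ^ 10 * D" by (simp flip: mult.assoc power_add)
      also have "\<dots> \<le> R ^ 11 * D" using pow[of 10 11] D by (intro mult_right_mono) auto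
      finally show ?thesis using \<rho> by simp
    next
      case False
      then have L2': "L2 = p div (2 * \<rho>)" by (simp add: L2_def)
      have "p < 2 * \<rho> * (L2 + 1)"
        using dividend_less_times_div[of "2 * \<rho>" p] \<rho> by (simp add: L2')
      also have "\<dots> \<le> 2 * \<rho> * (2 * L2)" using L2 by (intro mult_le_mono2) simp
      also have "\<dots> = 4 * (\<rho> * L2)" by simp
      finally have "real p < real (4 * (\<rho> * L2))" unfolding of_nat_less_iff .
      then have "real p < 4 * (real \<rho> * real L2)" by simp
      also have "\<dots> \<le> 4 * (6 * R * D * (6 * R\<^sup>2) + 2 * D * (6 * R\<^sup>2))"
      proof -
        have "6 * R * D * (2 * R * real q) \<le> 6 * R * D * (6 * R\<^sup>2)"
          using q6 D Rpos by (intro mult_left_mono) auto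
        moreover have "real \<rho> * (2 * R * real q) \<le> 2 * D * (6 * R\<^sup>2)"
          using q6 D Rpos by (intro mult_mono[OF \<rho>D]) auto
        ultimately have "real \<rho> * real L2 \<le> 6 * R * D * (6 * R\<^sup>2) + 2 * D * (6 * R\<^sup>2)"
          using main by (meson add_mono order_trans)
        then show ?thesis by (intro mult_left_mono) auto
      qed
      also have "\<dots> \<le> 4 * (6 * R * D * (6 * R\<^sup>2) + R * D * (6 * R\<^sup>2))"
        using R D by (intro mult_left_mono add_mono mult_right_mono) auto
      also have "\<dots> = 168 * D * R ^ 3" by (simp add: power3_eq_cube power2_eq_square)
      also have "\<dots> \<le> 256 * D * R ^ 3" using D R by (intro mult_right_mono) auto
      finally show ?thesis using pD by simp
    qed
  qed
  then have "\<bar>real_of_int (int q * c - j * int p)\<bar> \<le> R ^ 11 * D / H"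
    using H0 unfolding r_def by (simp add: field_simps)
  then have "near p (R ^ 11 * D / H) (int q * c)" unfolding near_def by blast
  then show ?thesis using q1 q11 by blast
qed

text \<open>With g = a + X g0 the difference equals (t + u) (g0(t + u) - g0(t)) + u g0(t), so the
  leading coefficient comes out by induction without the binomial theorem. Stating it for the
  coefficient at \<open>Suc e\<close>, zero or not, spares a case distinction on the exact
  degree.\<close>

lemma difference_poly:
  fixes g :: "int poly"
  assumes "degree g \<le> Suc e"
  shows "\<exists>g'. degree g' \<le> e \<and> coeff g' e = int (Suc e) * u * coeff g (Suc e) \<and>
    (\<forall>t. poly g' t = poly g (t + u) - poly g t)"
  using assms
proof (induction e arbitrary: g)
  case 0
  have "coeff g (Suc (Suc i)) = 0" for i using 0 by (intro coeff_eq_0) simp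
  then have "g = [:coeff g 0, coeff g 1:]"
    by (intro poly_eqI) (auto simp: coeff_pCons split: nat.splits)
  then obtain a b where g: "g = [:a, b:]" by blast
  then show ?case by (intro exI[of _ "[:u * b:]"]) (simp add: algebra_simps)
next
  case (Suc e)
  obtain a g0 where g: "g = pCons a g0" by (cases g)
  have d0: "degree g0 \<le> Suc e" using Suc.prems unfolding g
    by (cases "g0 = 0") auto
  from Suc.IH[OF d0] obtain g' where g': "degree g' \<le> e"
    "coeff g' e = int (Suc e) * u * coeff g0 (Suc e)" "\<And>t. poly g' t = poly g0 (t + u) - poly g0 t"
    by blast
  let ?h = "[:u, 1:] * g' + smult u g0"
  have "degree ?h \<le> Suc e"
    using degree_mult_le[of "[:u, 1:]" g'] g' d0 degree_smult_le[of u g0]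
    by (intro degree_add_le) auto
  moreover have "coeff g' (Suc e) = 0" using g' by (intro coeff_eq_0) simp
  then have "coeff ?h (Suc e) = int (Suc (Suc e)) * u * coeff g (Suc (Suc e))"
    by (simp add: g g'(2) algebra_simps)
  moreover have "poly ?h t = poly g (t + u) - poly g t" for t
    by (simp add: g g'(3) algebra_simps)
  ultimately show ?case by blast
qed

text \<open>The pairs off the diagonal form two halves exchanged by swapping, so positive
  differences account for all of them.\<close>

lemma card_pairs_differences:
  fixes T :: "int set"
  assumes T: "T \<subseteq> {- int h..int h}"
  shows "(card T)\<^sup>2 \<le> card T + 2 * (\<Sum>u\<in>{1..2 * h}. card {t \<in> T. t + int u \<in> T})"
proof -
  have fT: "finite T" using T finite_subset by blast
  let ?lt = "{(t, t'). t \<in> T \<and> t' \<in> T \<and> t < t'}"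
  let ?D = "SIGMA u:{1..2 * h}. {t \<in> T. t + int u \<in> T}"
  have flt: "finite ?lt" by (rule finite_subset[of _ "T \<times> T"]) (use fT in auto)
  have "T \<times> T = (\<lambda>t. (t, t)) ` T \<union> ?lt \<union> prod.swap ` ?lt"
    by (force simp: image_iff)
  then have "card (T \<times> T) \<le> card ((\<lambda>t. (t, t)) ` T) + card ?lt + card (prod.swap ` ?lt)"
    using card_Un_le[of "(\<lambda>t. (t, t)) ` T \<union> ?lt" "prod.swap ` ?lt"]
      card_Un_le[of "(\<lambda>t. (t, t)) ` T" ?lt] by simp
  also have "\<dots> \<le> card T + 2 * card ?lt"
    using card_image_le[OF fT, of "\<lambda>t. (t, t)"] card_image_le[OF flt, of prod.swap] by simp
  also have "card ?lt \<le> card ?D"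
  proof (rule card_inj_on_le)
    show "inj_on (\<lambda>(t, t'). (nat (t' - t), t)) ?lt" by (auto simp: inj_on_def)
    show "(\<lambda>(t, t'). (nat (t' - t), t)) ` ?lt \<subseteq> ?D"
    proof
      fix y assume "y \<in> (\<lambda>(t, t'). (nat (t' - t), t)) ` ?lt"
      then obtain t t' where "y = (nat (t' - t), t)" "t \<in> T" "t' \<in> T" "t < t'" by auto
      moreover have "- int h \<le> t" "t' \<le> int h" using T \<open>t \<in> T\<close> \<open>t' \<in> T\<close> by auto
      ultimately show "y \<in> ?D" by auto
    qed
    show "finite ?D" using fT by auto
  qed
  also have "card ?D = (\<Sum>u\<in>{1..2 * h}. card {t \<in> T. t + int u \<in> T})"
    using fT by (intro card_SigmaI) auto
  finally show ?thesis by (simp add: power2_eq_square card_cartesian_product)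
qed

text \<open>Averaging: there are at least (card T)^2 / 4 \<ge> h^2 / (4 R^2) pairs t, t + u in
  \<open>T\<close>. The unpopular \<open>u\<close>, at most 2h of them with fewer than h/R' pairs
  each, make up at most half of this number by the choice of \<open>R'\<close>, and a popular
  \<open>u\<close> contributes at most 3h pairs.\<close>

lemma many_popular_differences:
  fixes T :: "int set" and R R' :: real
  assumes T: "T \<subseteq> {- int h..int h}" and dense: "real h \<le> R * card T" and R: "2 \<le> R"
    and h: "2 * R \<le> real h" and R': "16 * R\<^sup>2 \<le> R'"
  shows "real h \<le> 24 * R\<^sup>2 * card {u \<in> {1..2 * h}. real h \<le> R' * card {t \<in> T. t + int u \<in> T}}"
proof -
  define N where "N u = card {t \<in> T. t + int u \<in> T}" for u :: nat
  define U where "U = {u \<in> {1..2 * h}. real h \<le> R' * real (N u)}"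
  have fT: "finite T" using T finite_subset by blast
  have Rpos: "0 < R" "0 < R'" "0 < real h"
    using R h R' zero_less_power[of R 2] by (linarith, linarith, linarith)
  have N_le: "real (N u) \<le> 3 * real h" for u
  proof -
    have "N u \<le> card {- int h..int h}" unfolding N_def using T by (intro card_mono) auto
    then show ?thesis using Rpos(3) by simp
  qed
  have sq: "(real (card T))\<^sup>2 \<le> real (card T) + 2 * (\<Sum>u\<in>{1..2 * h}. real (N u))"
  proof -
    have "real ((card T)\<^sup>2) \<le> real (card T + 2 * (\<Sum>u\<in>{1..2 * h}. N u))"
      using card_pairs_differences[OF T] unfolding N_def of_nat_le_iff .
    then show ?thesis by simp
  qed
  have cT: "real h / R \<le> card T" using dense Rpos by (simp add: field_simps)
  have "2 \<le> real h / R" using h Rpos by (simp add: field_simps)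
  then have cT2: "2 \<le> real (card T)" using cT by linarith
  then have "real (card T) * 2 \<le> real (card T) * real (card T)" by (intro mult_left_mono) auto
  then have "(real (card T))\<^sup>2 / 2 \<le> 2 * (\<Sum>u\<in>{1..2 * h}. real (N u))"
    using sq by (simp add: power2_eq_square)
  moreover have "(real h / R)\<^sup>2 \<le> (real (card T))\<^sup>2" using cT Rpos by (intro power_mono) auto
  ultimately have "(real h)\<^sup>2 / R\<^sup>2 \<le> 4 * (\<Sum>u\<in>{1..2 * h}. real (N u))"
    by (simp add: power_divide)
  also have "(\<Sum>u\<in>{1..2 * h}. real (N u)) \<le>
      (\<Sum>u\<in>{1..2 * h}. (if u \<in> U then 3 * real h else 0) + real h / R')"
  proof (rule sum_mono)
    fix u assume "u \<in> {1..2 * h}"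
    then have "u \<notin> U \<Longrightarrow> R' * real (N u) < real h" unfolding U_def by auto
    then show "real (N u) \<le> (if u \<in> U then 3 * real h else 0) + real h / R'"
      using N_le[of u] Rpos by (auto simp: field_simps intro: add_increasing)
  qed
  also have "\<dots> = 3 * real h * card U + 2 * (real h)\<^sup>2 / R'"
  proof -
    have "{1..2 * h} \<inter> U = U" unfolding U_def by auto
    then show ?thesis
      by (simp add: sum.distrib sum.If_cases power2_eq_square)
  qed
  also have "2 * (real h)\<^sup>2 / R' \<le> 2 * (real h)\<^sup>2 / (16 * R\<^sup>2)"
    using Rpos R' by (intro divide_left_mono) auto
  finally have "(real h)\<^sup>2 / R\<^sup>2 \<le> 4 * (3 * real h * card U) + (real h)\<^sup>2 / R\<^sup>2 / 2"
    by simp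
  then have "(real h)\<^sup>2 / R\<^sup>2 \<le> 24 * real h * card U" by simp
  then have "real h * real h \<le> real h * (24 * R\<^sup>2 * card U)"
    using Rpos by (simp add: field_simps power2_eq_square)
  then show ?thesis using Rpos(3) unfolding U_def N_def by simp
qed

text \<open>Weyl differencing, carried out in physical space: for many \<open>u\<close> the difference
  \<open>g (t + u) - g t\<close>, of smaller degree, takes small values on a dense set.\<close>

definition small_values_force :: "nat \<Rightarrow> nat \<Rightarrow> bool" where
  "small_values_force e C \<longleftrightarrow> (\<forall>(p::nat) (h::nat) (R::real) (E::real) (g::int poly) (T::int set). degree g \<le> e \<longrightarrow> T \<subseteq> {- int h..int h} \<longrightarrow>
     real h \<le> R * card T \<longrightarrow> 2 \<le> R \<longrightarrow> 0 \<le> E \<longrightarrow> (\<forall>t\<in>T. near p E (poly g t)) \<longrightarrow>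
     R ^ C \<le> real h \<longrightarrow> R ^ C * E < real p \<longrightarrow>
     (\<exists>q::nat. 1 \<le> q \<and> real q \<le> R ^ C \<and> near p (R ^ C * E / real h ^ e) (int q * coeff g e)))"

lemma small_values_force_mono:
  assumes "small_values_force e C" and "C \<le> C'"
  shows "small_values_force e C'"
  unfolding small_values_force_def
proof (intro allI impI)
  fix p h :: nat and R E :: real and g :: "int poly" and T :: "int set"
  assume *: "degree g \<le> e" "T \<subseteq> {- int h..int h}" "real h \<le> R * card T" "2 \<le> R" "0 \<le> E"
    "\<forall>t\<in>T. near p E (poly g t)" "R ^ C' \<le> real h" "R ^ C' * E < real p"
  have R: "R ^ C \<le> R ^ C'" using assms(2) *(4) by (intro power_increasing) auto
  then have RE: "R ^ C * E \<le> R ^ C' * E" using *(5) by (intro mult_right_mono)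
  have "R ^ C \<le> real h" "R ^ C * E < real p" using R RE *(7,8) by linarith+
  then obtain q where q: "1 \<le> q" "real q \<le> R ^ C" "near p (R ^ C * E / real h ^ e) (int q * coeff g e)"
    using assms(1) *(1-6) unfolding small_values_force_def by blast
  have "R ^ C * E / real h ^ e \<le> R ^ C' * E / real h ^ e"
    using RE by (intro divide_right_mono) auto
  then show "\<exists>q::nat. 1 \<le> q \<and> real q \<le> R ^ C' \<and> near p (R ^ C' * E / real h ^ e) (int q * coeff g e)"
    using q R near_mono by (intro exI[of _ q]) auto
qed

lemma small_values_force_0: "small_values_force 0 0"
  unfolding small_values_force_def
proof (intro allI impI)
  fix p h :: nat and R E :: real and g :: "int poly" and T :: "int set"
  assume *: "degree g \<le> 0" "real h \<le> R * card T" "R ^ 0 \<le> real h"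
    "\<forall>t\<in>T. near p E (poly g t)"
  have "T \<noteq> {}" using *(2,3) by auto
  then obtain t where "near p E (poly g t)" using *(4) by auto
  moreover obtain a where "g = [:a:]" using *(1) degree_eq_zeroE by blast
  ultimately show "\<exists>q::nat. 1 \<le> q \<and> real q \<le> R ^ 0 \<and> near p (R ^ 0 * E / real h ^ 0) (int q * coeff g 0)"
    by (intro exI[of _ 1]) simp
qed

text \<open>For popular \<open>u\<close> the induction hypothesis, applied to the difference
  polynomial, gives a multiplier that depends on \<open>u\<close>. The box principle makes it
  constant on a subset, at the price of a factor \<open>P\<close>. What is then small is linear in
  \<open>u\<close>, and \<open>linear_small_values\<close> supplies the missing factor 1/h.\<close>

lemma small_values_force_Suc:
  assumes IH: "small_values_force e C"
  shows "small_values_force (Suc e) (11 * (6 * C + 8) + 6 * C + e + 1)"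
  unfolding small_values_force_def
proof (intro allI impI)
  let ?C = "11 * (6 * C + 8) + 6 * C + e + 1"
  fix p h :: nat and R E :: real and g :: "int poly" and T :: "int set"
  assume g: "degree g \<le> Suc e" and T: "T \<subseteq> {- int h..int h}" and dense: "real h \<le> R * card T"
    and R: "2 \<le> R" and E: "0 \<le> E" and small: "\<forall>t\<in>T. near p E (poly g t)"
    and h: "R ^ ?C \<le> real h" and p: "R ^ ?C * E < real p"
  have pow: "R ^ i \<le> R ^ j" if "i \<le> j" for i j using R that by (intro power_increasing) auto
  have R46: "16 \<le> R ^ 4" "48 \<le> R ^ 6" using power_mono[of 2 R 4] power_mono[of 2 R 6] R by simp_all
  have Rpos: "0 < R" using R by simp
  \<comment> \<open>\<open>R'\<close> is the inverse density of the sets of \<open>t\<close>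
    belonging to popular differences, where 16 R^2 \<le> R^6. \<open>P\<close> bounds the
    multipliers coming from the hypothesis. \<open>R''\<close> is the inverse density of the
    differences with a common multiplier, where 48 R^2 P \<le> R^6 R^2 P.\<close>
  define R' where "R' = R ^ 6"
  define P where "P = R' ^ C"
  define R'' where "R'' = R ^ (6 * C + 8)"
  have P: "P = R ^ (6 * C)" by (simp add: P_def R'_def power_mult)
  have P1: "1 \<le> P" unfolding P using R by simp
  have "R ^ 1 * 2 \<le> R ^ 1 * R" using R by simp
  also have "\<dots> = R ^ 2" by (simp add: power2_eq_square)
  also have "\<dots> \<le> R ^ ?C" by (intro pow) simp
  finally have h2: "2 * R \<le> real h" using h by simp
  then have h0: "1 \<le> real h" using R by simp
  have R': "16 * R\<^sup>2 \<le> R'"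
  proof -
    have "16 * R\<^sup>2 \<le> R ^ 4 * R\<^sup>2" using R46 by (intro mult_right_mono) auto
    then show ?thesis by (simp add: R'_def flip: power_add)
  qed
  have R'2: "2 \<le> R'" using R46 by (simp add: R'_def)
  define T' where "T' u = {t \<in> T. t + int u \<in> T}" for u
  define U where "U = {u \<in> {1..2 * h}. real h \<le> R' * card (T' u)}"
  have U: "real h \<le> 24 * R\<^sup>2 * card U"
    unfolding U_def T'_def by (rule many_popular_differences[OF T dense R h2 R'])
  have fU: "finite U" unfolding U_def by simp
  let ?c = "int (Suc e) * coeff g (Suc e)"
  have "\<exists>q::nat. 1 \<le> q \<and> real q \<le> P \<and> near p (P * (2 * E) / real h ^ e) (int q * (?c * int u))"
    if "u \<in> U" for u
  proof -
    obtain g' where g': "degree g' \<le> e" "coeff g' e = int (Suc e) * int u * coeff g (Suc e)"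
      "\<And>t. poly g' t = poly g (t + int u) - poly g t"
      using difference_poly[OF g] by blast
    have "near p (2 * E) (poly g' t)" if "t \<in> T' u" for t
      using that small near_diff[of p E "poly g (t + int u)" E "poly g t"]
      unfolding T'_def g'(3) by simp
    moreover have "T' u \<subseteq> {- int h..int h}" using T unfolding T'_def by blast
    moreover have "R' ^ C \<le> real h"
      using pow[of "6 * C" ?C] h unfolding P_def[symmetric] P by simp
    moreover have "R' ^ C * (2 * E) < real p"
    proof -
      have "R' ^ C * (2 * E) \<le> R' ^ C * (R * E)" using R E P1 by (intro mult_left_mono mult_right_mono) (auto simp: P_def)
      also have "\<dots> = R ^ (6 * C + 1) * E" by (simp add: R'_def flip: power_mult)
      also have "\<dots> \<le> R ^ ?C * E" using E by (intro mult_right_mono pow) auto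
      finally show ?thesis using p by simp
    qed
    moreover have "real h \<le> R' * card (T' u)" using that unfolding U_def by simp
    ultimately obtain q where "1 \<le> q" "real q \<le> R' ^ C" "near p (R' ^ C * (2 * E) / real h ^ e) (int q * coeff g' e)"
      using IH[unfolded small_values_force_def, rule_format, of g' "T' u" h R' "2 * E" p] g'(1) R'2 E
      by auto
    then show ?thesis unfolding g'(2) P_def by (intro exI[of _ q]) (simp add: mult_ac)
  qed
  then obtain Q where Q: "\<And>u. u \<in> U \<Longrightarrow> 1 \<le> Q u" "\<And>u. u \<in> U \<Longrightarrow> real (Q u) \<le> P"
    "\<And>u. u \<in> U \<Longrightarrow> near p (P * (2 * E) / real h ^ e) (int (Q u) * (?c * int u))"
    by metis
  have "Q \<in> U \<rightarrow> {1..nat \<lfloor>P\<rfloor>}" using Q(1,2) by (auto simp: le_nat_floor)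
  then obtain q where q: "q \<in> {1..nat \<lfloor>P\<rfloor>}" "card U \<le> card (Q -` {q} \<inter> U) * card {1..nat \<lfloor>P\<rfloor>}"
    using pigeonhole_card[of Q U "{1..nat \<lfloor>P\<rfloor>}"] fU P1 by (auto simp: le_nat_floor)
  define V where "V = Q -` {q} \<inter> U"
  have qP: "1 \<le> q" "real q \<le> P" using q(1) P1 by (auto simp: le_nat_iff le_floor_iff)
  have cUV: "real (card U) \<le> real (card V) * P"
  proof -
    have "real (card U) \<le> real (card V) * real (nat \<lfloor>P\<rfloor>)"
      using q(2) unfolding V_def[symmetric] by (metis card_atLeastAtMost diff_Suc_1 of_nat_le_iff of_nat_mult)
    also have "\<dots> \<le> real (card V) * P" using P1 by (intro mult_left_mono) auto
    finally show ?thesis .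
  qed
  have R''_eq: "R'' = R ^ 6 * (R\<^sup>2 * P)" unfolding R''_def P power_add[symmetric] by (simp add: add.commute)
  have R'': "2 * (24 * R\<^sup>2 * P) \<le> R''"
  proof -
    have "48 * (R\<^sup>2 * P) \<le> R ^ 6 * (R\<^sup>2 * P)" using R46 P1 by (intro mult_right_mono) auto
    then show ?thesis unfolding R''_eq by simp
  qed
  have R''2: "2 \<le> R''" using pow[of 1 "6 * C + 8"] R unfolding R''_def by simp
  have V_dense: "real (2 * h) \<le> R'' * card V"
  proof -
    have "real (2 * h) \<le> 2 * (24 * R\<^sup>2 * card U)"
      unfolding of_nat_mult of_nat_numeral using U by linarith
    also have "\<dots> \<le> 2 * (24 * R\<^sup>2 * (real (card V) * P))"
      using cUV by (intro mult_left_mono) auto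
    also have "\<dots> = 2 * (24 * R\<^sup>2 * P) * card V" by simp
    also have "\<dots> \<le> R'' * card V" using R'' by (intro mult_right_mono) auto
    finally show ?thesis .
  qed
  define D where "D = P * (2 * E) / real h ^ e"
  have D: "0 \<le> D" using P1 E by (simp add: D_def)
  have DE: "D \<le> P * (2 * E)"
  proof -
    have "P * (2 * E) / real h ^ e \<le> P * (2 * E) / 1"
      using P1 E h0 by (intro divide_left_mono) auto
    then show ?thesis by (simp add: D_def)
  qed
  have R''11: "R'' ^ 11 = R ^ (11 * (6 * C + 8))" by (simp add: R''_def mult.commute flip: power_mult)
  have "\<exists>q'::nat. 1 \<le> q' \<and> real q' \<le> R'' ^ 11 \<and>
      near p (R'' ^ 11 * D / (2 * h)) (int q' * (int q * ?c))"
  proof (rule linear_small_values)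
    show "V \<subseteq> {1..2 * h}" unfolding V_def U_def by auto
    show "near p D (int q * ?c * int u)" if "u \<in> V" for u
      using that Q(3)[of u] unfolding V_def D_def by (auto simp: mult_ac)
    show "R'' ^ 11 \<le> real (2 * h)"
      using pow[of "11 * (6 * C + 8)" ?C] h h0 unfolding R''11 by simp
    have "R'' ^ 11 * D \<le> R'' ^ 11 * (P * (2 * E))" using DE R''2 by (intro mult_left_mono) auto
    also have "\<dots> \<le> R'' ^ 11 * (P * (R * E))" using R E P1 R''2 by (intro mult_left_mono mult_right_mono) auto
    also have "\<dots> = R ^ (11 * (6 * C + 8) + 6 * C + 1) * E" unfolding R''11 P
      by (simp only: power_add power_one_right mult_ac)
    also have "\<dots> \<le> R ^ ?C * E" using E by (intro mult_right_mono pow) auto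
    finally show "R'' ^ 11 * D < real p" using p by simp
  qed (use V_dense R''2 D in auto)
  then obtain q' :: nat where q': "1 \<le> q'" "real q' \<le> R'' ^ 11"
    "near p (R'' ^ 11 * D / (2 * h)) (int q' * (int q * ?c))" by blast
  \<comment> \<open>The factor \<open>Suc e\<close> created by differencing cannot be divided out
    modulo \<open>p\<close>; it joins the multiplier and costs the last e + 1 powers of
    \<open>R\<close>.\<close>
  have "real (Suc e) \<le> 2 ^ Suc e" by (simp only: of_nat_less_two_power less_imp_le)
  also have "\<dots> \<le> R ^ Suc e" using R by (intro power_mono) auto
  finally have eR: "real (Suc e) \<le> R ^ (e + 1)" by simp
  have "real (q' * q * Suc e) \<le> R'' ^ 11 * P * R ^ (e + 1)"
    unfolding of_nat_mult using q' qP eR R''2 P1 by (intro mult_mono) auto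
  also have "\<dots> = R ^ ?C" unfolding R''11 P by (simp only: power_add[symmetric] add.assoc)
  finally have 1: "real (q' * q * Suc e) \<le> R ^ ?C" .
  have "R'' ^ 11 * D / (2 * h) = R ^ (11 * (6 * C + 8) + 6 * C) * E / real h ^ Suc e"
  proof -
    have "R'' ^ 11 * P = R ^ (11 * (6 * C + 8) + 6 * C)"
      unfolding R''11 P power_add[symmetric] ..
    moreover have "R'' ^ 11 * D / (2 * h) = (R'' ^ 11 * P) * E / real h ^ Suc e"
      unfolding D_def by (simp add: field_simps)
    ultimately show ?thesis by simp
  qed
  also have "\<dots> \<le> R ^ ?C * E / real h ^ Suc e"
    using E by (intro divide_right_mono mult_right_mono pow) auto
  finally have "near p (R ^ ?C * E / real h ^ Suc e) (int q' * (int q * ?c))"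
    using q'(3) near_mono by blast
  moreover have "int (q' * q * Suc e) * coeff g (Suc e) = int q' * (int q * ?c)"
    by (simp only: of_nat_mult mult_ac)
  ultimately have "near p (R ^ ?C * E / real h ^ Suc e) (int (q' * q * Suc e) * coeff g (Suc e))"
    by (simp only:)
  moreover have "1 \<le> q' * q * Suc e" using q'(1) qP(1) by (simp add: Suc_le_eq)
  ultimately show "\<exists>q::nat. 1 \<le> q \<and> real q \<le> R ^ ?C \<and> near p (R ^ ?C * E / real h ^ Suc e) (int q * coeff g (Suc e))"
    using 1 by blast
qed

section \<open>The proportion of small values of a fixed nonzero polynomial\<close>

lemma small_values_force_uniform: "\<exists>C. \<forall>e\<le>n. small_values_force e C"
proof -
  have "\<exists>C. small_values_force e C" for e
    by (induction e) (use small_values_force_0 small_values_force_Suc in blast)+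
  then obtain C where C: "\<And>e. small_values_force e (C e)" by metis
  have "small_values_force e (\<Sum>i\<le>n. C i)" if "e \<le> n" for e
    using that by (intro small_values_force_mono[OF C] member_le_sum) auto
  then show ?thesis by blast
qed

text \<open>The order of the quantifiers is essential: \<open>theorem9\<close> chooses the number
  \<open>d\<close> of points from \<delta>, decoding with \<open>d\<close> points then loses a
  factor that depends on \<open>d\<close>, and only this loss determines \<kappa>. So \<delta> must
  not depend on \<kappa>, which is paid for by \<open>p0\<close> alone.\<close>

lemma small_value_fraction:
  fixes \<epsilon> :: real and n :: nat
  assumes \<epsilon>: "\<epsilon> > 0" and n: "n \<ge> 1"
  shows "\<exists>\<delta>>0. \<forall>\<kappa>\<ge>1. \<exists>p0::nat. \<forall>(p::nat) (\<Delta>::real) (h::nat) (k::nat) (c :: nat \<Rightarrow> int).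
     prime p \<and> p \<ge> p0 \<and> \<Delta> \<ge> 1 \<and> 1 \<le> h \<and> 2 * h < p \<and> 1 \<le> k \<and> k \<le> n \<and>
     real h ^ k > \<Delta> * real p powr \<epsilon> \<and> \<Delta> < real p powr (1 - \<epsilon>) \<and>
     (\<exists>j\<in>{k..n}. \<not> int p dvd c j) \<longrightarrow>
     real (card {t \<in> {- int h..int h}. near p (\<kappa> * \<Delta>) (\<Sum>j=k..n. c j * t ^ j)}) \<le> real h * real p powr - \<delta>"
proof -
  obtain C where C: "\<And>e. e \<le> n \<Longrightarrow> small_values_force e C"
    using small_values_force_uniform by blast
  \<comment> \<open>For R = p^\<delta> the factor \<open>n\<close> yields R^C \<le> h, since all
    that is known about \<open>h\<close> is that h^n exceeds p^\<epsilon>; the factor 2 leaves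
    p^(\<epsilon>/2) to absorb \<kappa>.\<close>
  define \<delta> where "\<delta> = \<epsilon> / (2 * real n * (real C + 1))"
  have \<delta>: "0 < \<delta>" unfolding \<delta>_def using \<epsilon> n by (simp add: add_pos_nonneg)
  have \<delta>C: "n * (\<delta> * C) \<le> \<epsilon> / 2"
  proof -
    have "real n > 0" "real C + 1 > 0" using n by auto
    then have "n * (\<delta> * C) = \<epsilon> / 2 * (C / (real C + 1))" unfolding \<delta>_def by (simp add: divide_simps)
    also have "\<dots> \<le> \<epsilon> / 2 * 1" using \<epsilon> by (intro mult_left_mono) auto
    finally show ?thesis by simp
  qed
  have \<delta>C1: "\<delta> * C \<le> \<epsilon> / 2"
  proof -
    have "1 * (\<delta> * C) \<le> n * (\<delta> * C)" using n \<delta> by (intro mult_right_mono) auto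
    then show ?thesis using \<delta>C by simp
  qed
  have "\<exists>p0::nat. \<forall>(p::nat) (\<Delta>::real) (h::nat) (k::nat) (c :: nat \<Rightarrow> int).
     prime p \<and> p \<ge> p0 \<and> \<Delta> \<ge> 1 \<and> 1 \<le> h \<and> 2 * h < p \<and> 1 \<le> k \<and> k \<le> n \<and>
     real h ^ k > \<Delta> * real p powr \<epsilon> \<and> \<Delta> < real p powr (1 - \<epsilon>) \<and>
     (\<exists>j\<in>{k..n}. \<not> int p dvd c j) \<longrightarrow>
     real (card {t \<in> {- int h..int h}. near p (\<kappa> * \<Delta>) (\<Sum>j=k..n. c j * t ^ j)}) \<le> real h * real p powr - \<delta>"
    if \<kappa>: "\<kappa> \<ge> 1" for \<kappa> :: real
  proof -
    \<comment> \<open>The first summand gives R \<ge> 2, the second \<kappa> <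
      p^(\<epsilon>/2).\<close>
    define p0 where "p0 = nat \<lceil>2 powr (1 / \<delta>)\<rceil> + nat \<lceil>(\<kappa> + 1) powr (2 / \<epsilon>)\<rceil>"
    show ?thesis
    proof (intro exI[of _ p0] allI impI, elim conjE)
      fix p h k :: nat and \<Delta> :: real and c :: "nat \<Rightarrow> int"
      assume p: "prime p" "p0 \<le> p" and \<Delta>: "1 \<le> \<Delta>" and h: "1 \<le> h" "2 * h < p" and k: "1 \<le> k" "k \<le> n"
        and hk: "\<Delta> * real p powr \<epsilon> < real h ^ k" and \<Delta>p: "\<Delta> < real p powr (1 - \<epsilon>)"
        and c: "\<exists>j\<in>{k..n}. \<not> int p dvd c j"
      have p1: "1 < real p" using prime_gt_1_nat[OF p(1)] by simp
      have p0: "2 powr (1 / \<delta>) \<le> real p" "(\<kappa> + 1) powr (2 / \<epsilon>) \<le> real p"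
        using p(2) unfolding p0_def by linarith+
      define R where "R = real p powr \<delta>"
      have "(2 powr (1 / \<delta>)) powr \<delta> \<le> R" unfolding R_def using p0(1) \<delta> by (intro powr_mono2) auto
      then have R: "2 \<le> R" using \<delta> by (simp add: powr_powr)
      have "((\<kappa> + 1) powr (2 / \<epsilon>)) powr (\<epsilon> / 2) \<le> real p powr (\<epsilon> / 2)"
        using p0(2) \<epsilon> by (intro powr_mono2) auto
      then have \<kappa>p: "\<kappa> < real p powr (\<epsilon> / 2)" using \<epsilon> \<kappa> by (simp add: powr_powr)
      have RC: "R ^ C = real p powr (\<delta> * C)"
        using p1 by (simp add: R_def powr_powr flip: powr_realpow)
      have RC2: "R ^ C \<le> real p powr (\<epsilon> / 2)" unfolding RC using \<delta>C1 p1 by (intro powr_mono) auto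
      have RC\<kappa>: "R ^ C * \<kappa> < real p powr \<epsilon>"
      proof -
        have "R ^ C * \<kappa> < real p powr (\<epsilon> / 2) * real p powr (\<epsilon> / 2)"
          using RC2 \<kappa>p \<kappa> R p1 by (intro mult_le_less_imp_less) auto
        then show ?thesis by (simp flip: powr_add)
      qed
      have RC\<Delta>: "R ^ C * (\<kappa> * \<Delta>) < real p powr \<epsilon> * \<Delta>"
        using mult_strict_right_mono[OF RC\<kappa>, of \<Delta>] \<Delta> by (simp add: mult.assoc)
      have Rh: "R ^ C \<le> real h"
      proof -
        have "(R ^ C) ^ n = real p powr (n * (\<delta> * C))"
          unfolding RC using p1 by (simp add: powr_powr mult.commute flip: powr_realpow)
        also have "\<dots> \<le> real p powr \<epsilon>" using \<delta>C \<epsilon> p1 by (intro powr_mono) auto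
        also have "\<dots> \<le> \<Delta> * real p powr \<epsilon>" using \<Delta> p1 by simp
        also have "\<dots> < real h ^ k" by (rule hk)
        also have "\<dots> \<le> real h ^ n" using h k by (intro power_increasing) auto
        finally show ?thesis using power_less_imp_less_base[of "R ^ C" n "real h"] by simp
      qed
      have Rp: "R ^ C * (\<kappa> * \<Delta>) < real p"
      proof -
        have "real p powr \<epsilon> * \<Delta> \<le> real p powr \<epsilon> * real p powr (1 - \<epsilon>)"
          using \<Delta>p by (intro mult_left_mono) auto
        also have "\<dots> = real p" using p1 by (simp flip: powr_add)
        finally show ?thesis using RC\<Delta> by simp
      qed
      \<comment> \<open>Cutting off above the last coefficient that survives modulo \<open>p\<close>
        changes no value modulo \<open>p\<close> and makes the leading coefficient prime to
        \<open>p\<close>. Since e \<ge> k, the hypothesis on h^k applies to h^e.\<close>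
      define e where "e = Max {j \<in> {k..n}. \<not> int p dvd c j}"
      have "e \<in> {j \<in> {k..n}. \<not> int p dvd c j}" unfolding e_def using c by (intro Max_in) auto
      then have e: "k \<le> e" "e \<le> n" "\<not> int p dvd c e" by auto
      have e_max: "int p dvd c j" if "j \<in> {e<..n}" for j
      proof (rule ccontr)
        assume "\<not> int p dvd c j"
        then have "j \<le> e" unfolding e_def using that e by (intro Max_ge) auto
        then show False using that by simp
      qed
      define g :: "int poly" where "g = (\<Sum>j=k..e. monom (c j) j)"
      have g_deg: "degree g \<le> e" unfolding g_def
        by (intro degree_sum_le) (auto intro: order_trans[OF degree_monom_le])
      have g_e: "coeff g e = c e" using e by (simp add: g_def coeff_sum)
      have g_t: "poly g t = (\<Sum>j=k..e. c j * t ^ j)" for t by (simp add: g_def poly_sum poly_monom)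
      let ?T = "{t \<in> {- int h..int h}. near p (\<kappa> * \<Delta>) (\<Sum>j=k..n. c j * t ^ j)}"
      have near_g: "near p (\<kappa> * \<Delta>) (poly g t)" if "t \<in> ?T" for t
      proof (rule near_cong)
        show "near p (\<kappa> * \<Delta>) (\<Sum>j=k..n. c j * t ^ j)" using that by simp
        have "(\<Sum>j=k..n. c j * t ^ j) = (\<Sum>j=k..e. c j * t ^ j) + (\<Sum>j\<in>{e<..n}. c j * t ^ j)"
          using e by (subst sum.union_disjoint[symmetric]) (auto intro: sum.cong)
        then have "poly g t - (\<Sum>j=k..n. c j * t ^ j) = - (\<Sum>j\<in>{e<..n}. c j * t ^ j)"
          unfolding g_t by simp
        then show "int p dvd poly g t - (\<Sum>j=k..n. c j * t ^ j)"
          using e_max by (auto intro!: dvd_sum dvd_mult2)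
      qed
      show "real (card ?T) \<le> real h * real p powr - \<delta>"
      proof (rule ccontr)
        assume "\<not> real (card ?T) \<le> real h * real p powr - \<delta>"
        then have "real h / R < real (card ?T)" by (simp add: R_def powr_minus_divide)
        then have dense: "real h \<le> R * card ?T" using R by (simp add: field_simps)
        have "\<exists>q::nat. 1 \<le> q \<and> real q \<le> R ^ C \<and> near p (R ^ C * (\<kappa> * \<Delta>) / real h ^ e) (int q * coeff g e)"
        proof (rule C[OF e(2), unfolded small_values_force_def, rule_format, where T = ?T])
          show "near p (\<kappa> * \<Delta>) (poly g t)" if "t \<in> ?T" for t using that by (rule near_g)
          show "real h \<le> R * card ?T" by (rule dense)
        qed (use g_deg R Rh Rp \<kappa> \<Delta> in auto)
        then obtain q :: nat where q: "1 \<le> q" "real q \<le> R ^ C" "near p (R ^ C * (\<kappa> * \<Delta>) / real h ^ e) (int q * c e)"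
          unfolding g_e by blast
        have "R ^ C * (\<kappa> * \<Delta>) < real h ^ k" using RC\<Delta> hk by (simp add: mult.commute)
        also have "\<dots> \<le> real h ^ e" using h e by (intro power_increasing) auto
        finally have "R ^ C * (\<kappa> * \<Delta>) / real h ^ e < 1" using h by simp
        then have "int p dvd int q * c e" using q(3) near_less_1 by blast
        then have "int p dvd int q" using e(3) p(1) prime_dvd_mult_iff[of "int p"] by auto
        then have "p \<le> q" using q(1) by (auto dest: dvd_imp_le)
        then show False using q(2) Rh h by linarith
      qed
    qed
  qed
  then show ?thesis using \<delta> by blast
qed

section \<open>Independent uniform points\<close>

lemma measure_pair_pmf_times:
  "measure_pmf.prob (pair_pmf P Q) (A \<times> B) = measure_pmf.prob P A * measure_pmf.prob Q B"
proof -
  have "emeasure (measure_pmf (pair_pmf P Q)) (A \<times> B) = (\<integral>\<^sup>+z. indicator (A \<times> B) z \<partial>measure_pmf (pair_pmf P Q))"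
    by simp
  also have "\<dots> = (\<integral>\<^sup>+x. \<integral>\<^sup>+y. indicator A x * indicator B y \<partial>measure_pmf Q \<partial>measure_pmf P)"
    unfolding nn_integral_pair_pmf' by (intro nn_integral_cong) (auto simp: indicator_def)
  also have "\<dots> = (\<integral>\<^sup>+x. indicator A x * emeasure (measure_pmf Q) B \<partial>measure_pmf P)"
    by (subst nn_integral_cmult) auto
  also have "\<dots> = emeasure (measure_pmf P) A * emeasure (measure_pmf Q) B"
    by (subst nn_integral_multc) auto
  finally show ?thesis by (simp add: measure_def enn2real_mult)
qed

lemma prob_replicate_pmf_all:
  "measure_pmf.prob (replicate_pmf d P) {ts. set ts \<subseteq> A} = measure_pmf.prob P A ^ d"
proof (induction d)
  case 0
  show ?case by (simp add: measure_return_pmf)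
next
  case (Suc d)
  have eq: "replicate_pmf (Suc d) P = map_pmf (\<lambda>(x, xs). x # xs) (pair_pmf P (replicate_pmf d P))"
    by (simp add: pair_pmf_def map_bind_pmf map_pmf_def bind_assoc_pmf bind_return_pmf)
  have "(\<lambda>(x, xs). x # xs) -` {ts. set ts \<subseteq> A} = A \<times> {ts. set ts \<subseteq> A}" by auto
  then have "measure_pmf.prob (replicate_pmf (Suc d) P) {ts. set ts \<subseteq> A}
      = measure_pmf.prob (pair_pmf P (replicate_pmf d P)) (A \<times> {ts. set ts \<subseteq> A})"
    unfolding eq by simp
  also have "\<dots> = measure_pmf.prob P A * measure_pmf.prob (replicate_pmf d P) {ts. set ts \<subseteq> A}"
    by (rule measure_pair_pmf_times)
  finally show ?case using Suc by simp
qed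

section \<open>Programs that evaluate arithmetic functions\<close>

lemma bits_le_Suc_iff: "bits x \<le> Suc b \<longleftrightarrow> \<bar>x\<bar> < 2 ^ b"
proof -
  have "bits x \<le> Suc b \<longleftrightarrow> bitlen \<bar>x\<bar> \<le> int b"
    using bitlen_nonneg[of "\<bar>x\<bar>"] unfolding bits_def by linarith
  also have "\<dots> \<longleftrightarrow> \<bar>x\<bar> < 2 ^ b"
    using bitlen_le_iff_power[of "\<bar>x\<bar>" b] by simp
  finally show ?thesis .
qed

lemma bits_ge_1: "1 \<le> bits x"
  by (simp add: bits_def)

lemma abs_less_power_bits: "\<bar>x\<bar> < 2 ^ (bits x - 1)"
  using bits_le_Suc_iff[of x "bits x - 1"] bits_ge_1[of x] by simp

lemma bits_mono: "\<bar>x\<bar> \<le> \<bar>y\<bar> \<Longrightarrow> bits x \<le> bits y"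
  using bits_le_Suc_iff[of x "bits y - 1"] abs_less_power_bits[of y] bits_ge_1[of y]
  by simp

lemma bits_uminus [simp]: "bits (- x) = bits x"
  by (simp add: bits_def)

lemma bits_add: "bits (x + y) \<le> bits x + bits y"
proof -
  have "\<bar>x + y\<bar> \<le> \<bar>x\<bar> + \<bar>y\<bar>" by (rule abs_triangle_ineq)
  also have "\<dots> < 2 ^ (bits x - 1) + 2 ^ (bits y - 1)"
    using abs_less_power_bits[of x] abs_less_power_bits[of y] by linarith
  also have "\<dots> \<le> 2 ^ (bits x + bits y - 2) + (2::int) ^ (bits x + bits y - 2)"
    using bits_ge_1[of x] bits_ge_1[of y]
    by (intro add_mono power_increasing) auto
  also have "\<dots> = 2 ^ Suc (bits x + bits y - 2)" by simp
  also have "Suc (bits x + bits y - 2) = bits x + bits y - 1"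
    using bits_ge_1[of x] bits_ge_1[of y] by simp
  finally show ?thesis
    using bits_le_Suc_iff[of "x + y" "bits x + bits y - 1"] bits_ge_1[of x] by simp
qed

lemma bits_diff: "bits (x - y) \<le> bits x + bits y"
  using bits_add[of x "- y"] by simp

lemma bits_mult: "bits (x * y) \<le> bits x + bits y"
proof -
  have "\<bar>x * y\<bar> \<le> 2 ^ (bits x - 1) * 2 ^ (bits y - 1)"
    unfolding abs_mult using abs_less_power_bits[of x] abs_less_power_bits[of y]
    by (intro mult_mono) auto
  also have "\<dots> = 2 ^ (bits x + bits y - 2)"
    using bits_ge_1[of x] bits_ge_1[of y] by (simp flip: power_add)
  also have "\<dots> < (2::int) ^ (bits x + bits y - 1)"
    using bits_ge_1[of x] bits_ge_1[of y] by (intro power_strict_increasing) auto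
  finally show ?thesis
    using bits_le_Suc_iff[of "x * y" "bits x + bits y - 1"] bits_ge_1[of x] by simp
qed

text \<open>Rounding downwards does not spoil this: for x < 0 < y the quotient is an integer between
  \<open>x\<close> and -1.\<close>

lemma abs_div_le: "\<bar>x div y\<bar> \<le> \<bar>x\<bar>" for x y :: int
proof -
  have pos: "\<bar>x div y\<bar> \<le> \<bar>x\<bar>" if "y > 0" for x y :: int
  proof (cases "x \<ge> 0")
    case True
    then show ?thesis using that
      by (metis abs_of_nonneg div_by_1 pos_imp_zdiv_nonneg_iff zdiv_mono2 int_one_le_iff_zero_less zero_less_one)
  next
    case False
    have "x * 1 \<ge> x * y" using False that by (intro mult_left_mono_neg) auto
    then have "x * y div y \<le> x div y" using that by (intro zdiv_mono1) auto
    then have "x \<le> x div y" using that by simp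
    moreover have "x div y < 0" using False that by (simp add: div_neg_pos_less0)
    ultimately show ?thesis using False by linarith
  qed
  consider "y > 0" | "y = 0" | "y < 0" by linarith
  then show ?thesis
  proof cases
    case 3
    then have "\<bar>(- x) div (- y)\<bar> \<le> \<bar>- x\<bar>" by (intro pos) simp
    then show ?thesis by simp
  qed (use pos in auto)
qed

lemma bits_div: "bits (x div y) \<le> bits x"
  by (intro bits_mono abs_div_le)

text \<open>A predicate on functions of the memory rather than on syntax, so that it can be verified
  for mathematical definitions as they stand; \<open>arith_exp\<close> produces the expression and
  its cost once and for all. Cells are read at fixed addresses only.\<close>

inductive arith :: "nat set \<Rightarrow> (mem \<Rightarrow> int) \<Rightarrow> bool" for S where
  const: "arith S (\<lambda>_. c)"
| cell: "i \<in> S \<Longrightarrow> arith S (\<lambda>M. M (int i))"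
| add: "arith S F \<Longrightarrow> arith S G \<Longrightarrow> arith S (\<lambda>M. F M + G M)"
| diff: "arith S F \<Longrightarrow> arith S G \<Longrightarrow> arith S (\<lambda>M. F M - G M)"
| mult: "arith S F \<Longrightarrow> arith S G \<Longrightarrow> arith S (\<lambda>M. F M * G M)"
| div: "arith S F \<Longrightarrow> arith S G \<Longrightarrow> arith S (\<lambda>M. F M div G M)"

lemma arith_local:
  assumes "arith S F" and "\<And>i. i \<in> S \<Longrightarrow> M (int i) = M' (int i)"
  shows "F M = F M'"
  using assms(1) by induction (auto simp: assms(2))

text \<open>The factor depends on the expression alone: lengths grow linearly and cost quadratically
  in the length of the operands, however deeply the expression is nested.\<close>

definition cost_bound :: "nat set \<Rightarrow> exp \<Rightarrow> nat \<Rightarrow> bool" where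
  "cost_bound S e \<kappa> \<longleftrightarrow> (\<forall>M B. 1 \<le> B \<longrightarrow> (\<forall>i\<in>S. bits (M (int i)) \<le> B) \<longrightarrow>
     bits (aval e M) \<le> \<kappa> * B \<and> acost e M \<le> \<kappa> * B\<^sup>2)"

lemma cost_bound_bin:
  assumes a: "cost_bound S a \<kappa>" and b: "cost_bound S b \<kappa>'"
    and v: "\<And>M. bits (aval e M) \<le> bits (aval a M) + bits (aval b M)"
    and c: "\<And>M. acost e M = acost a M + acost b M + bits (aval a M) * bits (aval b M)"
  shows "cost_bound S e (\<kappa> + \<kappa>' + \<kappa> * \<kappa>')"
  unfolding cost_bound_def
proof (intro allI impI conjI)
  fix M :: mem and B :: nat
  assume B: "1 \<le> B" and M: "\<forall>i\<in>S. bits (M (int i)) \<le> B"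
  from a b B M have *: "bits (aval a M) \<le> \<kappa> * B" "acost a M \<le> \<kappa> * B\<^sup>2"
      "bits (aval b M) \<le> \<kappa>' * B" "acost b M \<le> \<kappa>' * B\<^sup>2"
    unfolding cost_bound_def by blast+
  show "bits (aval e M) \<le> (\<kappa> + \<kappa>' + \<kappa> * \<kappa>') * B"
    using v[of M] *(1,3) by (simp add: algebra_simps)
  have "bits (aval a M) * bits (aval b M) \<le> (\<kappa> * B) * (\<kappa>' * B)"
    using *(1,3) by (intro mult_le_mono)
  then show "acost e M \<le> (\<kappa> + \<kappa>' + \<kappa> * \<kappa>') * B\<^sup>2"
    using c[of M] *(2,4) by (simp add: algebra_simps power2_eq_square)
qed

lemma arith_exp:
  assumes "arith S F"
  shows "\<exists>e \<kappa>. (\<forall>M. aval e M = F M) \<and> cost_bound S e \<kappa>"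
  using assms
proof induction
  case (const c)
  have "cost_bound S (Const c) (bits c)"
    unfolding cost_bound_def by simp
  then show ?case by (intro exI[of _ "Const c"]) auto
next
  case (cell i)
  have "cost_bound S (Mem (Const (int i))) (2 * bits (int i) + 1)"
    unfolding cost_bound_def
  proof (intro allI impI conjI)
    fix M :: mem and B :: nat
    assume B: "1 \<le> B" and M: "\<forall>i\<in>S. bits (M (int i)) \<le> B"
    from M cell have *: "bits (M (int i)) \<le> B" by blast
    then show "bits (aval (Mem (Const (int i))) M) \<le> (2 * bits (int i) + 1) * B" by simp
    have "B \<le> B\<^sup>2" "1 \<le> B\<^sup>2" using B by (simp_all add: power2_eq_square)
    then have "2 * bits (int i) * 1 + B \<le> 2 * bits (int i) * B\<^sup>2 + B\<^sup>2"
      by (intro add_mono mult_mono) auto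
    then show "acost (Mem (Const (int i))) M \<le> (2 * bits (int i) + 1) * B\<^sup>2"
      using * by (simp add: algebra_simps)
  qed
  then show ?case by (intro exI[of _ "Mem (Const (int i))"]) auto
next
  case (add F G)
  then obtain a \<kappa> b \<kappa>' where "\<forall>M. aval a M = F M" "cost_bound S a \<kappa>"
      "\<forall>M. aval b M = G M" "cost_bound S b \<kappa>'" by blast
  then show ?case
    by (intro exI[of _ "Add a b"] exI[of _ "\<kappa> + \<kappa>' + \<kappa> * \<kappa>'"] conjI)
       (auto intro!: cost_bound_bin simp: bits_add)
next
  case (diff F G)
  then obtain a \<kappa> b \<kappa>' where "\<forall>M. aval a M = F M" "cost_bound S a \<kappa>"
      "\<forall>M. aval b M = G M" "cost_bound S b \<kappa>'" by blast
  then show ?case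
    by (intro exI[of _ "Sub a b"] exI[of _ "\<kappa> + \<kappa>' + \<kappa> * \<kappa>'"] conjI)
       (auto intro!: cost_bound_bin simp: bits_diff)
next
  case (mult F G)
  then obtain a \<kappa> b \<kappa>' where "\<forall>M. aval a M = F M" "cost_bound S a \<kappa>"
      "\<forall>M. aval b M = G M" "cost_bound S b \<kappa>'" by blast
  then show ?case
    by (intro exI[of _ "Mul a b"] exI[of _ "\<kappa> + \<kappa>' + \<kappa> * \<kappa>'"] conjI)
       (auto intro!: cost_bound_bin simp: bits_mult)
next
  case (div F G)
  then obtain a \<kappa> b \<kappa>' where "\<forall>M. aval a M = F M" "cost_bound S a \<kappa>"
      "\<forall>M. aval b M = G M" "cost_bound S b \<kappa>'" by blast
  then show ?case
    by (intro exI[of _ "Div a b"] exI[of _ "\<kappa> + \<kappa>' + \<kappa> * \<kappa>'"] conjI)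
       (auto intro!: cost_bound_bin simp: bits_div trans_le_add1)
qed

section \<open>Block assignments and the loop\<close>

definition upd :: "nat \<Rightarrow> nat \<Rightarrow> (nat \<Rightarrow> int) \<Rightarrow> mem \<Rightarrow> mem" where
  "upd c r f M = (\<lambda>x. if int c \<le> x \<and> x < int (c + r) then f (nat x - c) else M x)"

lemma upd_in: "i < r \<Longrightarrow> upd c r f M (int (c + i)) = f i"
  unfolding upd_def nat_int by simp

lemma upd_out: "i \<notin> {c..<c + r} \<Longrightarrow> upd c r f M (int i) = M (int i)"
  by (auto simp: upd_def)

lemma upd_Suc: "upd c (Suc r) f M = (upd c r f M)(int (c + r) := f r)"
proof
  fix x
  show "upd c (Suc r) f M x = ((upd c r f M)(int (c + r) := f r)) x"
    by (cases "x = int (c + r)") (auto simp: upd_def simp del: of_nat_add)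
qed

definition runs :: "prog \<Rightarrow> nat \<Rightarrow> nat set \<Rightarrow> (mem \<Rightarrow> mem) \<Rightarrow> bool" where
  "runs P \<kappa> S \<phi> \<longleftrightarrow> (\<forall>M B. 1 \<le> B \<longrightarrow> (\<forall>i\<in>S. bits (M (int i)) \<le> B) \<longrightarrow>
     (\<exists>T. exec P M T (\<phi> M) \<and> T \<le> \<kappa> * B\<^sup>2))"

text \<open>The stores are executed one after the other, but the cells that the expressions read are
  disjoint from the target block, so each one still sees the original values.\<close>

lemma assign:
  assumes "\<And>i. i < r \<Longrightarrow> arith S (F i)" and "S \<inter> {c..<c + r} = {}"
  shows "\<exists>P \<kappa>. runs P \<kappa> S (\<lambda>M. upd c r (\<lambda>i. F i M) M)"
  using assms
proof (induction r)
  case 0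
  have "runs Skip 1 S (\<lambda>M. upd c 0 (\<lambda>i. F i M) M)"
    unfolding runs_def
  proof (intro allI impI)
    fix M :: mem and B :: nat
    assume "1 \<le> B"
    have "upd c 0 (\<lambda>i. F i M) M = M" by (auto simp: upd_def fun_eq_iff)
    moreover have "1 \<le> 1 * B\<^sup>2" using \<open>1 \<le> B\<close> by (simp add: power2_eq_square)
    ultimately show "\<exists>T. exec Skip M T (upd c 0 (\<lambda>i. F i M) M) \<and> T \<le> 1 * B\<^sup>2"
      using exec.Skip[of M] by metis
  qed
  then show ?case by blast
next
  case (Suc r)
  have "S \<inter> {c..<c + r} = {}" using Suc.prems(2) by auto
  then obtain P \<kappa> where P: "runs P \<kappa> S (\<lambda>M. upd c r (\<lambda>i. F i M) M)"
    using Suc by (meson less_Suc_eq)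
  obtain e \<kappa>' where e: "\<And>M. aval e M = F r M" and ce: "cost_bound S e \<kappa>'"
    using arith_exp[of S "F r"] Suc.prems(1)[of r] by blast
  let ?a = "Const (int (c + r))"
  let ?\<kappa> = "\<kappa> + 2 * bits (int (c + r)) + 2 * \<kappa>'"
  have "runs (Seq P (Store ?a e)) ?\<kappa> S (\<lambda>M. upd c (Suc r) (\<lambda>i. F i M) M)"
    unfolding runs_def
  proof (intro allI impI)
    fix M :: mem and B :: nat
    assume B: "1 \<le> B" and M: "\<forall>i\<in>S. bits (M (int i)) \<le> B"
    define N where "N = upd c r (\<lambda>i. F i M) M"
    have N: "N (int i) = M (int i)" if "i \<in> S" for i
      unfolding N_def using that Suc.prems(2) by (intro upd_out) auto
    from P B M obtain T where T: "exec P M T N" "T \<le> \<kappa> * B\<^sup>2"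
      unfolding runs_def N_def by blast
    have FN: "aval e N = F r M"
      unfolding e using Suc.prems(1)[of r] N by (metis arith_local lessI)
    have c: "bits (aval e N) \<le> \<kappa>' * B" "acost e N \<le> \<kappa>' * B\<^sup>2"
      using ce B M N unfolding cost_bound_def by auto
    let ?T = "acost ?a N + acost e N + bits (aval ?a N) + bits (aval e N)"
    have "exec (Store ?a e) N ?T (N(aval ?a N := aval e N))"
      by (rule exec.Store)
    then have "exec (Seq P (Store ?a e)) M (T + ?T) (upd c (Suc r) (\<lambda>i. F i M) M)"
      using T(1) FN unfolding upd_Suc N_def[symmetric] by (auto intro: exec.Seq)
    moreover have "T + ?T \<le> ?\<kappa> * B\<^sup>2"
    proof -
      have B2: "B \<le> B\<^sup>2" "1 \<le> B\<^sup>2" using B by (simp_all add: power2_eq_square)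
      have "2 * bits (int (c + r)) * 1 \<le> 2 * bits (int (c + r)) * B\<^sup>2" "\<kappa>' * B \<le> \<kappa>' * B\<^sup>2"
        using B2 by (auto intro: mult_le_mono)
      moreover have "?\<kappa> * B\<^sup>2 = \<kappa> * B\<^sup>2 + 2 * bits (int (c + r)) * B\<^sup>2 + 2 * (\<kappa>' * B\<^sup>2)"
        by (simp add: algebra_simps)
      moreover have "acost ?a N + bits (aval ?a N) = 2 * bits (int (c + r))" by simp
      ultimately show ?thesis using c T(2) by linarith
    qed
    ultimately show "\<exists>T. exec (Seq P (Store ?a e)) M T (upd c (Suc r) (\<lambda>i. F i M) M) \<and> T \<le> ?\<kappa> * B\<^sup>2"
      by blast
  qed
  then show ?case by blast
qed

text \<open>The second copy of the state \<open>v\<close> is the buffer that makes a simultaneous assignment to all of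
  its components possible.\<close>

definition enc :: "nat \<Rightarrow> int list \<Rightarrow> (nat \<Rightarrow> int) \<Rightarrow> mem" where
  "enc r xs v = upd (length xs) r v (upd (length xs + r) r v (load xs))"

lemma enc_input: "i < length xs \<Longrightarrow> enc r xs v (int i) = xs ! i"
  by (simp add: enc_def upd_def load_def)

lemma enc_state: "i < r \<Longrightarrow> enc r xs v (int (length xs + i)) = v i"
  unfolding enc_def by (rule upd_in)

lemma bits_load:
  assumes "\<forall>x\<in>set xs. bits x \<le> B" and "1 \<le> B"
  shows "bits (load xs y) \<le> B"
  using assms by (auto simp: load_def bits_def)

lemma bits_enc:
  assumes "\<forall>x\<in>set xs. bits x \<le> B" "1 \<le> B" "\<And>i. i < r \<Longrightarrow> bits (v i) \<le> B"
  shows "bits (enc r xs v y) \<le> B"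
  unfolding enc_def upd_def using bits_load[OF assms(1,2)] assms(3) by auto

text \<open>The new values are computed from the state into the buffer and then copied back. The
  case \<open>M = load xs\<close> is the initialization, when neither copy of the state exists
  yet.\<close>

lemma simultaneous_assign:
  assumes "\<And>i. i < r \<Longrightarrow> arith {..<c + r} (F i)"
  shows "\<exists>P \<kappa>. \<forall>M B v xs. length xs = c \<longrightarrow> 1 \<le> B \<longrightarrow> (\<forall>i. bits (M i) \<le> B) \<longrightarrow>
     (M = load xs \<or> M = enc r xs v) \<longrightarrow> (\<forall>i<r. bits (F i M) \<le> B) \<longrightarrow>
     (\<exists>T. exec P M T (enc r xs (\<lambda>i. F i M)) \<and> T \<le> \<kappa> * B\<^sup>2)"
proof -
  obtain P \<kappa> where P: "runs P \<kappa> {..<c + r} (\<lambda>M. upd (c + r) r (\<lambda>i. F i M) M)"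
    using assign[of r "{..<c + r}" F "c + r"] assms by fastforce
  have "arith {c + r..<c + r + r} (\<lambda>M. M (int (c + r + i)))" if "i < r" for i
    using that by (intro arith.cell) auto
  then obtain Q \<kappa>' where Q: "runs Q \<kappa>' {c + r..<c + r + r} (\<lambda>M. upd c r (\<lambda>i. M (int (c + r + i))) M)"
    using assign[of r "{c + r..<c + r + r}" "\<lambda>i M. M (int (c + r + i))" c] by fastforce
  have "\<exists>T. exec (Seq P Q) M T (enc r xs (\<lambda>i. F i M)) \<and> T \<le> (\<kappa> + \<kappa>') * B\<^sup>2"
    if xs: "length xs = c" and B: "1 \<le> B" and M: "\<forall>i. bits (M i) \<le> B"
      and Mx: "M = load xs \<or> M = enc r xs v" and FB: "\<forall>i<r. bits (F i M) \<le> B"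
    for M B v xs
  proof -
    let ?N = "upd (c + r) r (\<lambda>i. F i M) M"
    obtain T where T: "exec P M T ?N" "T \<le> \<kappa> * B\<^sup>2"
      using P B M unfolding runs_def by blast
    have "\<forall>i\<in>{c + r..<c + r + r}. bits (?N (int i)) \<le> B"
      using FB by (auto simp: upd_def)
    then obtain T' where T': "exec Q ?N T' (upd c r (\<lambda>i. ?N (int (c + r + i))) ?N)" "T' \<le> \<kappa>' * B\<^sup>2"
      using Q B unfolding runs_def by blast
    have "upd c r (\<lambda>i. ?N (int (c + r + i))) ?N = enc r xs (\<lambda>i. F i M)"
    proof
      fix x
      have "nat (int r + x) - (length xs + r) = nat x - length xs" if "int (length xs) \<le> x"
        using that by linarith
      then show "upd c r (\<lambda>i. ?N (int (c + r + i))) ?N x = enc r xs (\<lambda>i. F i M) x"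
        using Mx xs unfolding enc_def by (auto simp: upd_def)
    qed
    then show ?thesis using exec.Seq[OF T(1) T'(1)] T(2) T'(2)
      by (intro exI[of _ "T + T'"]) (auto simp: algebra_simps)
  qed
  then show ?thesis by blast
qed

text \<open>The first component of the state is the loop counter.\<close>

lemma loop_program:
  assumes init: "\<And>i. i < r \<Longrightarrow> arith {..<c + r} (init i)"
    and step: "\<And>i. i < r \<Longrightarrow> arith {..<c + r} (step i)"
    and fin: "\<And>i. i < r \<Longrightarrow> arith {..<c + r} (fin i)"
    and r: "0 < r" "m \<le> r" "m \<le> c"
  shows "\<exists>A \<kappa>. \<forall>xs B t v.
     length xs = c \<longrightarrow> 1 \<le> B \<longrightarrow> (\<forall>x\<in>set xs. bits x \<le> B) \<longrightarrow>
     v 0 = (\<lambda>i. init i (load xs)) \<longrightarrow>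
     (\<forall>s<t. v s 0 > 0 \<and> v (Suc s) = (\<lambda>i. step i (enc r xs (v s)))) \<longrightarrow> v t 0 \<le> 0 \<longrightarrow>
     (\<forall>s\<le>t. \<forall>i<r. bits (v s i) \<le> B) \<longrightarrow> (\<forall>i<r. bits (fin i (enc r xs (v t))) \<le> B) \<longrightarrow>
     (\<exists>T M'. exec A (load xs) T M' \<and> T \<le> \<kappa> * (t + 1) * B\<^sup>2 \<and>
        (\<forall>i<m. M' (int i) = fin i (enc r xs (v t))))"
proof -
  obtain P1 \<kappa>1 where P1: "\<And>M B v xs. length xs = c \<Longrightarrow> 1 \<le> B \<Longrightarrow> \<forall>i. bits (M i) \<le> B \<Longrightarrow>
     M = load xs \<or> M = enc r xs v \<Longrightarrow> \<forall>i<r. bits (init i M) \<le> B \<Longrightarrow>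
     \<exists>T. exec P1 M T (enc r xs (\<lambda>i. init i M)) \<and> T \<le> \<kappa>1 * B\<^sup>2"
    using simultaneous_assign[of r c init, OF init] by metis
  obtain P2 \<kappa>2 where P2: "\<And>M B v xs. length xs = c \<Longrightarrow> 1 \<le> B \<Longrightarrow> \<forall>i. bits (M i) \<le> B \<Longrightarrow>
     M = load xs \<or> M = enc r xs v \<Longrightarrow> \<forall>i<r. bits (step i M) \<le> B \<Longrightarrow>
     \<exists>T. exec P2 M T (enc r xs (\<lambda>i. step i M)) \<and> T \<le> \<kappa>2 * B\<^sup>2"
    using simultaneous_assign[of r c step, OF step] by metis
  obtain P3 \<kappa>3 where P3: "\<And>M B v xs. length xs = c \<Longrightarrow> 1 \<le> B \<Longrightarrow> \<forall>i. bits (M i) \<le> B \<Longrightarrow>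
     M = load xs \<or> M = enc r xs v \<Longrightarrow> \<forall>i<r. bits (fin i M) \<le> B \<Longrightarrow>
     \<exists>T. exec P3 M T (enc r xs (\<lambda>i. fin i M)) \<and> T \<le> \<kappa>3 * B\<^sup>2"
    using simultaneous_assign[of r c fin, OF fin] by metis
  have "arith {c..<c + r} (\<lambda>M. M (int (c + i)))" if "i < m" for i
    using that r by (intro arith.cell) auto
  \<comment> \<open>The results move from the state to the output cells 0, ..., m - 1;
    \<open>m \<le> c\<close> keeps these disjoint from the cells still to be read.\<close>
  then obtain P4 \<kappa>4 where P4: "runs P4 \<kappa>4 {c..<c + r} (\<lambda>M. upd 0 m (\<lambda>i. M (int (c + i))) M)"
    using assign[of m "{c..<c + r}" "\<lambda>i M. M (int (c + i))" 0] r by fastforce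
  define b where "b = Mem (Const (int c))"
  define W where "W = WhilePos b P2"
  define A where "A = Seq P1 (Seq W (Seq P3 P4))"
  define \<kappa>b where "\<kappa>b = 2 * bits (int c) + 2"
  define \<kappa> where "\<kappa> = \<kappa>1 + \<kappa>3 + \<kappa>4 + \<kappa>2 + \<kappa>b"
  have "\<exists>T M'. exec A (load xs) T M' \<and> T \<le> \<kappa> * (t + 1) * B\<^sup>2 \<and>
        (\<forall>i<m. M' (int i) = fin i (enc r xs (v t)))"
    if xs: "length xs = c" and B: "1 \<le> B" and xsB: "\<forall>x\<in>set xs. bits x \<le> B"
      and v0: "v 0 = (\<lambda>i. init i (load xs))"
      and vS: "\<forall>s<t. v s 0 > 0 \<and> v (Suc s) = (\<lambda>i. step i (enc r xs (v s)))"
      and vt: "v t 0 \<le> 0"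
      and vB: "\<forall>s\<le>t. \<forall>i<r. bits (v s i) \<le> B"
      and fB: "\<forall>i<r. bits (fin i (enc r xs (v t))) \<le> B" for xs B t v
  proof -
    define E where "E s = enc r xs (v s)" for s
    have EB: "bits (E s i) \<le> B" if "s \<le> t" for s i
      unfolding E_def using that vB xsB B by (intro bits_enc) auto
    have Ec: "E s (int c) = v s 0" for s
      unfolding E_def using enc_state[of 0 r xs "v s"] xs r by simp
    have cb: "acost b (E s) + bits (aval b (E s)) \<le> \<kappa>b * B\<^sup>2" if "s \<le> t" for s
    proof -
      have B2: "B \<le> B\<^sup>2" "1 \<le> B\<^sup>2" using B by (simp_all add: power2_eq_square)
      have "2 * bits (int c) * 1 \<le> 2 * bits (int c) * B\<^sup>2" using B2 by (intro mult_le_mono) auto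
      moreover have "bits (E s (int c)) \<le> B" using EB that by blast
      moreover have "\<kappa>b * B\<^sup>2 = 2 * bits (int c) * B\<^sup>2 + 2 * B\<^sup>2"
        by (simp add: \<kappa>b_def algebra_simps)
      moreover have "acost b (E s) + bits (aval b (E s)) = 2 * bits (int c) + 2 * bits (E s (int c))"
        by (simp add: b_def)
      ultimately show ?thesis using B2 by linarith
    qed
    have W: "\<exists>T. exec W (E s) T (E t) \<and> T \<le> (\<kappa>2 + \<kappa>b) * (t - s + 1) * B\<^sup>2" if "s \<le> t" for s
      using that
    proof (induction "t - s" arbitrary: s)
      case 0
      then have "s = t" by simp
      have "\<not> aval b (E t) > 0" using Ec[of t] vt by (simp add: b_def)
      then have "exec W (E t) (acost b (E t) + bits (aval b (E t))) (E t)"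
        unfolding W_def by (rule exec.WhileFalse)
      moreover have "\<kappa>b * B\<^sup>2 \<le> (\<kappa>2 + \<kappa>b) * (t - s + 1) * B\<^sup>2" by simp
      ultimately show ?case using cb[of t] \<open>s = t\<close> by (meson le_trans order_refl)
    next
      case (Suc u)
      then have s: "s < t" "u = t - Suc s" by auto
      have "v s 0 > 0" and vs: "v (Suc s) = (\<lambda>i. step i (E s))"
        using vS s unfolding E_def by auto
      then have pos: "aval b (E s) > 0" using Ec[of s] by (simp add: b_def)
      have "\<forall>i<r. bits (step i (E s)) \<le> B" using vs vB s by (metis Suc_leI)
      then obtain T1 where T1: "exec P2 (E s) T1 (E (Suc s))" "T1 \<le> \<kappa>2 * B\<^sup>2"
        using P2[OF xs B, of "E s" "v s"] EB s vs unfolding E_def by auto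
      obtain T2 where T2: "exec W (E (Suc s)) T2 (E t)" "T2 \<le> (\<kappa>2 + \<kappa>b) * (t - Suc s + 1) * B\<^sup>2"
        using Suc.hyps(1)[of "Suc s"] s by auto
      let ?T = "acost b (E s) + bits (aval b (E s)) + T1 + T2"
      have "exec W (E s) ?T (E t)"
        using exec.WhileTrue[OF pos T1(1) T2(1)[unfolded W_def]] unfolding W_def .
      moreover have "?T \<le> (\<kappa>2 + \<kappa>b) * (t - s + 1) * B\<^sup>2"
      proof -
        have "t - s + 1 = (t - Suc s + 1) + 1" using s by simp
        then have "(\<kappa>2 + \<kappa>b) * (t - s + 1) * B\<^sup>2
            = (\<kappa>2 + \<kappa>b) * (t - Suc s + 1) * B\<^sup>2 + \<kappa>2 * B\<^sup>2 + \<kappa>b * B\<^sup>2"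
          by (simp only:) (simp add: algebra_simps)
        then show ?thesis using cb[of s] T1(2) T2(2) s by linarith
      qed
      ultimately show ?case by blast
    qed
    obtain T1 where T1: "exec P1 (load xs) T1 (E 0)" "T1 \<le> \<kappa>1 * B\<^sup>2"
      using P1[OF xs B, of "load xs" "v 0"] bits_load[OF xsB B] v0 vB unfolding E_def by fastforce
    obtain T2 where T2: "exec W (E 0) T2 (E t)" "T2 \<le> (\<kappa>2 + \<kappa>b) * (t + 1) * B\<^sup>2"
      using W[of 0] by auto
    define E' where "E' = enc r xs (\<lambda>i. fin i (E t))"
    obtain T3 where T3: "exec P3 (E t) T3 E'" "T3 \<le> \<kappa>3 * B\<^sup>2"
      using P3[OF xs B, of "E t" "v t"] EB fB unfolding E'_def E_def by fastforce
    have "bits (E' i) \<le> B" for i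
      unfolding E'_def using fB xsB B unfolding E_def by (intro bits_enc) auto
    then obtain T4 where T4: "exec P4 E' T4 (upd 0 m (\<lambda>i. E' (int (c + i))) E')" "T4 \<le> \<kappa>4 * B\<^sup>2"
      using P4 B unfolding runs_def by blast
    have "exec A (load xs) (T1 + (T2 + (T3 + T4))) (upd 0 m (\<lambda>i. E' (int (c + i))) E')"
      unfolding A_def by (intro exec.Seq[OF T1(1)] exec.Seq[OF T2(1)] exec.Seq[OF T3(1) T4(1)])
    moreover have "T1 + (T2 + (T3 + T4)) \<le> \<kappa> * (t + 1) * B\<^sup>2"
    proof -
      have "(\<kappa>1 + \<kappa>3 + \<kappa>4) * 1 * B\<^sup>2 \<le> (\<kappa>1 + \<kappa>3 + \<kappa>4) * (t + 1) * B\<^sup>2"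
        by (intro mult_le_mono) auto
      then show ?thesis using T1(2) T2(2) T3(2) T4(2)
        unfolding \<kappa>_def by (simp add: algebra_simps)
    qed
    moreover have "upd 0 m (\<lambda>i. E' (int (c + i))) E' (int i) = fin i (enc r xs (v t))" if "i < m" for i
      using that r enc_state[of i r xs "\<lambda>i. fin i (E t)"] xs
      unfolding E'_def E_def by (simp add: upd_def)
    ultimately show ?thesis by blast
  qed
  then show ?thesis by blast
qed

section \<open>Lattice basis reduction\<close>

definition rvec :: "(nat \<Rightarrow> int) \<Rightarrow> nat \<Rightarrow> real" where
  "rvec x = (\<lambda>l. real_of_int (x l))"

text \<open>The inner product is an argument because in the program it varies with the memory,
  through the prime, the points and the approximations.\<close>

function star :: "((nat \<Rightarrow> real) \<Rightarrow> (nat \<Rightarrow> real) \<Rightarrow> real) \<Rightarrow> (nat \<Rightarrow> nat \<Rightarrow> int) \<Rightarrow> nat \<Rightarrow> nat \<Rightarrow> real" where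
  "star ip b i = (\<lambda>l. rvec (b i) l -
     (\<Sum>j<i. ip (star ip b j) (rvec (b i)) / ip (star ip b j) (star ip b j) * star ip b j l))"
  by pat_completeness auto
termination by (relation "Wellfounded.measure (\<lambda>(ip, b, i). i)") auto

declare star.simps [simp del]

definition nrm :: "((nat \<Rightarrow> real) \<Rightarrow> (nat \<Rightarrow> real) \<Rightarrow> real) \<Rightarrow> (nat \<Rightarrow> nat \<Rightarrow> int) \<Rightarrow> nat \<Rightarrow> real" where
  "nrm ip b i = ip (star ip b i) (star ip b i)"

definition mu :: "((nat \<Rightarrow> real) \<Rightarrow> (nat \<Rightarrow> real) \<Rightarrow> real) \<Rightarrow> (nat \<Rightarrow> nat \<Rightarrow> int) \<Rightarrow> nat \<Rightarrow> (nat \<Rightarrow> real) \<Rightarrow> real" where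
  "mu ip b i x = ip (star ip b i) x / nrm ip b i"

text \<open>Rounding proceeds from the last row downwards, since subtracting row \<open>j\<close>
  disturbs only the Gram-Schmidt coefficients at \<open>j\<close> and below. Each row is reduced by
  the original rows and not by reduced ones, so the rows are independent of one another.\<close>

primrec reduce_vec :: "((nat \<Rightarrow> real) \<Rightarrow> (nat \<Rightarrow> real) \<Rightarrow> real) \<Rightarrow> (nat \<Rightarrow> nat \<Rightarrow> int) \<Rightarrow> nat \<Rightarrow> (nat \<Rightarrow> int) \<Rightarrow> nat \<Rightarrow> int" where
  "reduce_vec ip b 0 x = x"
| "reduce_vec ip b (Suc j) x = reduce_vec ip b j (\<lambda>l. x l - \<lfloor>mu ip b j (rvec x) + 1 / 2\<rfloor> * b j l)"

definition reduce :: "((nat \<Rightarrow> real) \<Rightarrow> (nat \<Rightarrow> real) \<Rightarrow> real) \<Rightarrow> (nat \<Rightarrow> nat \<Rightarrow> int) \<Rightarrow> nat \<Rightarrow> nat \<Rightarrow> int" where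
  "reduce ip b i = reduce_vec ip b i (b i)"

definition swap_rows :: "nat \<Rightarrow> (nat \<Rightarrow> nat \<Rightarrow> int) \<Rightarrow> nat \<Rightarrow> nat \<Rightarrow> int" where
  "swap_rows i b = (\<lambda>j. b (if j = i then Suc i else if j = Suc i then i else j))"

text \<open>At most one swap per call, at the last violation of Siegel's condition. The test may use
  the norms of the unreduced rows, as reduction preserves them. All rows are reduced in every call,
  which keeps the entries bounded at all times.\<close>

primrec swap_last :: "((nat \<Rightarrow> real) \<Rightarrow> (nat \<Rightarrow> real) \<Rightarrow> real) \<Rightarrow> nat \<Rightarrow> (nat \<Rightarrow> nat \<Rightarrow> int) \<Rightarrow> nat \<Rightarrow> nat \<Rightarrow> int" where
  "swap_last ip 0 b = reduce ip b"
| "swap_last ip (Suc i) b = (if 2 * nrm ip b (Suc i) < nrm ip b i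
     then swap_rows i (reduce ip b) else swap_last ip i b)"

section \<open>Forms diagonalized along a basis\<close>

definition linfun :: "((nat \<Rightarrow> real) \<Rightarrow> real) \<Rightarrow> bool" where
  "linfun f \<longleftrightarrow> (\<forall>x y c. f (\<lambda>l. x l + c * y l) = f x + c * f y)"

lemma linfun_add_mult: "linfun f \<Longrightarrow> f (\<lambda>l. x l + c * y l) = f x + c * f y"
  by (simp add: linfun_def)

lemma linfun_diff_mult: "linfun f \<Longrightarrow> f (\<lambda>l. x l - c * y l) = f x - c * f y"
  using linfun_add_mult[of f x "- c" y] by simp

lemma linfun_comb: "linfun f \<Longrightarrow> linfun g \<Longrightarrow> linfun (\<lambda>x. (a * f x + c * g x) / d)"
  by (simp add: linfun_def algebra_simps add_divide_distrib)

lemma linfun_diff: "linfun f \<Longrightarrow> linfun g \<Longrightarrow> linfun (\<lambda>x. f x - c * g x)"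
  by (simp add: linfun_def algebra_simps)

lemma linfun_sum:
  assumes "linfun f" and "finite J"
  shows "f (\<lambda>l. x l + (\<Sum>j\<in>J. c j * y j l)) = f x + (\<Sum>j\<in>J. c j * f (y j))"
  using assms(2)
proof (induction J)
  case empty
  then show ?case by simp
next
  case (insert a J)
  have "f (\<lambda>l. x l + (\<Sum>j\<in>insert a J. c j * y j l)) = f (\<lambda>l. (x l + (\<Sum>j\<in>J. c j * y j l)) + c a * y a l)"
    using insert by (simp add: algebra_simps)
  also have "\<dots> = f (\<lambda>l. x l + (\<Sum>j\<in>J. c j * y j l)) + c a * f (y a)"
    by (rule linfun_add_mult[OF assms(1)])
  finally show ?case using insert by simp
qed

lemma sq_le_quarter: "\<bar>z\<bar> \<le> 1 / 2 \<Longrightarrow> z\<^sup>2 \<le> (1 / 2)\<^sup>2" for z :: real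
  using power_mono[of "\<bar>z\<bar>" "1 / 2" 2] by simp

definition lll_step :: "((nat \<Rightarrow> real) \<Rightarrow> (nat \<Rightarrow> real) \<Rightarrow> real) \<Rightarrow> nat \<Rightarrow> (nat \<Rightarrow> nat \<Rightarrow> int) \<Rightarrow> nat \<Rightarrow> nat \<Rightarrow> int" where
  "lll_step ip N b = swap_last ip (N - 1) b"

definition form_ip :: "nat \<Rightarrow> (nat \<Rightarrow> real) \<Rightarrow> (nat \<Rightarrow> (nat \<Rightarrow> real) \<Rightarrow> real) \<Rightarrow> (nat \<Rightarrow> real) \<Rightarrow> (nat \<Rightarrow> real) \<Rightarrow> real" where
  "form_ip N W lam x y = (\<Sum>i<N. W i * lam i x * lam i y)"

text \<open>In the application the weights are the squared Gram-Schmidt norms of the initial basis,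
  so \<open>m\<close> and \<open>X\<close> are the bounds between which all later norms
  remain.\<close>

locale quad_form =
  fixes N :: nat and W :: "nat \<Rightarrow> real" and lam :: "nat \<Rightarrow> (nat \<Rightarrow> real) \<Rightarrow> real" and m X :: real
  assumes lam_lin: "i < N \<Longrightarrow> linfun (lam i)"
    and W_bounds: "i < N \<Longrightarrow> m \<le> W i \<and> W i \<le> X"
    and m_pos: "0 < m"
begin

abbreviation ip :: "(nat \<Rightarrow> real) \<Rightarrow> (nat \<Rightarrow> real) \<Rightarrow> real" where
  "ip \<equiv> form_ip N W lam"

text \<open>The Gram-Schmidt data of the rows \<open>b 0, \<dots>, b (N - 1)\<close>: \<open>B i\<close> is the squared norm of the
  \<open>i\<close>-th orthogonalized row, and \<open>L i x\<close> the coefficient of that row in \<open>x\<close>. Row \<open>N\<close> is not part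
  of the basis: it is the vector to be decoded.\<close>

definition gso :: "(nat \<Rightarrow> nat \<Rightarrow> int) \<Rightarrow> (nat \<Rightarrow> real) \<Rightarrow> (nat \<Rightarrow> (nat \<Rightarrow> real) \<Rightarrow> real) \<Rightarrow> bool" where
  "gso b B L \<longleftrightarrow> (\<forall>i<N. m \<le> B i \<and> B i \<le> X) \<and> (\<forall>i<N. linfun (L i)) \<and>
     (\<forall>x y. ip x y = (\<Sum>i<N. B i * L i x * L i y)) \<and>
     (\<forall>i<N. \<forall>j<i. L i (rvec (b j)) = 0) \<and> (\<forall>i<N. L i (rvec (b i)) = 1)"

lemma gso_pos: "gso b B L \<Longrightarrow> i < N \<Longrightarrow> 0 < B i"
  unfolding gso_def using m_pos by force

lemma ip_nonneg: "0 \<le> ip x x"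
  unfolding form_ip_def using W_bounds m_pos
  by (intro sum_nonneg) (smt (verit) lessThan_iff mult.assoc mult_nonneg_nonneg zero_le_square)

text \<open>This links the computed orthogonalization to the abstract data \<open>B\<close> and
  \<open>L\<close>. Afterwards a reduction or a swap only has to exhibit new data satisfying
  \<open>gso\<close>, and the recursion for \<open>star\<close> is never unfolded again.\<close>

lemma gso_star:
  assumes g: "gso b B L" and "i < N" "l < N"
  shows "L l (star ip b i) = (if l = i then 1 else 0)"
  using assms(2,3)
proof (induction i arbitrary: l rule: less_induct)
  case (less i)
  define c where "c j = ip (star ip b j) (rvec (b i)) / ip (star ip b j) (star ip b j)" for j
  have lin: "\<And>l. l < N \<Longrightarrow> linfun (L l)" and ipL: "\<And>x y. ip x y = (\<Sum>i<N. B i * L i x * L i y)"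
    using g unfolding gso_def by blast+
  have ips: "ip (star ip b j) x = B j * L j x" if "j < i" for j x
  proof -
    have "ip (star ip b j) x = (\<Sum>l<N. if l = j then B j * L j x else 0)"
      unfolding ipL[of "star ip b j"] using less.IH[OF that] that less.prems by (intro sum.cong) auto
    then show ?thesis using that less.prems by simp
  qed
  have c: "c j = L j (rvec (b i))" if "j < i" for j
    using gso_pos[OF g, of j] that less.prems less.IH[OF that, of j] unfolding c_def
    by (simp add: ips)
  have "star ip b i = (\<lambda>t. rvec (b i) t + (\<Sum>j<i. (- c j) * star ip b j t))"
    unfolding star.simps[of ip b i] c_def by (simp add: sum_negf)
  then have "L l (star ip b i) = L l (rvec (b i)) + (\<Sum>j<i. (- c j) * L l (star ip b j))"
    by (simp only: linfun_sum[OF lin[OF less.prems(2)] finite_lessThan])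
  also have "(\<Sum>j<i. (- c j) * L l (star ip b j)) = (\<Sum>j<i. if j = l then - c l else 0)"
    using less by (intro sum.cong) auto
  also have "\<dots> = (if l < i then - c l else 0)" by simp
  finally have "L l (star ip b i) = L l (rvec (b i)) + (if l < i then - c l else 0)" .
  moreover have "L l (rvec (b i)) = 0" if "i < l"
    using g that less.prems unfolding gso_def by blast
  moreover have "L i (rvec (b i)) = 1" using g less.prems unfolding gso_def by blast
  ultimately show ?case using c[of l] by (cases l i rule: linorder_cases) auto
qed

lemma gso_ip_star:
  assumes g: "gso b B L" and i: "i < N"
  shows "ip (star ip b i) x = B i * L i x"
proof -
  have "ip (star ip b i) x = (\<Sum>l<N. if l = i then B i * L i x else 0)"
  proof -
    have "ip (star ip b i) x = (\<Sum>l<N. B l * L l (star ip b i) * L l x)"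
      using g unfolding gso_def by blast
    also have "\<dots> = (\<Sum>l<N. if l = i then B i * L i x else 0)"
      by (intro sum.cong) (auto simp: gso_star[OF g i])
    finally show ?thesis .
  qed
  then show ?thesis using i by simp
qed

lemma gso_nrm: "gso b B L \<Longrightarrow> i < N \<Longrightarrow> nrm ip b i = B i"
  by (simp add: nrm_def gso_ip_star gso_star)

lemma gso_mu: "gso b B L \<Longrightarrow> i < N \<Longrightarrow> mu ip b i x = L i x"
  using gso_pos[of b B L i] by (simp add: mu_def gso_nrm gso_ip_star)

lemma gso_reduce_vec:
  assumes g: "gso b B L" and "i \<le> N"
  shows "(\<forall>l<N. i \<le> l \<longrightarrow> L l (rvec (reduce_vec ip b i x)) = L l (rvec x)) \<and>
    (\<forall>l<i. \<bar>L l (rvec (reduce_vec ip b i x))\<bar> \<le> 1 / 2)"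
  using assms(2)
proof (induction i arbitrary: x)
  case 0
  then show ?case by simp
next
  case (Suc i)
  define c where "c = \<lfloor>mu ip b i (rvec x) + 1 / 2\<rfloor>"
  define x' where "x' = (\<lambda>l. x l - c * b i l)"
  have "rvec x' = (\<lambda>l. rvec x l - real_of_int c * rvec (b i) l)"
    by (simp add: x'_def rvec_def)
  then have Lx': "L l (rvec x') = L l (rvec x) - real_of_int c * L l (rvec (b i))" if "l < N" for l
    using g that linfun_diff_mult[of "L l"] unfolding gso_def by simp
  have IH: "\<forall>l<N. i \<le> l \<longrightarrow> L l (rvec (reduce_vec ip b i x')) = L l (rvec x')"
    "\<forall>l<i. \<bar>L l (rvec (reduce_vec ip b i x'))\<bar> \<le> 1 / 2"
    using Suc.IH[of x'] Suc.prems by auto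
  have r: "reduce_vec ip b (Suc i) x = reduce_vec ip b i x'"
    by (simp add: x'_def c_def)
  have "L l (rvec x') = L l (rvec x)" if "Suc i \<le> l" "l < N" for l
    using g that Lx'[OF that(2)] unfolding gso_def by simp
  moreover have "\<bar>L i (rvec x')\<bar> \<le> 1 / 2"
  proof -
    have "L i (rvec (b i)) = 1" using g Suc.prems unfolding gso_def by simp
    then have "L i (rvec x') = L i (rvec x) - real_of_int \<lfloor>L i (rvec x) + 1 / 2\<rfloor>"
      using Lx'[of i] Suc.prems gso_mu[OF g, of i] by (simp add: c_def)
    then show ?thesis by linarith
  qed
  ultimately show ?case using IH Suc.prems unfolding r by (auto simp: less_Suc_eq)
qed

lemma gso_reduce:
  assumes g: "gso b B L"
  shows "gso (reduce ip b) B L"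
proof -
  have "L l (rvec (reduce ip b i)) = L l (rvec (b i))" if "i \<le> l" "l < N" for l i
    using gso_reduce_vec[OF g, of i "b i"] that unfolding reduce_def by simp
  then show ?thesis using g unfolding gso_def by simp
qed

lemma gso_reduce_half:
  assumes g: "gso b B L" and "l < i" "i \<le> N"
  shows "\<bar>L l (rvec (reduce ip b i))\<bar> \<le> 1 / 2"
  using gso_reduce_vec[OF g, of i "b i"] assms(2,3) unfolding reduce_def by simp

text \<open>After reduction all coefficients are at most 1 in absolute value and all norms at most
  \<open>X\<close>. The bound therefore holds after any number of rounds, and for the vector to be
  decoded (i = N) as well.\<close>

lemma ip_reduce_le:
  assumes g: "gso b B L" and i: "i \<le> N"
  shows "ip (rvec (reduce ip b i)) (rvec (reduce ip b i)) \<le> N * X"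
proof -
  let ?r = "rvec (reduce ip b i)"
  have g': "gso (reduce ip b) B L" by (rule gso_reduce[OF g])
  have "\<bar>L l ?r\<bar> \<le> 1" if "l < N" for l
  proof (cases l i rule: linorder_cases)
    case less
    then show ?thesis using gso_reduce_half[OF g less i] by simp
  qed (use g' that in \<open>auto simp: gso_def\<close>)
  then have L1: "(L l ?r)\<^sup>2 \<le> 1" if "l < N" for l using that by (simp add: abs_square_le_1)
  have "ip ?r ?r = (\<Sum>l<N. B l * L l ?r * L l ?r)"
    using g unfolding gso_def by blast
  also have "\<dots> \<le> (\<Sum>l<N. X)"
  proof (rule sum_mono)
    fix l assume "l \<in> {..<N}"
    then have "B l * (L l ?r)\<^sup>2 \<le> B l * 1" "B l \<le> X"
      using L1[of l] gso_pos[OF g, of l] g by (auto simp: gso_def intro!: mult_left_mono)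
    then show "B l * L l ?r * L l ?r \<le> X" by (simp add: power2_eq_square mult.assoc)
  qed
  finally show ?thesis by simp
qed

text \<open>The logarithm of the product of the Gram determinants of the leading rows, which is the
  product of the B_i^(N - i), normalized by \<open>m\<close> so that every term is
  nonnegative.\<close>

definition potential :: "(nat \<Rightarrow> real) \<Rightarrow> real" where
  "potential B = (\<Sum>i<N. real (N - i) * ln (B i / m))"

lemma potential_nonneg: "gso b B L \<Longrightarrow> 0 \<le> potential B"
  unfolding potential_def gso_def using m_pos by (auto intro!: sum_nonneg mult_nonneg_nonneg)

lemma potential_le:
  assumes "gso b B L" and "m \<le> X"
  shows "potential B \<le> real N ^ 2 * ln (X / m)"
proof -
  have "potential B \<le> (\<Sum>i<N. real N * ln (X / m))"
    unfolding potential_def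
  proof (rule sum_mono)
    fix i assume "i \<in> {..<N}"
    then have "m \<le> B i" "B i \<le> X" using assms(1) by (auto simp: gso_def)
    then have "0 \<le> ln (B i / m)" "ln (B i / m) \<le> ln (X / m)"
      using m_pos by (auto intro!: ln_mono divide_right_mono)
    then show "real (N - i) * ln (B i / m) \<le> real N * ln (X / m)" by (intro mult_mono) auto
  qed
  then show ?thesis by (simp add: power2_eq_square)
qed

lemma sum_split_adjacent:
  fixes f :: "nat \<Rightarrow> real"
  assumes "Suc i < N"
  shows "(\<Sum>j<N. f j) = f i + f (Suc i) + (\<Sum>j\<in>{..<N} - {i, Suc i}. f j)"
  using assms by (subst sum.subset_diff[of "{i, Suc i}"]) auto

text \<open>The new norms \<beta> and B_i B_(i+1) / \<beta> both lie between B_(i+1) and B_i, so the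
  interval from \<open>m\<close> to \<open>X\<close> is preserved. Their product is unchanged and
  position \<open>i\<close> weighs one more than the next, so the potential changes by ln (\<beta> /
  B_i), where \<beta> \<le> B_i / 2 + B_i / 4.\<close>

lemma gso_swap:
  assumes g: "gso b B L" and i: "Suc i < N" and half: "\<bar>L i (rvec (b (Suc i)))\<bar> \<le> 1 / 2"
    and small: "2 * B (Suc i) < B i"
  shows "\<exists>B' L'. gso (swap_rows i b) B' L' \<and> potential B' \<le> potential B - ln (4 / 3)"
proof -
  define \<mu> where "\<mu> = L i (rvec (b (Suc i)))"
  define \<beta> where "\<beta> = B (Suc i) + \<mu>\<^sup>2 * B i"
  define B' where "B' = B(i := \<beta>, Suc i := B i * B (Suc i) / \<beta>)"
  define L' where "L' = L(i := (\<lambda>x. (\<mu> * B i * L i x + B (Suc i) * L (Suc i) x) / \<beta>),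
     Suc i := (\<lambda>x. L i x - \<mu> * L (Suc i) x))"
  have pos: "0 < B i" "0 < B (Suc i)" using gso_pos[OF g] i by auto
  have bd: "m \<le> B j" "B j \<le> X" if "j < N" for j using g that by (auto simp: gso_def)
  have ge: "B (Suc i) \<le> \<beta>" using pos by (simp add: \<beta>_def)
  have "\<mu>\<^sup>2 \<le> (1 / 2)\<^sup>2" using half unfolding \<mu>_def by (rule sq_le_quarter)
  then have "\<mu>\<^sup>2 * B i \<le> 1 / 4 * B i" using pos by (intro mult_right_mono) (auto simp: power2_eq_square)
  then have le: "\<beta> \<le> 3 / 4 * B i" using small by (simp add: \<beta>_def)
  have \<beta>: "0 < \<beta>" using ge pos by simp
  have C1: "B i * B (Suc i) / \<beta> \<le> B i"
    using ge pos \<beta> by (simp add: field_simps)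
  have C2: "B (Suc i) \<le> B i * B (Suc i) / \<beta>"
    using le pos \<beta> by (simp add: field_simps)
  have lin: "linfun (L j)" if "j < N" for j using g that by (simp add: gso_def)
  have "gso (swap_rows i b) B' L'"
    unfolding gso_def
  proof (intro conjI allI impI)
    fix j assume j: "j < N"
    show "m \<le> B' j" using bd[OF j] bd[OF i] ge C2 unfolding B'_def by auto
    show "B' j \<le> X" using bd[OF j] bd(2)[of i] i le C1 pos unfolding B'_def by auto
    show "linfun (L' j)"
      using lin[OF j] lin[of i] lin[OF i] i unfolding L'_def
      by (auto intro: linfun_comb linfun_diff)
  next
    fix x y
    have eq: "\<beta> * ((\<mu> * B i * p + B (Suc i) * q) / \<beta>) * ((\<mu> * B i * p' + B (Suc i) * q') / \<beta>)
      + B i * B (Suc i) / \<beta> * (p - \<mu> * q) * (p' - \<mu> * q') = B i * p * p' + B (Suc i) * q * q'" for p q p' q'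
    proof -
      have "(\<mu> * B i * p + B (Suc i) * q) * (\<mu> * B i * p' + B (Suc i) * q') +
        B i * B (Suc i) * (p - \<mu> * q) * (p' - \<mu> * q') = \<beta> * (B i * p * p' + B (Suc i) * q * q')"
        unfolding \<beta>_def by (simp add: algebra_simps power2_eq_square)
      then show ?thesis using \<beta> by (simp add: divide_simps)
    qed
    have "ip x y = (\<Sum>j<N. B j * L j x * L j y)" using g by (simp add: gso_def)
    also have "\<dots> = (\<Sum>j<N. B' j * L' j x * L' j y)"
      unfolding sum_split_adjacent[OF i, of "\<lambda>j. B j * L j x * L j y"]
        sum_split_adjacent[OF i, of "\<lambda>j. B' j * L' j x * L' j y"]
      using eq[of "L i x" "L (Suc i) x" "L i y" "L (Suc i) y"]
      by (auto simp: B'_def L'_def intro!: sum.cong)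
    finally show "ip x y = (\<Sum>j<N. B' j * L' j x * L' j y)" .
  next
    fix j l assume j: "j < N" and l: "l < j"
    have 0: "L s (rvec (b t)) = 0" if "t < s" "s < N" for s t
      using g that by (simp add: gso_def)
    have 1: "L s (rvec (b s)) = 1" if "s < N" for s
      using g that by (simp add: gso_def)
    consider "j = i" | "j = Suc i" "l = i" | "j = Suc i" "l < i" | "j < i" | "Suc i < j"
      using l by linarith
    then show "L' j (rvec (swap_rows i b l)) = 0"
      by cases (use 0 1 i j l in \<open>auto simp: L'_def swap_rows_def \<mu>_def\<close>)
  next
    fix j assume j: "j < N"
    have 0: "L s (rvec (b t)) = 0" if "t < s" "s < N" for s t
      using g that by (simp add: gso_def)
    have 1: "L s (rvec (b s)) = 1" if "s < N" for s
      using g that by (simp add: gso_def)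
    have "(\<mu> * B i * \<mu> + B (Suc i)) / \<beta> = 1"
      using \<beta> by (simp add: \<beta>_def power2_eq_square algebra_simps)
    then show "L' j (rvec (swap_rows i b j)) = 1"
      using 0 1 i j unfolding L'_def swap_rows_def \<mu>_def by auto
  qed
  moreover have "potential B' \<le> potential B - ln (4 / 3)"
  proof -
    define a where "a = ln (B i / m)"
    define c where "c = ln (B (Suc i) / m)"
    define a' where "a' = ln (\<beta> / m)"
    define c' where "c' = ln (B i * B (Suc i) / \<beta> / m)"
    have "a + c = a' + c'"
      unfolding a_def c_def a'_def c'_def using pos \<beta> m_pos by (simp add: ln_div ln_mult)
    moreover have "a' \<le> a - ln (4 / 3)"
    proof -
      have "a' = ln \<beta> - ln m" "a = ln (B i) - ln m"
        unfolding a_def a'_def using pos \<beta> m_pos by (simp_all add: ln_div)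
      moreover have "ln \<beta> \<le> ln (B i / (4 / 3))" using le \<beta> by (intro ln_mono) auto
      moreover have "ln (B i / (4 / 3)) = ln (B i) - ln (4 / 3)" using pos by (subst ln_div) auto
      ultimately show ?thesis by linarith
    qed
    moreover have "real (N - i) = real (N - Suc i) + 1" using i by simp
    moreover have "real (N - i) * a' + real (N - Suc i) * c' = real (N - Suc i) * (a' + c') + a'"
      "real (N - i) * a + real (N - Suc i) * c = real (N - Suc i) * (a + c) + a"
      unfolding calculation(3) by (simp_all add: algebra_simps)
    ultimately have "real (N - i) * a' + real (N - Suc i) * c' \<le> real (N - i) * a + real (N - Suc i) * c - ln (4 / 3)"
      by simp
    moreover have "(\<Sum>j\<in>{..<N} - {i, Suc i}. real (N - j) * ln (B' j / m)) = (\<Sum>j\<in>{..<N} - {i, Suc i}. real (N - j) * ln (B j / m))"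
      by (intro sum.cong) (auto simp: B'_def)
    ultimately show ?thesis
      unfolding potential_def sum_split_adjacent[OF i, of "\<lambda>j. real (N - j) * ln (B' j / m)"]
        sum_split_adjacent[OF i, of "\<lambda>j. real (N - j) * ln (B j / m)"]
      by (simp add: B'_def a_def c_def a'_def c'_def)
  qed
  ultimately show ?thesis by blast
qed

definition balanced :: "(nat \<Rightarrow> real) \<Rightarrow> bool" where
  "balanced B \<longleftrightarrow> (\<forall>i. Suc i < N \<longrightarrow> B i \<le> 2 * B (Suc i))"

abbreviation step :: "(nat \<Rightarrow> nat \<Rightarrow> int) \<Rightarrow> nat \<Rightarrow> nat \<Rightarrow> int" where
  "step \<equiv> lll_step ip N"

lemma swap_last_cases:
  assumes g: "gso b B L" and "k \<le> N - 1"
  shows "(swap_last ip k b = reduce ip b \<and> (\<forall>i<k. B i \<le> 2 * B (Suc i))) \<or>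
    (\<exists>i<k. swap_last ip k b = swap_rows i (reduce ip b) \<and> 2 * B (Suc i) < B i)"
  using assms(2)
proof (induction k)
  case 0
  then show ?case by simp
next
  case (Suc k)
  then have n: "nrm ip b k = B k" "nrm ip b (Suc k) = B (Suc k)" using gso_nrm[OF g] by auto
  show ?case
  proof (cases "2 * B (Suc k) < B k")
    case True
    then have "swap_last ip (Suc k) b = swap_rows k (reduce ip b)" by (simp add: n)
    then show ?thesis using True by blast
  next
    case False
    then have "swap_last ip (Suc k) b = swap_last ip k b" by (simp add: n)
    then show ?thesis using Suc False by (auto simp: less_Suc_eq)
  qed
qed

lemma step_cases:
  assumes g: "gso b B L"
  obtains "step b = reduce ip b" "balanced B"
  | i where "Suc i < N" "step b = swap_rows i (reduce ip b)" "2 * B (Suc i) < B i"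
proof -
  assume 1: "step b = reduce ip b \<Longrightarrow> balanced B \<Longrightarrow> thesis"
    and 2: "\<And>i. Suc i < N \<Longrightarrow> step b = swap_rows i (reduce ip b) \<Longrightarrow> 2 * B (Suc i) < B i \<Longrightarrow> thesis"
  from swap_last_cases[OF g order_refl] show thesis
  proof (elim disjE)
    assume "swap_last ip (N - 1) b = reduce ip b \<and> (\<forall>i<N - 1. B i \<le> 2 * B (Suc i))"
    then show thesis by (intro 1) (auto simp: lll_step_def balanced_def)
  next
    assume "\<exists>i<N - 1. swap_last ip (N - 1) b = swap_rows i (reduce ip b) \<and> 2 * B (Suc i) < B i"
    then obtain i where "i < N - 1" "swap_last ip (N - 1) b = swap_rows i (reduce ip b)" "2 * B (Suc i) < B i"
      by blast
    then show thesis by (intro 2[of i]) (simp_all add: lll_step_def)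
  qed
qed

lemma gso_step:
  assumes g: "gso b B L"
  shows "\<exists>B' L'. gso (step b) B' L' \<and> (balanced B' \<or> potential B' \<le> potential B - ln (4 / 3))"
  using g
proof (cases rule: step_cases)
  case 1
  then show ?thesis using gso_reduce[OF g] by auto
next
  case (2 i)
  then show ?thesis
    using gso_swap[OF gso_reduce[OF g], of i] gso_reduce_half[OF g, of i "Suc i"] by auto
qed

text \<open>Surplus rounds keep the balance, which allows the number of rounds to be fixed
  beforehand.\<close>

lemma gso_step_balanced:
  assumes g: "gso b B L" and bal: "balanced B"
  shows "gso (step b) B L"
  using g
proof (cases rule: step_cases)
  case 1
  then show ?thesis using gso_reduce[OF g] by simp
next
  case (2 i)
  then show ?thesis using bal unfolding balanced_def by force
qed

section \<open>Integral spans and the vector to be decoded\<close>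

definition Zspan :: "(nat \<Rightarrow> nat \<Rightarrow> int) \<Rightarrow> (nat \<Rightarrow> int) set" where
  "Zspan b = {x. \<exists>n. x = (\<lambda>l. \<Sum>j\<le>N. n j * b j l)}"

lemma Zspan_add_mult: "x \<in> Zspan b \<Longrightarrow> y \<in> Zspan b \<Longrightarrow> (\<lambda>l. x l + c * y l) \<in> Zspan b"
proof -
  assume "x \<in> Zspan b" "y \<in> Zspan b"
  then obtain n n' where "x = (\<lambda>l. \<Sum>j\<le>N. n j * b j l)" "y = (\<lambda>l. \<Sum>j\<le>N. n' j * b j l)"
    unfolding Zspan_def by blast
  then have "(\<lambda>l. x l + c * y l) = (\<lambda>l. \<Sum>j\<le>N. (n j + c * n' j) * b j l)"
    by (simp add: sum.distrib sum_distrib_left algebra_simps)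
  then show ?thesis unfolding Zspan_def by (intro CollectI exI[of _ "\<lambda>j. n j + c * n' j"])
qed

lemma Zspan_row: "i \<le> N \<Longrightarrow> b i \<in> Zspan b"
proof -
  assume "i \<le> N"
  then have "b i = (\<lambda>l. \<Sum>j\<le>N. (if j = i then 1 else 0) * b j l)" by (simp add: if_distrib[of "\<lambda>n. n * _"] cong: if_cong)
  then show ?thesis unfolding Zspan_def by (intro CollectI exI[of _ "\<lambda>j. if j = i then 1 else 0"])
qed

lemma Zspan_mono:
  assumes "\<And>i. i \<le> N \<Longrightarrow> b i \<in> Zspan b'"
  shows "Zspan b \<subseteq> Zspan b'"
proof
  fix x assume "x \<in> Zspan b"
  then obtain n where x: "x = (\<lambda>l. \<Sum>j\<le>N. n j * b j l)" unfolding Zspan_def by blast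
  have "(\<lambda>l. \<Sum>j\<in>J. n j * b j l) \<in> Zspan b'" if "finite J" "J \<subseteq> {..N}" for J
    using that
  proof (induction J)
    case empty
    show ?case unfolding Zspan_def by (auto intro: exI[of _ "\<lambda>_. 0"])
  next
    case (insert i J)
    then have "(\<lambda>l. (\<Sum>j\<in>J. n j * b j l) + n i * b i l) \<in> Zspan b'"
      using assms by (intro Zspan_add_mult) auto
    then show ?case using insert by (simp add: add.commute)
  qed
  then show "x \<in> Zspan b'" unfolding x by simp
qed

lemma Zspan_reduce_vec:
  assumes "reduce_vec ip b i x \<in> Zspan b'" and "\<And>j. j < i \<Longrightarrow> b j \<in> Zspan b'"
  shows "x \<in> Zspan b'"
  using assms
proof (induction i arbitrary: x)
  case 0
  then show ?case by simp
next
  case (Suc i)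
  define c where "c = \<lfloor>mu ip b i (rvec x) + 1 / 2\<rfloor>"
  have "(\<lambda>l. x l - c * b i l) \<in> Zspan b'" using Suc by (auto simp: c_def)
  then have "(\<lambda>l. (x l - c * b i l) + c * b i l) \<in> Zspan b'"
    using Suc.prems(2) by (intro Zspan_add_mult) auto
  then show ?case by simp
qed

text \<open>A row is its reduction plus multiples of earlier rows, which are recovered
  first.\<close>

lemma Zspan_reduce: "Zspan b \<subseteq> Zspan (reduce ip b)"
proof (rule Zspan_mono)
  show "b i \<in> Zspan (reduce ip b)" if "i \<le> N" for i
    using that
  proof (induction i rule: less_induct)
    case (less i)
    show ?case
    proof (rule Zspan_reduce_vec)
      show "reduce_vec ip b i (b i) \<in> Zspan (reduce ip b)"
        using Zspan_row[of i "reduce ip b"] less.prems by (simp add: reduce_def)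
      show "b j \<in> Zspan (reduce ip b)" if "j < i" for j
        using less.IH[of j] less.prems that by simp
    qed
  qed
qed

lemma Zspan_swap_rows:
  assumes "Suc i < N"
  shows "Zspan b \<subseteq> Zspan (swap_rows i b)"
proof (rule Zspan_mono)
  fix j assume "j \<le> N"
  define j' where "j' = (if j = i then Suc i else if j = Suc i then i else j)"
  have "b j = swap_rows i b j'" "j' \<le> N" using assms \<open>j \<le> N\<close> by (auto simp: swap_rows_def j'_def)
  then show "b j \<in> Zspan (swap_rows i b)" using Zspan_row by metis
qed

lemma gso_cong:
  assumes "\<And>j. j \<le> N \<Longrightarrow> b j = b' j" and "gso b B L"
  shows "gso b' B L"
proof -
  have "b' j = b j" if "j < N" for j using assms(1)[of j] that by simp
  then show ?thesis using assms(2) unfolding gso_def by (auto dest: less_trans)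
qed

text \<open>Coordinate \<open>N\<close> counts copies of the vector to be decoded: a vector with
  value 1 there is row \<open>N\<close> plus a lattice vector. The span consists of all integral
  vectors on the coordinates up to \<open>N\<close>, because the arithmetic of the lattice sits in
  the form and not in the basis.\<close>

definition decoding_basis :: "(nat \<Rightarrow> nat \<Rightarrow> int) \<Rightarrow> bool" where
  "decoding_basis b \<longleftrightarrow> (\<forall>x. (\<forall>l>N. x l = 0) \<longrightarrow> x \<in> Zspan b) \<and>
     (\<forall>j\<le>N. \<forall>l>N. b j l = 0) \<and> b N N = 1 \<and> (\<forall>j<N. b j N = 0)"

lemma decoding_basis_cong:
  assumes "\<And>j. j \<le> N \<Longrightarrow> b j = b' j" and "decoding_basis b"
  shows "decoding_basis b'"
proof -
  have "Zspan b = Zspan b'" unfolding Zspan_def using assms(1) by simp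
  then show ?thesis using assms unfolding decoding_basis_def by simp
qed

lemma reduce_vec_coord:
  assumes "\<And>j. j < i \<Longrightarrow> b j l = 0"
  shows "reduce_vec ip b i x l = x l"
  using assms by (induction i arbitrary: x) auto

lemma decoding_basis_reduce:
  assumes "decoding_basis b"
  shows "decoding_basis (reduce ip b)"
proof -
  have "reduce ip b j l = b j l" if "j \<le> N" "N \<le> l" for j l
    unfolding reduce_def using assms that
    by (intro reduce_vec_coord) (auto simp: decoding_basis_def le_less)
  then show ?thesis using assms Zspan_reduce[of b] unfolding decoding_basis_def by auto
qed

lemma decoding_basis_swap_rows:
  assumes "decoding_basis b" and "Suc i < N"
  shows "decoding_basis (swap_rows i b)"
  using assms Zspan_swap_rows[OF assms(2), of b] unfolding decoding_basis_def
  by (auto simp: swap_rows_def)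

lemma decoding_basis_step:
  assumes "gso b B L" and "decoding_basis b"
  shows "decoding_basis (step b)"
  using assms(1)
  by (cases rule: step_cases)
     (use assms(2) in \<open>auto intro: decoding_basis_reduce decoding_basis_swap_rows\<close>)

lemma ip_step_le:
  assumes g: "gso b B L" and i: "i \<le> N"
  shows "ip (rvec (step b i)) (rvec (step b i)) \<le> N * X"
  using g
proof (cases rule: step_cases)
  case 1
  then show ?thesis using ip_reduce_le[OF g i] by simp
next
  case (2 j)
  then show ?thesis using ip_reduce_le[OF g] i by (auto simp: swap_rows_def)
qed

text \<open>Nearest plane decoding: \<open>x\<close> and the reduced row \<open>N\<close> differ by an integral combination
  of the basis; at the last basis vector that occurs in it, \<open>x\<close> has a Gram-Schmidt coefficient
  of size at least \<open>1 / 2\<close>.\<close>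

lemma nearest_plane:
  assumes g: "gso b B L" and bal: "balanced B" and db: "decoding_basis b"
    and x: "\<forall>l>N. x l = 0" "x N = 1"
  shows "ip (rvec (reduce ip b N)) (rvec (reduce ip b N)) \<le> (1 + N * 2 ^ N) * ip (rvec x) (rvec x)"
proof -
  define r where "r = reduce ip b"
  define y where "y = r N"
  have g': "gso r B L" and db': "decoding_basis r"
    unfolding r_def using gso_reduce[OF g] decoding_basis_reduce[OF db] .
  obtain n where n: "x = (\<lambda>l. \<Sum>j\<le>N. n j * r j l)"
    using db' x(1) unfolding decoding_basis_def Zspan_def by blast
  have "x N = (\<Sum>j\<le>N. if j = N then n N else 0)"
    unfolding n using db' by (intro sum.cong) (auto simp: decoding_basis_def)
  then have nN: "n N = 1" using x(2) by simp
  have "x = (\<lambda>l. y l + (\<Sum>j<N. n j * r j l))"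
    unfolding n y_def by (simp add: lessThan_Suc_atMost[symmetric] nN add.commute)
  then have rx: "rvec x = (\<lambda>l. rvec y l + (\<Sum>j<N. real_of_int (n j) * rvec (r j) l))"
    by (simp add: rvec_def)
  have Lx: "L l (rvec x) = L l (rvec y) + (\<Sum>j<N. real_of_int (n j) * L l (rvec (r j)))" if "l < N" for l
    unfolding rx using g' that by (intro linfun_sum) (auto simp: gso_def)
  have ipL: "ip z z = (\<Sum>l<N. B l * (L l z)\<^sup>2)" for z
    using g by (simp add: gso_def power2_eq_square mult.assoc)
  have term_le: "B l * (L l z)\<^sup>2 \<le> ip z z" if "l < N" for l z
    unfolding ipL using that gso_pos[OF g]
    by (intro member_le_sum) (simp_all add: less_imp_le)
  \<comment> \<open>If no basis row from \<open>l\<close> on occurs in the difference,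
    \<open>x\<close> and \<open>y\<close> agree in their coefficient at \<open>l\<close>. Otherwise
    let \<open>i\<close> be the last row that occurs: B_i is at most 4
    \<open>ip (rvec x) (rvec x)\<close>, balance carries this down to \<open>l\<close> at the price
    of 2^(i - l), and \<open>y\<close> contributes at most B_l / 4.\<close>
  have "B l * (L l (rvec y))\<^sup>2 \<le> B l * (L l (rvec x))\<^sup>2 + 2 ^ N * ip (rvec x) (rvec x)" if l: "l < N" for l
  proof (cases "\<forall>j<N. l \<le> j \<longrightarrow> n j = 0")
    case True
    have "(\<Sum>j<N. real_of_int (n j) * L l (rvec (r j))) = 0"
    proof (intro sum.neutral ballI)
      fix j assume "j \<in> {..<N}"
      then show "real_of_int (n j) * L l (rvec (r j)) = 0"
        using True g' l by (cases "l \<le> j") (auto simp: gso_def)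
    qed
    then show ?thesis using Lx[OF l] ip_nonneg by simp
  next
    case False
    define i where "i = Max {j. j < N \<and> n j \<noteq> 0}"
    have fin: "finite {j. j < N \<and> n j \<noteq> 0}" by simp
    then have "i \<in> {j. j < N \<and> n j \<noteq> 0}" unfolding i_def using False by (intro Max_in) auto
    then have i: "i < N" "n i \<noteq> 0" by auto
    have max: "n j = 0" if "i < j" "j < N" for j
      using that Max_ge[OF fin, of j] unfolding i_def[symmetric] by force
    have li: "l \<le> i" using False max by (metis le_trans nat_le_linear nat_less_le)
    have "(\<Sum>j<N. real_of_int (n j) * L i (rvec (r j))) = (\<Sum>j<N. if j = i then real_of_int (n i) else 0)"
    proof (intro sum.cong refl)
      fix j assume "j \<in> {..<N}"
      then show "real_of_int (n j) * L i (rvec (r j)) = (if j = i then real_of_int (n i) else 0)"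
        using max[of j] g' i by (cases i j rule: linorder_cases) (auto simp: gso_def)
    qed
    then have "L i (rvec x) = L i (rvec y) + real_of_int (n i)" using Lx[OF i(1)] i by simp
    moreover have "\<bar>L i (rvec y)\<bar> \<le> 1 / 2"
      using gso_reduce_half[OF g, of i N] i unfolding y_def r_def by simp
    moreover have "1 \<le> \<bar>real_of_int (n i)\<bar>" using i(2) by linarith
    ultimately have "1 / 2 \<le> \<bar>L i (rvec x)\<bar>" by linarith
    then have "(1 / 2)\<^sup>2 \<le> (L i (rvec x))\<^sup>2" using power_mono[of "1 / 2" "\<bar>L i (rvec x)\<bar>" 2] by simp
    then have "B i * (1 / 2)\<^sup>2 \<le> B i * (L i (rvec x))\<^sup>2"
      using gso_pos[OF g i(1)] by (intro mult_left_mono) auto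
    also have "\<dots> \<le> ip (rvec x) (rvec x)" by (rule term_le[OF i(1)])
    finally have Bi: "B i * (1 / 2)\<^sup>2 \<le> ip (rvec x) (rvec x)" .
    have "B (i - k) \<le> 2 ^ k * B i" if "k \<le> i" for k
      using that
    proof (induction k)
      case (Suc k)
      then have e: "Suc (i - Suc k) = i - k" by simp
      then have "B (i - Suc k) \<le> 2 * B (i - k)"
        using bal[unfolded balanced_def, rule_format, of "i - Suc k"] i(1) by simp
      then show ?case using Suc by simp
    qed simp
    from this[of "i - l"] have "B l \<le> 2 ^ (i - l) * B i" using li by simp
    also have "\<dots> \<le> 2 ^ N * B i" using i gso_pos[OF g i(1)] by (intro mult_right_mono power_increasing) auto
    finally have Bl: "B l \<le> 2 ^ N * B i" .
    have "\<bar>L l (rvec y)\<bar> \<le> 1 / 2"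
      using gso_reduce_half[OF g, of l N] l unfolding y_def r_def by simp
    then have "(L l (rvec y))\<^sup>2 \<le> (1 / 2)\<^sup>2" by (rule sq_le_quarter)
    then have "B l * (L l (rvec y))\<^sup>2 \<le> (2 ^ N * B i) * (1 / 2)\<^sup>2"
      using Bl gso_pos[OF g l] gso_pos[OF g i(1)] by (intro mult_mono) auto
    also have "\<dots> \<le> 2 ^ N * ip (rvec x) (rvec x)"
      using Bi by simp
    finally show ?thesis using gso_pos[OF g l] by (simp add: add_increasing)
  qed
  then have "ip (rvec y) (rvec y) \<le> (\<Sum>l<N. B l * (L l (rvec x))\<^sup>2 + 2 ^ N * ip (rvec x) (rvec x))"
    unfolding ipL[of "rvec y"] by (intro sum_mono) auto
  also have "\<dots> = (1 + N * 2 ^ N) * ip (rvec x) (rvec x)"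
    by (simp add: sum.distrib ipL[symmetric] algebra_simps)
  finally show ?thesis by (simp add: y_def r_def)
qed

end

section \<open>Basis reduction as an arithmetic function\<close>

text \<open>Expressions have no conditionals; division provides a sign test.\<close>

lemma sgn_via_div: "x div (x * x + 1) = (if x < 0 then - 1 else 0)" for x :: int
proof (cases "x < 0")
  case True
  have "0 \<le> x * x + 1 + x"
  proof -
    have "(- x) * 1 \<le> (- x) * (- x)" using True by (intro mult_left_mono) auto
    then show ?thesis by simp
  qed
  then have "x div (x * x + 1) = - 1"
    using True by (intro int_div_pos_eq[where r = "x + (x * x + 1)"]) auto
  then show ?thesis using True by simp
next
  case False
  have "x < x * x + 1"
  proof (cases "x = 0")
    case False
    then have "x * 1 \<le> x * x" using \<open>\<not> x < 0\<close> by (intro mult_left_mono) auto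
    then show ?thesis by simp
  qed simp
  then show ?thesis using False by (simp add: div_pos_pos_trivial)
qed

lemma arith_if_less:
  assumes "arith S F" "arith S G" "arith S A" "arith S B"
  shows "arith S (\<lambda>M. if F M < G M then A M else B M)"
proof -
  have "arith S (\<lambda>M. B M + (0 - (F M - G M) div ((F M - G M) * (F M - G M) + 1)) * (A M - B M))"
    by (intro arith.intros assms)
  moreover have "(\<lambda>M. if F M < G M then A M else B M) =
    (\<lambda>M. B M + (0 - (F M - G M) div ((F M - G M) * (F M - G M) + 1)) * (A M - B M))"
    unfolding sgn_via_div by auto
  ultimately show ?thesis by simp
qed

lemma arith_power: "arith S F \<Longrightarrow> arith S (\<lambda>M. F M ^ k)"
  by (induction k) (auto intro: arith.intros)

lemma arith_mod: "arith S F \<Longrightarrow> arith S G \<Longrightarrow> arith S (\<lambda>M. F M mod G M)"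
  unfolding minus_mult_div_eq_mod[symmetric] by (intro arith.intros)

text \<open>Fractions are never cancelled; their length is covered by the cost bound for
  expressions. Positive denominators turn comparisons into integer comparisons by cross
  multiplication.\<close>

definition rarith :: "nat set \<Rightarrow> (mem \<Rightarrow> real) \<Rightarrow> bool" where
  "rarith S F \<longleftrightarrow> (\<exists>a b. arith S a \<and> arith S b \<and>
     (\<forall>M. 0 < b M \<and> F M = real_of_int (a M) / real_of_int (b M)))"

lemma rarithI:
  assumes "arith S a" "arith S b" "\<And>M. 0 < b M" "\<And>M. F M = real_of_int (a M) / real_of_int (b M)"
  shows "rarith S F"
  using assms unfolding rarith_def by blast

lemma rarith_of_int: "arith S F \<Longrightarrow> rarith S (\<lambda>M. real_of_int (F M))"
  by (rule rarithI[of S F "\<lambda>_. 1"]) (auto intro: arith.intros)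

lemma rarith_const: "rarith S (\<lambda>M. real_of_int c)"
  by (intro rarith_of_int arith.intros)

lemma rarith_add:
  assumes "rarith S F" "rarith S G"
  shows "rarith S (\<lambda>M. F M + G M)"
proof -
  from assms obtain a b c d where *: "arith S a" "arith S b" "arith S c" "arith S d"
    "\<And>M. 0 < b M" "\<And>M. 0 < d M" "\<And>M. F M = real_of_int (a M) / real_of_int (b M)"
    "\<And>M. G M = real_of_int (c M) / real_of_int (d M)"
    unfolding rarith_def by blast
  show ?thesis
    by (rule rarithI[of S "\<lambda>M. a M * d M + c M * b M" "\<lambda>M. b M * d M"])
       (use * less_imp_neq[OF *(5)] less_imp_neq[OF *(6)] in \<open>auto intro!: arith.intros simp: add_frac_eq\<close>)
qed

lemma rarith_mult:
  assumes "rarith S F" "rarith S G"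
  shows "rarith S (\<lambda>M. F M * G M)"
proof -
  from assms obtain a b c d where *: "arith S a" "arith S b" "arith S c" "arith S d"
    "\<And>M. 0 < b M" "\<And>M. 0 < d M" "\<And>M. F M = real_of_int (a M) / real_of_int (b M)"
    "\<And>M. G M = real_of_int (c M) / real_of_int (d M)"
    unfolding rarith_def by blast
  show ?thesis
    by (rule rarithI[of S "\<lambda>M. a M * c M" "\<lambda>M. b M * d M"]) (use * in \<open>auto intro!: arith.intros\<close>)
qed

lemma rarith_diff: "rarith S F \<Longrightarrow> rarith S G \<Longrightarrow> rarith S (\<lambda>M. F M - G M)"
  using rarith_add[of S F "\<lambda>M. real_of_int (- 1) * G M"] rarith_mult[OF rarith_const, of S G "- 1"]
  by simp

text \<open>Extending the quotient by the numerator \<open>c\<close> of the divisor makes the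
  denominator b c^2 positive. If c = 0, the denominator is replaced by 1 and the numerator vanishes,
  in agreement with division by zero.\<close>

lemma rarith_divide:
  assumes "rarith S F" "rarith S G"
  shows "rarith S (\<lambda>M. F M / G M)"
proof -
  from assms obtain a b c d where *: "arith S a" "arith S b" "arith S c" "arith S d"
    "\<And>M. 0 < b M" "\<And>M. 0 < d M" "\<And>M. F M = real_of_int (a M) / real_of_int (b M)"
    "\<And>M. G M = real_of_int (c M) / real_of_int (d M)"
    unfolding rarith_def by blast
  show ?thesis
  proof (rule rarithI[of S "\<lambda>M. a M * d M * c M" "\<lambda>M. if 0 < b M * c M * c M then b M * c M * c M else 1"])
    show "arith S (\<lambda>M. if 0 < b M * c M * c M then b M * c M * c M else 1)"
      by (intro arith_if_less arith.intros *)
    show "F M / G M = real_of_int (a M * d M * c M) /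
        real_of_int (if 0 < b M * c M * c M then b M * c M * c M else 1)" for M
    proof (cases "c M = 0")
      case False
      then have "0 < c M * c M" by (auto simp: zero_less_mult_iff)
      then have "0 < b M * (c M * c M)" using *(5)[of M] by simp
      then show ?thesis using *(5,6)[of M] False unfolding *(7,8) by (simp add: mult.assoc)
    qed (simp add: *(8))
  qed (use * in \<open>auto intro!: arith.intros\<close>)
qed

lemma rarith_sum:
  assumes "finite J" and "\<And>j. j \<in> J \<Longrightarrow> rarith S (F j)"
  shows "rarith S (\<lambda>M. \<Sum>j\<in>J. F j M)"
  using assms
proof (induction J)
  case empty
  then show ?case using rarith_const[of S 0] by simp
next
  case (insert j J)
  then show ?case by (simp add: rarith_add)
qed

lemma rarith_power: "rarith S F \<Longrightarrow> rarith S (\<lambda>M. F M ^ k)"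
  by (induction k) (use rarith_const[of S 1] in \<open>auto intro: rarith_mult\<close>)

lemma arith_floor:
  assumes "rarith S F"
  shows "arith S (\<lambda>M. \<lfloor>F M\<rfloor>)"
proof -
  from assms obtain a b where *: "arith S a" "arith S b" "\<And>M. F M = real_of_int (a M) / real_of_int (b M)"
    unfolding rarith_def by blast
  have "arith S (\<lambda>M. a M div b M)" by (intro arith.intros *)
  then show ?thesis unfolding *(3) floor_divide_of_int_eq .
qed

lemma arith_if_rless:
  assumes "rarith S F" "rarith S G" "arith S A" "arith S B"
  shows "arith S (\<lambda>M. if F M < G M then A M else B M)"
proof -
  from assms obtain a b c d where *: "arith S a" "arith S b" "arith S c" "arith S d"
    "\<And>M. 0 < b M" "\<And>M. 0 < d M" "\<And>M. F M = real_of_int (a M) / real_of_int (b M)"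
    "\<And>M. G M = real_of_int (c M) / real_of_int (d M)"
    unfolding rarith_def by blast
  have "F M < G M \<longleftrightarrow> a M * d M < c M * b M" for M
  proof -
    have "F M < G M \<longleftrightarrow> real_of_int (a M) * real_of_int (d M) < real_of_int (c M) * real_of_int (b M)"
      unfolding *(7,8) using *(5,6)[of M] by (simp add: divide_simps)
    then show ?thesis by (simp flip: of_int_mult)
  qed
  moreover have "arith S (\<lambda>M. if a M * d M < c M * b M then A M else B M)"
    by (intro arith_if_less arith.intros * assms)
  ultimately show ?thesis by simp
qed

context
  fixes S :: "nat set" and IP :: "mem \<Rightarrow> (nat \<Rightarrow> real) \<Rightarrow> (nat \<Rightarrow> real) \<Rightarrow> real"
    and b :: "mem \<Rightarrow> nat \<Rightarrow> nat \<Rightarrow> int"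
  assumes IP: "\<And>x y. (\<And>l. rarith S (\<lambda>M. x M l)) \<Longrightarrow> (\<And>l. rarith S (\<lambda>M. y M l)) \<Longrightarrow>
      rarith S (\<lambda>M. IP M (x M) (y M))"
    and b: "\<And>i l. arith S (\<lambda>M. b M i l)"
begin

lemma rarith_rvec: "(\<And>l. arith S (\<lambda>M. x M l)) \<Longrightarrow> rarith S (\<lambda>M. rvec (x M) l)"
  unfolding rvec_def by (intro rarith_of_int)

text \<open>The recursion unrolls into a single expression whose size depends on \<open>i\<close>
  but not on the memory: this is the use of the fixed dimension.\<close>

lemma rarith_star: "rarith S (\<lambda>M. star (IP M) (b M) i l)"
proof (induction i arbitrary: l rule: less_induct)
  case (less i)
  show ?case
    unfolding star.simps[of _ _ i]
    by (intro rarith_diff rarith_sum rarith_mult rarith_divide IP rarith_rvec b less) auto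
qed

lemma rarith_nrm: "rarith S (\<lambda>M. nrm (IP M) (b M) i)"
  unfolding nrm_def by (intro IP rarith_star)

lemma rarith_mu:
  "(\<And>l. rarith S (\<lambda>M. x M l)) \<Longrightarrow> rarith S (\<lambda>M. mu (IP M) (b M) i (x M))"
  unfolding mu_def by (intro rarith_divide IP rarith_star rarith_nrm)

lemma arith_reduce_vec:
  assumes "\<And>l. arith S (\<lambda>M. x M l)"
  shows "arith S (\<lambda>M. reduce_vec (IP M) (b M) i (x M) l)"
  using assms
proof (induction i arbitrary: x l)
  case 0
  then show ?case by simp
next
  case (Suc i)
  have half: "rarith S (\<lambda>M. 1 / 2 :: real)"
    using rarith_divide[OF rarith_const[of S 1] rarith_const[of S 2]] by simp
  have "arith S (\<lambda>M. x M l - \<lfloor>mu (IP M) (b M) i (rvec (x M)) + 1 / 2\<rfloor> * b M i l)" for l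
    by (intro arith.intros arith_floor rarith_add rarith_mu rarith_rvec half Suc.prems b)
  from Suc.IH[OF this] show ?case by simp
qed

lemma arith_reduce: "arith S (\<lambda>M. reduce (IP M) (b M) i l)"
  unfolding reduce_def by (intro arith_reduce_vec b)

lemma arith_swap_last: "arith S (\<lambda>M. swap_last (IP M) k (b M) i l)"
proof (induction k)
  case 0
  then show ?case by (simp add: arith_reduce)
next
  case (Suc k)
  have "swap_last (IP M) (Suc k) (b M) i l = (if 2 * nrm (IP M) (b M) (Suc k) < nrm (IP M) (b M) k
     then swap_rows k (reduce (IP M) (b M)) i l else swap_last (IP M) k (b M) i l)" for M
    by simp
  moreover have "rarith S (\<lambda>M. 2 * nrm (IP M) (b M) (Suc k))"
    using rarith_mult[OF rarith_const[of S 2] rarith_nrm] by simp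
  ultimately show ?case
    by (simp only:) (intro arith_if_rless rarith_nrm Suc, auto simp: swap_rows_def intro: arith_reduce)
qed

lemma arith_lll_step: "arith S (\<lambda>M. lll_step (IP M) N (b M) i l)"
  unfolding lll_step_def by (rule arith_swap_last)

end

section \<open>The lattice of the decoding problem\<close>

text \<open>The first \<open>d\<close> coordinates are multiples of \<open>p\<close>, the next
  \<open>w\<close> ones the coefficients of \<open>X ^ k, \<dots>, X ^ (k + w - 1)\<close>, and the last one multiplies the vector of
  approximations. The weights make the error terms and the coefficients contribute about \<open>D\<^sup>2\<close> each,
  and the forms are already triangular, so the unit vectors are a basis with known
  Gram-Schmidt data.\<close>

definition dec_lam :: "nat \<Rightarrow> nat \<Rightarrow> nat \<Rightarrow> int \<Rightarrow> (nat \<Rightarrow> int) \<Rightarrow> (nat \<Rightarrow> int) \<Rightarrow> nat \<Rightarrow> (nat \<Rightarrow> real) \<Rightarrow> real" where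
  "dec_lam d w k p t s i x = (if i < d then
     x i + ((\<Sum>j<w. x (d + j) * real_of_int (t i) ^ (k + j)) - x (d + w) * real_of_int (s i)) / real_of_int p
     else x i)"

definition dec_W :: "nat \<Rightarrow> int \<Rightarrow> int \<Rightarrow> nat \<Rightarrow> real" where
  "dec_W d p D i = (if i < d then real_of_int p ^ 2 else real_of_int D ^ 2 / real_of_int p ^ 2)"

definition dec_ip :: "nat \<Rightarrow> nat \<Rightarrow> nat \<Rightarrow> int \<Rightarrow> int \<Rightarrow> (nat \<Rightarrow> int) \<Rightarrow> (nat \<Rightarrow> int) \<Rightarrow> (nat \<Rightarrow> real) \<Rightarrow> (nat \<Rightarrow> real) \<Rightarrow> real" where
  "dec_ip d w k p D t s = form_ip (d + w) (dec_W d p D) (dec_lam d w k p t s)"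

lemma linfun_dec_lam: "linfun (dec_lam d w k p t s i)"
  unfolding linfun_def dec_lam_def
  by (auto simp: sum.distrib sum_distrib_left algebra_simps add_divide_distrib diff_divide_distrib)

lemma dec_quad_form:
  assumes "1 \<le> D" "D < p"
  shows "quad_form (d + w) (dec_W d p D) (dec_lam d w k p t s) (1 / real_of_int p ^ 2) (real_of_int p ^ 2)"
proof
  have p: "1 \<le> real_of_int p ^ 2" using assms by simp
  have D: "1 \<le> real_of_int D ^ 2" "real_of_int D ^ 2 \<le> real_of_int p ^ 2"
    using assms by (auto intro: power_mono)
  have Dp: "real_of_int D ^ 2 / real_of_int p ^ 2 \<le> 1" using D p by (simp add: divide_simps)
  show "1 / real_of_int p ^ 2 \<le> dec_W d p D i \<and> dec_W d p D i \<le> real_of_int p ^ 2" for i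
  proof -
    have "1 / real_of_int p ^ 2 \<le> 1" unfolding divide_le_eq_1 using p by linarith
    then have "1 / real_of_int p ^ 2 \<le> real_of_int p ^ 2" using p by linarith
    moreover have "1 / real_of_int p ^ 2 \<le> real_of_int D ^ 2 / real_of_int p ^ 2"
      using D by (intro divide_right_mono) auto
    moreover have "real_of_int D ^ 2 / real_of_int p ^ 2 \<le> real_of_int p ^ 2"
      using Dp p by linarith
    ultimately show ?thesis by (simp add: dec_W_def)
  qed
qed (use assms linfun_dec_lam in auto)

text \<open>The triangular shape: the weights and forms themselves serve as \<open>gso\<close> data
  for the unit vectors, and no initial orthogonalization is required.\<close>

lemma dec_lam_unit:
  assumes "j \<le> i" "i < d + w"
  shows "dec_lam d w k p t s i (rvec (\<lambda>l. if j = l then 1 else 0)) = (if j = i then 1 else 0)"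
proof -
  have "(\<Sum>j'<w. rvec (\<lambda>l. if j = l then 1 else 0) (d + j') * real_of_int (t i) ^ (k + j')) = 0" if "i < d"
    using that assms by (intro sum.neutral) (auto simp: rvec_def)
  then show ?thesis using assms by (auto simp: dec_lam_def rvec_def)
qed

text \<open>With \<open>ip_reduce_le\<close> this keeps the state short. The form controls the
  coefficients directly, up to a factor p/D \<le> p, and then each of the first \<open>d\<close>
  coordinates, once the polynomial part has been estimated by means of the coefficients. Coordinate
  \<open>d + w\<close> has no square of its own in the form, hence \<open>xN\<close>.\<close>

lemma dec_coords_bound:
  fixes x :: "nat \<Rightarrow> int"
  assumes D: "1 \<le> D" "D < p" and t: "\<And>i. i < d \<Longrightarrow> \<bar>t i\<bar> \<le> p" and s: "\<And>i. i < d \<Longrightarrow> \<bar>s i\<bar> \<le> p"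
    and ip: "dec_ip d w k p D t s (rvec x) (rvec x) \<le> (d + w) * real_of_int p ^ 2"
    and xN: "\<bar>x (d + w)\<bar> \<le> 1" and l: "l \<le> d + w"
  shows "\<bar>x l\<bar> \<le> (d + w + w * (d + w) + 1) * p ^ (k + w + 2)"
proof -
  define N where "N = d + w"
  define P where "P = real_of_int p"
  have P: "1 \<le> P" using D by (simp add: P_def)
  have term_le: "dec_W d p D i * (dec_lam d w k p t s i (rvec x))\<^sup>2 \<le> N * P ^ 2" if "i < N" for i
  proof -
    have "dec_W d p D i * (dec_lam d w k p t s i (rvec x))\<^sup>2
        \<le> (\<Sum>i<N. dec_W d p D i * (dec_lam d w k p t s i (rvec x))\<^sup>2)"
      using that by (intro member_le_sum) (auto simp: dec_W_def)
    also have "\<dots> = dec_ip d w k p D t s (rvec x) (rvec x)"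
      by (simp add: dec_ip_def form_ip_def N_def power2_eq_square mult.assoc)
    finally show ?thesis using ip by (simp add: N_def P_def)
  qed
  have big: "\<bar>real_of_int (x l)\<bar> \<le> N * P ^ 2" if "d \<le> l" "l < N" for l
  proof -
    have N1: "1 \<le> real N" using that by simp
    have "real_of_int D ^ 2 / P ^ 2 * (real_of_int (x l))\<^sup>2 \<le> N * P ^ 2"
      using term_le[of l] that by (simp add: dec_W_def dec_lam_def P_def rvec_def)
    then have "real_of_int D ^ 2 * (real_of_int (x l))\<^sup>2 \<le> N * P ^ 2 * P ^ 2"
      using P by (simp add: divide_simps)
    moreover have "1 * (real_of_int (x l))\<^sup>2 \<le> real_of_int D ^ 2 * (real_of_int (x l))\<^sup>2"
      using D by (intro mult_right_mono) auto
    ultimately have "(real_of_int (x l))\<^sup>2 \<le> N * P ^ 2 * P ^ 2" by simp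
    also have "\<dots> \<le> N * P ^ 2 * (N * P ^ 2)" using N1 P by (intro mult_left_mono) auto
    finally have "(real_of_int (x l))\<^sup>2 \<le> (N * P ^ 2)\<^sup>2" by (simp add: power2_eq_square)
    then have "\<bar>real_of_int (x l)\<bar> \<le> \<bar>N * P ^ 2\<bar>" unfolding abs_le_square_iff .
    then show ?thesis by simp
  qed
  define E where "E = k + w + 2"
  have PE: "P ^ i \<le> P ^ E" if "i \<le> E" for i using that P by (intro power_increasing)
  have small: "\<bar>real_of_int (x l)\<bar> \<le> (N + w * N + 1) * P ^ E" if "l < d" for l
  proof -
    define y where "y = (\<Sum>j<w. real_of_int (x (d + j)) * real_of_int (t l) ^ (k + j)) - real_of_int (x (d + w)) * real_of_int (s l)"
    have "P ^ 2 * (real_of_int (x l) + y / P)\<^sup>2 \<le> N * P ^ 2"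
      using term_le[of l] that by (simp add: dec_W_def dec_lam_def P_def rvec_def y_def N_def)
    then have "(real_of_int (x l) + y / P)\<^sup>2 \<le> N" using P by simp
    also have "real N \<le> real N ^ 2" by (simp add: power2_eq_square flip: of_nat_mult)
    finally have "\<bar>real_of_int (x l) + y / P\<bar> \<le> \<bar>real N\<bar>" unfolding abs_le_square_iff .
    then have 1: "\<bar>real_of_int (x l) + y / P\<bar> \<le> N" by simp
    have "\<bar>\<Sum>j<w. real_of_int (x (d + j)) * real_of_int (t l) ^ (k + j)\<bar>
        \<le> (\<Sum>j<w. \<bar>real_of_int (x (d + j)) * real_of_int (t l) ^ (k + j)\<bar>)" by (rule sum_abs)
    also have "\<dots> \<le> (\<Sum>j<w. N * P ^ 2 * P ^ (k + j))"
    proof (rule sum_mono)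
      fix j assume "j \<in> {..<w}"
      then have "\<bar>real_of_int (x (d + j))\<bar> \<le> N * P ^ 2" by (intro big) (auto simp: N_def)
      moreover have "\<bar>real_of_int (t l)\<bar> ^ (k + j) \<le> P ^ (k + j)"
        using t[OF that] unfolding P_def by (intro power_mono) auto
      ultimately show "\<bar>real_of_int (x (d + j)) * real_of_int (t l) ^ (k + j)\<bar> \<le> N * P ^ 2 * P ^ (k + j)"
        unfolding abs_mult power_abs using P by (intro mult_mono) auto
    qed
    also have "\<dots> \<le> (\<Sum>j<w. N * P ^ E)"
    proof (rule sum_mono)
      fix j assume "j \<in> {..<w}"
      then have "N * P ^ (2 + (k + j)) \<le> N * P ^ E" by (intro mult_left_mono PE) (auto simp: E_def)
      then show "N * P ^ 2 * P ^ (k + j) \<le> N * P ^ E" by (simp only: power_add mult.assoc)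
    qed
    also have "\<dots> = w * N * P ^ E" by simp
    finally have 2: "\<bar>\<Sum>j<w. real_of_int (x (d + j)) * real_of_int (t l) ^ (k + j)\<bar> \<le> w * N * P ^ E" .
    have "\<bar>real_of_int (x (d + w)) * real_of_int (s l)\<bar> \<le> 1 * P"
      unfolding abs_mult using xN s[OF that] unfolding P_def by (intro mult_mono) auto
    also have "\<dots> \<le> P ^ E" using PE[of 1] by (simp add: E_def)
    finally have "\<bar>y\<bar> \<le> (w * N + 1) * P ^ E" using 2 unfolding y_def by (simp add: algebra_simps)
    moreover have "\<bar>y / P\<bar> \<le> \<bar>y\<bar>"
      using P mult_left_mono[of 1 P "\<bar>y\<bar>"] by (simp add: abs_divide divide_simps)
    moreover have "real N * 1 \<le> N * P ^ E" using PE[of 0] by (intro mult_left_mono) auto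
    moreover have "(N + w * N + 1) * P ^ E = N * P ^ E + (w * N + 1) * P ^ E"
      by (simp add: algebra_simps)
    ultimately show ?thesis using 1 by linarith
  qed
  have "\<bar>real_of_int (x l)\<bar> \<le> (N + w * N + 1) * P ^ E"
  proof -
    consider "l < d" | "d \<le> l" "l < N" | "l = N" using l unfolding N_def by linarith
    then show ?thesis
    proof cases
      case 2
      have "\<bar>real_of_int (x l)\<bar> \<le> N * P ^ 2" by (rule big[OF 2])
      also have "\<dots> \<le> (N + w * N + 1) * P ^ E"
        using P by (intro mult_mono PE) (auto simp: E_def)
      finally show ?thesis .
    next
      case 3
      have "\<bar>real_of_int (x l)\<bar> \<le> 1 * P ^ 0" using xN 3 by (simp add: N_def)
      also have "\<dots> \<le> (N + w * N + 1) * P ^ E" using P by (intro mult_mono PE) auto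
      finally show ?thesis .
    qed (rule small)
  qed
  then have "real_of_int \<bar>x l\<bar> \<le> real_of_int ((N + w * N + 1) * p ^ E)"
    by (simp add: P_def)
  then show ?thesis unfolding of_int_le_iff N_def E_def by (simp add: add_ac)
qed

lemma dec_near:
  fixes y :: "nat \<Rightarrow> int"
  assumes D: "1 \<le> D" "D < int p" and Q: "1 \<le> Q"
    and ip: "dec_ip d w k (int p) D t s (rvec y) (rvec y) \<le> Q * real_of_int D ^ 2"
    and yN: "y (d + w) = 1" and i: "i < d"
  shows "near p (Q * D) ((\<Sum>j<w. y (d + j) * t i ^ (k + j)) - s i)"
proof -
  have p: "1 \<le> real p" using D by simp
  define z where "z = (\<Sum>j<w. y (d + j) * t i ^ (k + j)) - s i - (- y i) * int p"
  have "dec_W d (int p) D i * (dec_lam d w k (int p) t s i (rvec y))\<^sup>2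
      \<le> (\<Sum>i<d + w. dec_W d (int p) D i * (dec_lam d w k (int p) t s i (rvec y))\<^sup>2)"
    using i by (intro member_le_sum) (auto simp: dec_W_def)
  also have "\<dots> = dec_ip d w k (int p) D t s (rvec y) (rvec y)"
    by (simp add: dec_ip_def form_ip_def power2_eq_square mult.assoc)
  also note ip
  finally have "(real p * dec_lam d w k (int p) t s i (rvec y))\<^sup>2 \<le> Q * real_of_int D ^ 2"
    using i by (simp add: dec_W_def power_mult_distrib)
  also have "real p * dec_lam d w k (int p) t s i (rvec y) = real_of_int z"
  proof -
    have "real p * (u + v / real p) = real p * u + v" for u v using p by (simp add: distrib_left)
    then show ?thesis using i yN by (simp add: dec_lam_def rvec_def z_def mult.commute)
  qed
  \<comment> \<open>Passing from \<open>Q\<close> to Q^2, possible since Q \<ge> 1, avoids a square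
    root in the conclusion.\<close>
  also have "Q * real_of_int D ^ 2 \<le> Q * (Q * real_of_int D ^ 2)"
    using Q D mult_right_mono[OF Q, of "real_of_int D ^ 2"] by (intro mult_left_mono) auto
  also have "\<dots> = (Q * D)\<^sup>2" by (simp add: power2_eq_square)
  finally have "\<bar>real_of_int z\<bar> \<le> \<bar>Q * D\<bar>" by (simp add: abs_le_square_iff)
  then have "\<bar>real_of_int z\<bar> \<le> Q * D" using Q D by simp
  then show ?thesis unfolding near_def z_def by blast
qed

text \<open>The vector consists of the negated multiples of \<open>p\<close>, the coefficients and a
  final 1. Each error contributes at most D^2, and so does each coefficient, being smaller than
  \<open>p\<close> with weight D^2 / p^2.\<close>

lemma dec_close_vector:
  fixes a :: "nat \<Rightarrow> int"
  assumes D: "1 \<le> D" "D < int p" and a: "\<And>j. j < w \<Longrightarrow> a j \<in> {0..<int p}"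
    and near: "\<And>i. i < d \<Longrightarrow> near p D ((\<Sum>j<w. a j * t i ^ (k + j)) - s i)"
  shows "\<exists>x :: nat \<Rightarrow> int. (\<forall>l>d + w. x l = 0) \<and> x (d + w) = 1 \<and>
    dec_ip d w k (int p) D t s (rvec x) (rvec x) \<le> (d + w) * real_of_int D ^ 2"
proof -
  have p: "1 \<le> real p" using D by simp
  have "\<forall>i. \<exists>c. i < d \<longrightarrow> \<bar>real_of_int ((\<Sum>j<w. a j * t i ^ (k + j)) - s i - c * int p)\<bar> \<le> D"
    using near unfolding near_def by blast
  from choice[OF this] obtain c where
    c: "\<And>i. i < d \<Longrightarrow> \<bar>real_of_int ((\<Sum>j<w. a j * t i ^ (k + j)) - s i - c i * int p)\<bar> \<le> D" by blast
  define x where "x l = (if l < d then - c l else if l < d + w then a (l - d) else if l = d + w then 1 else 0)" for l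
  have xN: "x (d + w) = 1" by (simp add: x_def)
  have "dec_W d (int p) D i * (dec_lam d w k (int p) t s i (rvec x))\<^sup>2 \<le> real_of_int D ^ 2" if i: "i < d + w" for i
  proof (cases "i < d")
    case True
    have *: "(\<Sum>j<w. real_of_int (x (d + j)) * real_of_int (t i) ^ (k + j)) = (\<Sum>j<w. real_of_int (a j) * real_of_int (t i) ^ (k + j))"
      by (intro sum.cong) (auto simp: x_def)
    have "real p * dec_lam d w k (int p) t s i (rvec x) = real_of_int ((\<Sum>j<w. a j * t i ^ (k + j)) - s i - c i * int p)"
    proof -
      have "real p * (u + v / real p) = real p * u + v" for u v using p by (simp add: distrib_left)
      moreover have "dec_lam d w k (int p) t s i (rvec x) = real_of_int (x i) +
          ((\<Sum>j<w. real_of_int (a j) * real_of_int (t i) ^ (k + j)) - real_of_int (s i)) / real p"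
        using True *[symmetric] xN by (simp add: dec_lam_def rvec_def)
      ultimately have "real p * dec_lam d w k (int p) t s i (rvec x) = real p * real_of_int (x i) +
          ((\<Sum>j<w. real_of_int (a j) * real_of_int (t i) ^ (k + j)) - real_of_int (s i))" by simp
      then show ?thesis using True by (simp add: x_def)
    qed
    then have "\<bar>real p * dec_lam d w k (int p) t s i (rvec x)\<bar> \<le> \<bar>real_of_int D\<bar>" using c[OF True] by simp
    then have "(real p * dec_lam d w k (int p) t s i (rvec x))\<^sup>2 \<le> (real_of_int D)\<^sup>2" unfolding abs_le_square_iff .
    then show ?thesis using True by (simp add: dec_W_def power_mult_distrib)
  next
    case False
    then have "a (i - d) \<in> {0..<int p}" using i by (intro a) auto
    then have "real_of_int (a (i - d)) \<le> real p" "0 \<le> real_of_int (a (i - d))" by auto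
    then have "(real_of_int (a (i - d)))\<^sup>2 \<le> real p ^ 2" by (intro power_mono)
    then have "real_of_int D ^ 2 * (real_of_int (a (i - d)))\<^sup>2 \<le> real_of_int D ^ 2 * real p ^ 2"
      by (intro mult_left_mono) auto
    then have "real_of_int D ^ 2 * (real_of_int (a (i - d)))\<^sup>2 / real p ^ 2 \<le> real_of_int D ^ 2"
      using p by (simp add: pos_divide_le_eq)
    moreover have "x i = a (i - d)" using False i by (simp add: x_def)
    ultimately show ?thesis using False by (simp add: dec_W_def dec_lam_def rvec_def)
  qed
  then have "(\<Sum>i<d + w. dec_W d (int p) D i * (dec_lam d w k (int p) t s i (rvec x))\<^sup>2)
      \<le> (\<Sum>i<d + w. real_of_int D ^ 2)" by (intro sum_mono) simp
  also have "(\<Sum>i<d + w. dec_W d (int p) D i * (dec_lam d w k (int p) t s i (rvec x))\<^sup>2)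
      = dec_ip d w k (int p) D t s (rvec x) (rvec x)"
    by (simp add: dec_ip_def form_ip_def power2_eq_square mult.assoc)
  finally have "dec_ip d w k (int p) D t s (rvec x) (rvec x) \<le> (d + w) * real_of_int D ^ 2" by simp
  moreover have "\<forall>l>d + w. x l = 0" by (simp add: x_def)
  ultimately show ?thesis using xN by (intro exI[of _ x] conjI) simp_all
qed

section \<open>The decoding program for a fixed lowest exponent\<close>

lemma bits_power: "bits (x ^ k) \<le> 2 + k * bits x"
proof (induction k)
  case 0
  show ?case using bits_le_Suc_iff[of 1 1] by simp
next
  case (Suc k)
  then show ?case using bits_mult[of x "x ^ k"] by simp
qed

lemma dec_ip_cong:
  assumes "\<And>i. i < d \<Longrightarrow> t i = t' i" and "\<And>i. i < d \<Longrightarrow> s i = s' i"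
  shows "dec_ip d w k p D t s = dec_ip d w k p D t' s'"
proof -
  have "dec_lam d w k p t s i = dec_lam d w k p t' s' i" for i
    unfolding dec_lam_def using assms by (auto simp: fun_eq_iff)
  then show ?thesis by (simp add: dec_ip_def form_ip_def fun_eq_iff)
qed

lemma rarith_dec_ip:
  assumes p: "arith S p" and D: "arith S D"
    and t: "\<And>i. i < d \<Longrightarrow> arith S (\<lambda>M. t M i)" and s: "\<And>i. i < d \<Longrightarrow> arith S (\<lambda>M. s M i)"
    and x: "\<And>l. rarith S (\<lambda>M. x M l)" and y: "\<And>l. rarith S (\<lambda>M. y M l)"
  shows "rarith S (\<lambda>M. dec_ip d w k (p M) (D M) (t M) (s M) (x M) (y M))"
proof -
  have lam: "rarith S (\<lambda>M. dec_lam d w k (p M) (t M) (s M) i (z M))"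
    if "\<And>l. rarith S (\<lambda>M. z M l)" for i z
  proof (cases "i < d")
    case True
    show ?thesis unfolding dec_lam_def if_P[OF True]
      by (intro rarith_add rarith_divide rarith_diff rarith_sum rarith_mult rarith_power
          rarith_of_int p t[OF True] s[OF True] that finite_lessThan)
  next
    case False
    then show ?thesis unfolding dec_lam_def if_not_P[OF False] by (intro that)
  qed
  have W: "rarith S (\<lambda>M. dec_W d (p M) (D M) i)" for i
    unfolding dec_W_def
    by (cases "i < d") (auto intro!: rarith_divide rarith_power rarith_of_int p D)
  show ?thesis
    unfolding dec_ip_def form_ip_def
    by (intro rarith_sum rarith_mult W lam x y finite_lessThan)
qed

text \<open>Both \<open>k\<close> and \<open>w\<close> are constants of the program text, as they
  determine the dimension and the exponents. The time bound holds for all \<open>ss\<close>. The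
  last clause promises only that \<open>y\<close> fits the data up to the factor \<open>Q\<close> if
  some \<open>a\<close> fits them; that this determines \<open>a\<close> modulo \<open>p\<close> is
  left to the random choice of the points.\<close>

lemma exec_decoder:
  fixes d k w :: nat
  assumes w: "1 \<le> w" "w \<le> d"
  shows "\<exists>A (\<kappa>::nat) (Q::real). 1 \<le> Q \<and> (\<forall>(p::nat) (h::nat) (D::int) ts ss.
     2 \<le> p \<longrightarrow> 2 * h < p \<longrightarrow> 1 \<le> D \<longrightarrow> D < int p \<longrightarrow> length ts = d \<longrightarrow> set ts \<subseteq> {- int h..int h} \<longrightarrow>
     length ss = d \<longrightarrow> set ss \<subseteq> {0..<int p} \<longrightarrow>
     (\<exists>T M' (y :: nat \<Rightarrow> int). exec A (load (interp_input p h k D ts ss)) T M' \<and> T \<le> \<kappa> * bits (int p) ^ 3 \<and>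
        (\<forall>j<w. M' (int j) = y j mod int p) \<and>
        (\<forall>a. (\<forall>j<w. a j \<in> {0..<int p}) \<longrightarrow> (\<forall>i<d. near p D ((\<Sum>j<w. a j * (ts ! i) ^ (k + j)) - ss ! i)) \<longrightarrow>
           (\<forall>i<d. near p (Q * D) ((\<Sum>j<w. y j * (ts ! i) ^ (k + j)) - ss ! i)))))"
proof -
  define N where "N = d + w"
  \<comment> \<open>The input has four parameters and \<open>2 * d\<close> numbers. The state is the
    counter, in position 0, followed by the rows 0, ..., \<open>N\<close> of length
    \<open>N + 1\<close>.\<close>
  define c where "c = 4 + 2 * d"
  define r where "r = 1 + (N + 1) * (N + 1)"
  \<comment> \<open>The potential is at most 4 N^2 ln p initially and drops by ln (4/3) \<ge> 1/4
    per round until balance is reached, so 16 N^2 ln p rounds suffice. A counter that starts at p^K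
    and is halved in each round lasts for more than K ln p rounds, and no logarithm has to be
    computed.\<close>
  define K where "K = 16 * N ^ 2"
  define IPm where "IPm M = dec_ip d w k (M (int 0)) (M (int 3)) (\<lambda>i. M (int (4 + i))) (\<lambda>i. M (int (4 + d + i)))" for M :: mem
  define bm where "bm M i l = (if i \<le> N \<and> l \<le> N then M (int (c + (1 + (i * (N + 1) + l)))) else 0)" for M :: mem and i l
  define init where "init q M = (if q = 0 then M (int 0) ^ K
     else if (q - 1) div (N + 1) = (q - 1) mod (N + 1) then 1 else 0)" for q and M :: mem
  define step where "step q M = (if q = 0 then M (int c) div 2
     else lll_step (IPm M) N (bm M) ((q - 1) div (N + 1)) ((q - 1) mod (N + 1)))" for q and M :: mem
  define fin where "fin q M = (if q < w then reduce (IPm M) (bm M) N (d + q) mod M (int 0) else 0)" for q and M :: mem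
  \<comment> \<open>The loss of \<open>nearest_plane\<close> times the factor \<open>N\<close> of
    \<open>dec_close_vector\<close>.\<close>
  define Q where "Q = (1 + real N * 2 ^ N) * real N"
  let ?S = "{..<c + r}"
  have idx: "1 + (i * (N + 1) + l) < r" if "i \<le> N" "l \<le> N" for i l
  proof -
    have "i * (N + 1) \<le> N * (N + 1)" using that(1) by (rule mult_le_mono1)
    then show ?thesis using that(2) by (simp add: r_def)
  qed
  have bm_arith: "arith ?S (\<lambda>M. bm M i l)" for i l
  proof (cases "i \<le> N \<and> l \<le> N")
    case True
    then have "c + (1 + (i * (N + 1) + l)) \<in> ?S" using idx[of i l] by simp
    then show ?thesis using True arith.cell[of "c + (1 + (i * (N + 1) + l))" ?S] by (simp add: bm_def)
  next
    case False
    then have "(\<lambda>M. bm M i l) = (\<lambda>_. 0)" by (auto simp: bm_def)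
    then show ?thesis by (simp add: arith.const)
  qed
  have IPm_arith: "rarith ?S (\<lambda>M. IPm M (x M) (y M))"
    if "\<And>l. rarith ?S (\<lambda>M. x M l)" "\<And>l. rarith ?S (\<lambda>M. y M l)" for x y
    unfolding IPm_def by (intro rarith_dec_ip that arith.cell) (auto simp: c_def)
  have init_arith: "arith {..<c + r} (init q)" for q
  proof -
    have "arith ?S (\<lambda>M. M (int 0) ^ K)" by (intro arith_power arith.cell) (simp add: c_def)
    then show ?thesis unfolding init_def by (cases "q = 0") (auto intro: arith.const)
  qed
  have step_arith: "arith {..<c + r} (step q)" for q
  proof (cases "q = 0")
    case True
    have "arith ?S (\<lambda>M. M (int c) div 2)" by (intro arith.intros) (simp add: r_def)
    then show ?thesis using True unfolding step_def by simp
  next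
    case False
    have "arith ?S (\<lambda>M. lll_step (IPm M) N (bm M) ((q - 1) div (N + 1)) ((q - 1) mod (N + 1)))"
      by (rule arith_lll_step) (rule IPm_arith bm_arith; assumption)+
    then show ?thesis using False unfolding step_def by simp
  qed
  have fin_arith: "arith {..<c + r} (fin q)" for q
  proof (cases "q < w")
    case True
    have "arith ?S (\<lambda>M. reduce (IPm M) (bm M) N (d + q))"
      by (rule arith_reduce) (rule IPm_arith bm_arith; assumption)+
    moreover have "arith ?S (\<lambda>M. M (int 0))" by (intro arith.cell) (simp add: c_def)
    ultimately show ?thesis using True unfolding fin_def by (simp add: arith_mod)
  next
    case False
    then show ?thesis unfolding fin_def by (simp add: arith.const)
  qed
  have r: "0 < r" "w \<le> r" "w \<le> c"
    using w by (auto simp: r_def c_def N_def)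
  obtain A \<kappa> where A: "\<forall>xs B t v.
     length xs = c \<longrightarrow> 1 \<le> B \<longrightarrow> (\<forall>x\<in>set xs. bits x \<le> B) \<longrightarrow>
     v 0 = (\<lambda>i. init i (load xs)) \<longrightarrow>
     (\<forall>s<t. v s 0 > 0 \<and> v (Suc s) = (\<lambda>i. step i (enc r xs (v s)))) \<longrightarrow> v t 0 \<le> 0 \<longrightarrow>
     (\<forall>s\<le>t. \<forall>i<r. bits (v s i) \<le> B) \<longrightarrow> (\<forall>i<r. bits (fin i (enc r xs (v t))) \<le> B) \<longrightarrow>
     (\<exists>T M'. exec A (load xs) T M' \<and> T \<le> \<kappa> * (t + 1) * B\<^sup>2 \<and>
        (\<forall>i<w. M' (int i) = fin i (enc r xs (v t))))"
    using loop_program[of r c init step fin w, OF init_arith step_arith fin_arith r] by (elim exE) (rule that)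
  define E where "E = k + w + 2"
  define Z where "Z = int (N + w * N + 1)"
  \<comment> \<open>In units of the length of \<open>p\<close>, the summands bound the lengths of
    \<open>k\<close>, of the counter, of the basis entries, and of the remaining inputs and the
    outputs.\<close>
  define c1 where "c1 = bits (int k) + (2 + K) + (bits Z + (2 + E)) + 1"
  have "1 \<le> Q"
  proof -
    have "1 * 1 \<le> Q" unfolding Q_def using w by (intro mult_mono) (auto simp: N_def)
    then show ?thesis by simp
  qed
  moreover have "\<exists>T M' (y :: nat \<Rightarrow> int). exec A (load (interp_input p h k D ts ss)) T M' \<and>
        T \<le> \<kappa> * (3 + K) * c1\<^sup>2 * bits (int p) ^ 3 \<and>
        (\<forall>j<w. M' (int j) = y j mod int p) \<and>
        (\<forall>a. (\<forall>j<w. a j \<in> {0..<int p}) \<longrightarrow> (\<forall>i<d. near p D ((\<Sum>j<w. a j * (ts ! i) ^ (k + j)) - ss ! i)) \<longrightarrow>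
           (\<forall>i<d. near p (Q * D) ((\<Sum>j<w. y j * (ts ! i) ^ (k + j)) - ss ! i)))"
    if p: "2 \<le> p" and h: "2 * h < p" and D: "1 \<le> D" "D < int p"
      and ts: "length ts = d" "set ts \<subseteq> {- int h..int h}" and ss: "length ss = d" "set ss \<subseteq> {0..<int p}"
    for p h D ts ss
  proof -
    define xs where "xs = interp_input p h k D ts ss"
    have len: "length xs = c" using ts ss by (simp add: xs_def interp_input_def c_def)
    have x0: "xs ! 0 = int p" "xs ! 3 = D" by (simp_all add: xs_def interp_input_def)
    have xt: "xs ! (4 + i) = ts ! i" "xs ! (4 + d + i) = ss ! i" if "i < d" for i
      using that ts ss by (simp_all add: xs_def interp_input_def nth_append)
    have t_abs: "\<bar>ts ! i\<bar> \<le> int p" if "i < d" for i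
    proof -
      have "ts ! i \<in> {- int h..int h}" using that ts nth_mem by blast
      then show ?thesis using h by auto
    qed
    have s_abs: "\<bar>ss ! i\<bar> \<le> int p" if "i < d" for i
    proof -
      have "ss ! i \<in> {0..<int p}" using that ss nth_mem by blast
      then show ?thesis by auto
    qed
    define IP where "IP = dec_ip d w k (int p) D ((!) ts) ((!) ss)"
    have IPm: "IPm (enc r xs v) = IP" for v
    proof -
      have "enc r xs v (int i) = xs ! i" if "i < c" for i using that len by (intro enc_input) simp
      from this[of 0] this[of 3] this[of "4 + _"] this[of "4 + d + _"] show ?thesis
        unfolding IPm_def IP_def x0(1)[symmetric] x0(2)[symmetric]
        using xt by (auto simp: c_def simp del: of_nat_add intro!: dec_ip_cong)
    qed
    define v where "v s = ((\<lambda>u q. step q (enc r xs u)) ^^ s) (\<lambda>q. init q (load xs))" for s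
    define bs where "bs s = bm (enc r xs (v s))" for s
    have v0: "v 0 = (\<lambda>q. init q (load xs))" by (simp add: v_def)
    have vS: "v (Suc s) = (\<lambda>q. step q (enc r xs (v s)))" for s by (simp add: v_def)
    have bs_in: "bs s i l = v s (1 + (i * (N + 1) + l))" if "i \<le> N" "l \<le> N" for s i l
      unfolding bs_def bm_def using that idx[OF that] enc_state[of "1 + (i * (N + 1) + l)" r xs "v s"] len
      by simp
    have bs_out: "bs s i l = 0" if "\<not> (i \<le> N \<and> l \<le> N)" for s i l
      unfolding bs_def bm_def using that by auto
    have dm: "(1 + (i * (N + 1) + l) - 1) div (N + 1) = i" "(1 + (i * (N + 1) + l) - 1) mod (N + 1) = l"
      if "l \<le> N" for i l
      using that div_mult_self3[of "N + 1" i l] mod_mult_self3[of i "N + 1" l] by simp_all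
    have bs0: "bs 0 i = (\<lambda>l. if i = l then 1 else 0)" if "i \<le> N" for i
    proof
      fix l
      show "bs 0 i l = (if i = l then 1 else 0)"
      proof (cases "l \<le> N")
        case True
        then show ?thesis unfolding bs_in[OF that True] v0 init_def dm[OF True] by simp
      next
        case False
        then show ?thesis using that bs_out[of i l 0] by auto
      qed
    qed
    have bsS: "bs (Suc s) i l = lll_step IP N (bs s) i l" if "i \<le> N" "l \<le> N" for s i l
      unfolding bs_in[OF that] vS step_def dm[OF that(2)] IPm bs_def[symmetric] by simp
    have ctr: "v s 0 = int p ^ K div 2 ^ s" for s
    proof (induction s)
      case 0
      have "load xs (int 0) = int p" using len x0 by (simp add: load_def c_def)
      then show ?case unfolding v0 init_def by simp
    next
      case (Suc s)
      have "enc r xs (v s) (int c) = v s 0"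
        using enc_state[of 0 r xs "v s"] len r(1) by simp
      then show ?case unfolding vS step_def
        using Suc by (simp add: zdiv_zmult2_eq power_Suc2 del: power_Suc)
    qed
    interpret qf: quad_form N "dec_W d (int p) D" "dec_lam d w k (int p) ((!) ts) ((!) ss)" "1 / real_of_int (int p) ^ 2" "real_of_int (int p) ^ 2"
      unfolding N_def using D by (intro dec_quad_form)
    have IP: "form_ip N (dec_W d (int p) D) (dec_lam d w k (int p) ((!) ts) ((!) ss)) = IP"
      unfolding IP_def dec_ip_def N_def ..
    have p1: "1 < real p" using p by simp
    define P0 where "P0 = real N ^ 2 * (4 * ln (real p))"
    have coords: "\<bar>x l\<bar> \<le> Z * int p ^ E" if "IP (rvec x) (rvec x) \<le> N * real_of_int (int p) ^ 2" "\<bar>x N\<bar> \<le> 1" "l \<le> N" for x l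
      using dec_coords_bound[OF D, of d "(!) ts" "(!) ss" w k x l] t_abs s_abs that
      unfolding IP_def N_def Z_def E_def by (simp add: algebra_simps)
    \<comment> \<open>The bound on the entries is derived afresh from the form in every round and
      not from its predecessor, so it does not grow with \<open>s\<close>.\<close>
    have inv: "\<exists>B L. qf.gso (bs s) B L \<and> qf.decoding_basis (bs s) \<and>
        (qf.balanced B \<or> qf.potential B \<le> P0 - s * ln (4 / 3)) \<and> (\<forall>i\<le>N. \<forall>l\<le>N. \<bar>bs s i l\<bar> \<le> Z * int p ^ E)" for s
    proof (induction s)
      case 0
      let ?W = "dec_W d (int p) D" and ?L = "dec_lam d w k (int p) ((!) ts) ((!) ss)"
      have g: "qf.gso (bs 0) ?W ?L"
        unfolding qf.gso_def form_ip_def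
        using qf.W_bounds qf.lam_lin dec_lam_unit[of _ _ d w k "int p" "(!) ts" "(!) ss"]
        by (auto simp: bs0 N_def)
      have "x \<in> qf.Zspan (bs 0)" if "\<forall>l>N. x l = 0" for x
      proof -
        have "x = (\<lambda>l. \<Sum>j\<le>N. x j * bs 0 j l)"
        proof
          fix l
          have "(\<Sum>j\<le>N. x j * bs 0 j l) = (\<Sum>j\<le>N. if j = l then x l else 0)"
            by (intro sum.cong) (auto simp: bs0)
          also have "\<dots> = x l" using that by auto
          finally show "x l = (\<Sum>j\<le>N. x j * bs 0 j l)" by simp
        qed
        then show ?thesis unfolding qf.Zspan_def by (intro CollectI exI[of _ x])
      qed
      then have "qf.decoding_basis (bs 0)"
        unfolding qf.decoding_basis_def by (auto simp: bs0)
      moreover have "qf.potential ?W \<le> P0"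
      proof -
        have 1: "1 / real_of_int (int p) ^ 2 \<le> real_of_int (int p) ^ 2"
          using qf.W_bounds[of 0] w unfolding N_def by force
        have "real_of_int (int p) ^ 2 / (1 / real_of_int (int p) ^ 2) = real p ^ 4" by (simp flip: power_add)
        then have "ln (real_of_int (int p) ^ 2 / (1 / real_of_int (int p) ^ 2)) = 4 * ln (real p)"
          using p1 by (simp only:) (simp add: ln_realpow)
        then show ?thesis using qf.potential_le[OF g 1] unfolding P0_def by simp
      qed
      moreover have "1 \<le> Z * int p ^ E"
        using p mult_mono[of 1 Z 1 "int p ^ E"] by (simp add: Z_def)
      then have "\<forall>i\<le>N. \<forall>l\<le>N. \<bar>bs 0 i l\<bar> \<le> Z * int p ^ E" by (auto simp: bs0)
      ultimately show ?case using g by (intro exI[of _ ?W] exI[of _ ?L]) auto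
    next
      case (Suc s)
      then obtain B L where g: "qf.gso (bs s) B L" and db: "qf.decoding_basis (bs s)"
        and pot: "qf.balanced B \<or> qf.potential B \<le> P0 - s * ln (4 / 3)" by blast
      let ?b = "lll_step IP N (bs s)"
      have db': "qf.decoding_basis ?b" using qf.decoding_basis_step[OF g db] unfolding IP .
      have eq: "?b j = bs (Suc s) j" if "j \<le> N" for j
      proof
        fix l
        show "?b j l = bs (Suc s) j l"
          using bsS[OF that, of l s] bs_out[of j l "Suc s"] db' that unfolding qf.decoding_basis_def
          by (cases "l \<le> N") auto
      qed
      have "\<exists>B' L'. qf.gso ?b B' L' \<and> (qf.balanced B' \<or> qf.potential B' \<le> P0 - Suc s * ln (4 / 3))"
      proof (cases "qf.balanced B")
        case True
        then show ?thesis using qf.gso_step_balanced[OF g True] unfolding IP by blast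
      next
        case False
        then have "qf.potential B \<le> P0 - s * ln (4 / 3)" using pot by blast
        moreover obtain B' L' where "qf.gso ?b B' L'" "qf.balanced B' \<or> qf.potential B' \<le> qf.potential B - ln (4 / 3)"
          using qf.gso_step[OF g] unfolding IP by blast
        ultimately show ?thesis by (intro exI[of _ B'] exI[of _ L']) (auto simp: algebra_simps)
      qed
      then obtain B' L' where g': "qf.gso ?b B' L'" and pot': "qf.balanced B' \<or> qf.potential B' \<le> P0 - Suc s * ln (4 / 3)"
        by blast
      have "\<bar>?b i l\<bar> \<le> Z * int p ^ E" if "i \<le> N" "l \<le> N" for i l
      proof (rule coords[OF _ _ that(2)])
        show "IP (rvec (?b i)) (rvec (?b i)) \<le> N * real_of_int (int p) ^ 2"
          using qf.ip_step_le[OF g that(1)] unfolding IP .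
        show "\<bar>?b i N\<bar> \<le> 1" using db' that(1) unfolding qf.decoding_basis_def by (cases "i = N") auto
      qed
      then have "\<forall>i\<le>N. \<forall>l\<le>N. \<bar>bs (Suc s) i l\<bar> \<le> Z * int p ^ E" using eq by metis
      then show ?case
        using qf.gso_cong[OF eq g'] qf.decoding_basis_cong[OF eq db'] pot' by blast
    qed
    define t where "t = bits (int p ^ K) - 1"
    have bt: "bits (int p ^ K) = Suc t" using bits_ge_1[of "int p ^ K"] by (simp add: t_def)
    have pt: "int p ^ K < 2 ^ t" using bits_le_Suc_iff[of "int p ^ K" t] bt by simp
    have ps: "2 ^ s \<le> int p ^ K" if "s < t" for s
      using bits_le_Suc_iff[of "int p ^ K" s] bt that by simp
    have pos: "0 < v s 0" if "s < t" for s
      unfolding ctr using ps[OF that] by (simp add: pos_imp_zdiv_pos_iff)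
    have vt: "v t 0 \<le> 0" unfolding ctr using pt by simp
    obtain B L where g: "qf.gso (bs t) B L" and db: "qf.decoding_basis (bs t)"
        and pot: "qf.balanced B \<or> qf.potential B \<le> P0 - t * ln (4 / 3)" using inv[of t] by blast
    have bal: "qf.balanced B"
    proof (rule ccontr)
      assume "\<not> qf.balanced B"
      then have "t * ln (4 / 3) \<le> P0" using pot qf.potential_nonneg[OF g] by simp
      moreover have "t * (1 / 4) \<le> t * ln (4 / 3 :: real)"
        using ln_ge_iff[of "4/3" "1/4"] ln_le_minus_one[of "3/4 :: real"] ln_div[of 3 "4::real"] ln_div[of 4 "3::real"]
        by (intro mult_left_mono) auto
      moreover have "K * ln (real p) < t"
      proof -
        have "real_of_int (int p ^ K) < real_of_int (2 ^ t)" using pt of_int_less_iff by blast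
        then have "real p ^ K < 2 ^ t" by simp
        then have "ln (real p ^ K) < ln (2 ^ t)" using p1 by (subst ln_less_cancel_iff) auto
        then have "K * ln (real p) < t * ln 2" using p1 by (simp add: ln_realpow)
        also have "\<dots> \<le> real t * 1" using ln_le_minus_one[of "2 :: real"] by (intro mult_left_mono) auto
        finally show ?thesis by simp
      qed
      ultimately show False unfolding P0_def K_def by (simp add: algebra_simps)
    qed
    define Bd where "Bd = c1 * bits (int p)"
    have bp: "1 \<le> bits (int p)" by (rule bits_ge_1)
    have Bd_le: "m * bits (int p) \<le> Bd" if "m \<le> c1" for m unfolding Bd_def using that by (rule mult_le_mono1)
    have Bp: "bits x \<le> Bd" if "\<bar>x\<bar> \<le> int p" for x
      using bits_mono[of x "int p"] that Bd_le[of 1] by (simp add: c1_def)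
    have B_in: "bits x \<le> Bd" if x: "x \<in> set xs" for x
    proof (cases "x = int k")
      case True
      have "bits x * 1 \<le> bits (int k) * bits (int p)" using bp True by (intro mult_le_mono) auto
      also have "\<dots> \<le> Bd" by (rule Bd_le) (simp add: c1_def)
      finally show ?thesis by simp
    next
      case False
      then have "x \<in> {int p, int h, D} \<union> set ts \<union> set ss"
        using x by (auto simp: xs_def interp_input_def)
      then show ?thesis using h D by (intro Bp) (auto dest!: subsetD[OF ts(2)] subsetD[OF ss(2)])
    qed
    have B_v: "bits (v s q) \<le> Bd" if "q < r" for s q
    proof (cases "q = 0")
      case True
      have "\<bar>v s 0\<bar> \<le> \<bar>int p ^ K\<bar>" unfolding ctr by (rule abs_div_le)
      then have "bits (v s 0) \<le> 2 + K * bits (int p)" using bits_mono bits_power le_trans by blast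
      also have "\<dots> \<le> (2 + K) * bits (int p)" using bp by (simp add: algebra_simps)
      also have "\<dots> \<le> Bd" by (rule Bd_le) (simp add: c1_def)
      finally show ?thesis using True by simp
    next
      case False
      define i l where "i = (q - 1) div (N + 1)" and "l = (q - 1) mod (N + 1)"
      have "i * (N + 1) + l = q - 1" unfolding i_def l_def by (rule div_mult_mod_eq)
      then have q: "q = 1 + (i * (N + 1) + l)" using False by linarith
      have l: "l \<le> N" unfolding l_def using mod_less_divisor[of "N + 1" "q - 1"] by linarith
      have "q - 1 < (N + 1) * (N + 1)" using that False by (simp add: r_def)
      then have "i < N + 1" unfolding i_def by (intro less_mult_imp_div_less)
      then have i: "i \<le> N" by simp
      have "\<bar>v s q\<bar> \<le> \<bar>Z * int p ^ E\<bar>" using inv[of s] i l bs_in[OF i l, of s] unfolding q by force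
      then have "bits (v s q) \<le> bits (Z * int p ^ E)" by (rule bits_mono)
      also have "\<dots> \<le> bits Z + (2 + E * bits (int p))"
        using bits_mult[of Z "int p ^ E"] bits_power[of "int p" E] by simp
      also have "\<dots> \<le> (bits Z + (2 + E)) * bits (int p)"
      proof -
        have "(bits Z + 2) * 1 + E * bits (int p) \<le> (bits Z + 2) * bits (int p) + E * bits (int p)"
          using bp by (intro add_le_mono1 mult_le_mono2)
        then show ?thesis by (simp add: algebra_simps)
      qed
      also have "\<dots> \<le> Bd" by (rule Bd_le) (simp add: c1_def)
      finally show ?thesis .
    qed
    have fin_eq: "fin q (enc r xs (v t)) = (if q < w then reduce IP (bs t) N (d + q) mod int p else 0)" for q
      unfolding fin_def IPm bs_def using enc_input[of 0 xs r "v t"] len x0 by (simp add: c_def)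
    have B_fin: "bits (fin q (enc r xs (v t))) \<le> Bd" for q
    proof -
      have "0 \<le> x mod int p" "x mod int p < int p" for x using p by simp_all
      then show ?thesis unfolding fin_eq by (intro Bp) (auto simp: less_imp_le)
    qed
    have "1 \<le> Bd" using Bd_le[of 1] bp by (simp add: c1_def)
    then have "\<exists>T M'. exec A (load xs) T M' \<and> T \<le> \<kappa> * (t + 1) * Bd\<^sup>2 \<and>
        (\<forall>i<w. M' (int i) = fin i (enc r xs (v t)))"
      by (rule A[rule_format, OF len _ B_in v0 _ vt B_v B_fin]) (simp_all add: pos vS)
    then obtain T M' where T: "exec A (load xs) T M'" "T \<le> \<kappa> * (t + 1) * Bd\<^sup>2"
      "\<And>q. q < w \<Longrightarrow> M' (int q) = fin q (enc r xs (v t))" by blast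
    define y where "y j = reduce IP (bs t) N (d + j)" for j
    \<comment> \<open>The number of rounds is linear in the length of \<open>p\<close>, and a round
      costs its square.\<close>
    have "T \<le> \<kappa> * (3 + K) * c1\<^sup>2 * bits (int p) ^ 3"
    proof -
      have "t + 1 \<le> 2 + K * bits (int p)" using bits_power[of "int p" K] bt by simp
      also have "\<dots> \<le> (3 + K) * bits (int p)" using bp by (simp add: algebra_simps)
      finally have "\<kappa> * (t + 1) * Bd\<^sup>2 \<le> \<kappa> * ((3 + K) * bits (int p)) * Bd\<^sup>2"
        by (intro mult_le_mono) auto
      also have "\<dots> = \<kappa> * (3 + K) * c1\<^sup>2 * bits (int p) ^ 3"
        by (simp add: Bd_def power2_eq_square power3_eq_cube mult_ac)
      finally show ?thesis using T(2) by simp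
    qed
    moreover have "\<forall>j<w. M' (int j) = y j mod int p" using T(3) by (simp add: fin_eq y_def)
    moreover have "near p (Q * D) ((\<Sum>j<w. y j * (ts ! i) ^ (k + j)) - ss ! i)"
      if a: "\<forall>j<w. a j \<in> {0..<int p}" and near: "\<forall>i<d. near p D ((\<Sum>j<w. a j * (ts ! i) ^ (k + j)) - ss ! i)"
        and i: "i < d" for a i
    proof -
      have "\<exists>x :: nat \<Rightarrow> int. (\<forall>l>N. x l = 0) \<and> x N = 1 \<and> IP (rvec x) (rvec x) \<le> N * real_of_int D ^ 2"
        unfolding IP_def N_def using dec_close_vector[OF D, of w a d "(!) ts" k "(!) ss"] a near by simp
      then obtain x :: "nat \<Rightarrow> int" where x: "\<forall>l>N. x l = 0" "x N = 1" "IP (rvec x) (rvec x) \<le> N * real_of_int D ^ 2"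
        by (elim exE conjE) (rule that)
      have "IP (rvec (reduce IP (bs t) N)) (rvec (reduce IP (bs t) N)) \<le> (1 + N * 2 ^ N) * IP (rvec x) (rvec x)"
        using qf.nearest_plane[OF g bal db x(1,2)] unfolding IP .
      also have "\<dots> \<le> (1 + N * 2 ^ N) * (N * real_of_int D ^ 2)" using x(3) by (intro mult_left_mono) auto
      also have "\<dots> = Q * real_of_int D ^ 2" by (simp add: Q_def)
      finally have "dec_ip d w k (int p) D ((!) ts) ((!) ss) (rvec (reduce IP (bs t) N)) (rvec (reduce IP (bs t) N)) \<le> Q * real_of_int D ^ 2"
        unfolding IP_def[symmetric] .
      moreover have "reduce IP (bs t) N (d + w) = 1"
        using qf.decoding_basis_reduce[OF db] unfolding IP qf.decoding_basis_def N_def[symmetric] by blast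
      ultimately show ?thesis using dec_near[OF D \<open>1 \<le> Q\<close> _ _ i] unfolding y_def by blast
    qed
    ultimately show ?thesis using T(1) unfolding xs_def by (intro exI[of _ T] exI[of _ M'] exI[of _ y]) auto
  qed
  ultimately show ?thesis by (intro exI[of _ A] exI[of _ "\<kappa> * (3 + K) * c1\<^sup>2"] exI[of _ Q]) auto
qed

section \<open>Recovery from random points\<close>

text \<open>Nested tests select the program built for the given \<open>k\<close>. They read only
  cell 2, which holds \<open>k\<close>, so their cost \<tau> depends on nothing else in the
  memory.\<close>

lemma exec_dispatch:
  "\<exists>P. \<forall>k\<in>{1..m}. \<exists>\<tau>. \<forall>M T M'. M 2 = int k \<longrightarrow> exec (A k) M T M' \<longrightarrow> exec P M (\<tau> + T) M'"
proof (induction m)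
  case 0
  show ?case by simp
next
  case (Suc m)
  then obtain P where P: "\<And>k. k \<in> {1..m} \<Longrightarrow> \<exists>\<tau>. \<forall>M T M'. M 2 = int k \<longrightarrow> exec (A k) M T M' \<longrightarrow> exec P M (\<tau> + T) M'"
    by blast
  define e where "e = Sub (Mem (Const 2)) (Const (int m))"
  have e: "aval e M = M 2 - int m" for M by (simp add: e_def)
  have ec: "acost e M = acost e (\<lambda>_. M 2)" for M by (simp add: e_def)
  have "\<exists>\<tau>. \<forall>M T M'. M 2 = int k \<longrightarrow> exec (A k) M T M' \<longrightarrow> exec (IfPos e (A (Suc m)) P) M (\<tau> + T) M'"
    if k: "k \<in> {1..Suc m}" for k
  proof (cases "k = Suc m")
    case True
    show ?thesis
    proof (intro exI allI impI)
      fix M T M' assume M: "M 2 = int k" and ex: "exec (A k) M T M'"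
      have "exec (IfPos e (A (Suc m)) P) M (acost e M + bits (aval e M) + T) M'"
        using ex True M by (intro exec.IfTrue) (auto simp: e)
      then show "exec (IfPos e (A (Suc m)) P) M ((acost e (\<lambda>_. int k) + bits (int k - int m)) + T) M'"
        using ec[of M] by (simp add: e M)
    qed
  next
    case False
    then have km: "k \<in> {1..m}" using k by auto
    then obtain \<tau> where \<tau>: "\<And>M T M'. M 2 = int k \<Longrightarrow> exec (A k) M T M' \<Longrightarrow> exec P M (\<tau> + T) M'"
      using P by blast
    show ?thesis
    proof (intro exI allI impI)
      fix M T M' assume M: "M 2 = int k" and ex: "exec (A k) M T M'"
      have "exec (IfPos e (A (Suc m)) P) M (acost e M + bits (aval e M) + (\<tau> + T)) M'"
        using \<tau>[OF M ex] km M by (intro exec.IfFalse) (auto simp: e)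
      then show "exec (IfPos e (A (Suc m)) P) M ((acost e (\<lambda>_. int k) + bits (int k - int m) + \<tau>) + T) M'"
        using ec[of M] by (simp add: e M add.assoc)
    qed
  qed
  then show ?case by blast
qed

lemma bits_le_log:
  assumes "2 \<le> p"
  shows "real (bits (int p)) \<le> 3 * log 2 (real p)" and "1 \<le> log 2 (real p)"
proof -
  show 1: "1 \<le> log 2 (real p)" using assms by (simp add: le_log_iff)
  have "bits (int p) = 1 + nat (\<lfloor>log 2 (real p)\<rfloor> + 1)" using assms by (simp add: bits_def bitlen_alt_def)
  then show "real (bits (int p)) \<le> 3 * log 2 (real p)" using 1 by linarith
qed

text \<open>The infimum is attained because the distances are nonnegative integers.\<close>

lemma near_mult_dist:
  assumes "real_of_int (mult_dist s p) \<le> E"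
  shows "near p E s"
proof -
  obtain j where j: "\<And>i. nat \<bar>s - j * int p\<bar> \<le> nat \<bar>s - i * int p\<bar>"
    using ex_has_least_nat[of "\<lambda>_. True" 0 "\<lambda>j. nat \<bar>s - j * int p\<bar>"] by blast
  have "mult_dist s p = \<bar>s - j * int p\<bar>"
    unfolding mult_dist_def
  proof (rule cInf_eq_minimum)
    fix x assume "x \<in> range (\<lambda>j. \<bar>s - j * int p\<bar>)"
    then obtain i where "x = \<bar>s - i * int p\<bar>" by blast
    then show "\<bar>s - j * int p\<bar> \<le> x" using j[of i] by simp
  qed simp
  then show ?thesis using assms unfolding near_def by (intro exI[of _ j]) simp
qed

lemma prob_ex_all_near_le:
  fixes f :: "'c \<Rightarrow> int set" and q :: real
  assumes C: "finite C" and f: "\<And>c. c \<in> C \<Longrightarrow> real (card ({- int h..int h} \<inter> f c)) \<le> real h * q" and q: "0 \<le> q"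
  shows "measure_pmf.prob (replicate_pmf d (pmf_of_set {- int h..int h})) (\<Union>c\<in>C. {ts. set ts \<subseteq> f c}) \<le> card C * q ^ d"
proof -
  let ?P = "pmf_of_set {- int h..int h}"
  have "measure_pmf.prob (replicate_pmf d ?P) (\<Union>c\<in>C. {ts. set ts \<subseteq> f c})
      \<le> (\<Sum>c\<in>C. measure_pmf.prob (replicate_pmf d ?P) {ts. set ts \<subseteq> f c})"
    using C by (intro measure_pmf.finite_measure_subadditive_finite) auto
  also have "\<dots> \<le> (\<Sum>c\<in>C. q ^ d)"
  proof (rule sum_mono)
    fix c assume c: "c \<in> C"
    have "measure_pmf.prob ?P (f c) = card ({- int h..int h} \<inter> f c) / card {- int h..int h}"
      by (subst measure_pmf_of_set) auto
    also have "\<dots> \<le> (real h * q) / card {- int h..int h}" using f[OF c] by (intro divide_right_mono) auto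
    also have "\<dots> = real h / (2 * real h + 1) * q" by simp
    also have "\<dots> \<le> 1 * q" using q by (intro mult_right_mono) auto
    finally show "measure_pmf.prob (replicate_pmf d ?P) {ts. set ts \<subseteq> f c} \<le> q ^ d"
      unfolding prob_replicate_pmf_all by (intro power_mono) auto
  qed
  finally show ?thesis by simp
qed

lemma sum_lessThan_shift: "k \<le> n \<Longrightarrow> (\<Sum>j<n - k + 1. f (k + j)) = (\<Sum>j=k..n. f j)" for f :: "nat \<Rightarrow> int"
  by (rule sum.reindex_bij_witness[of _ "\<lambda>j. j - k" "\<lambda>j. k + j"]) auto

theorem theorem9:
  fixes \<epsilon> :: real and n :: nat
  assumes "\<epsilon> > 0" and "n \<ge> 1"
  shows "\<exists>(d :: nat) (A :: prog). poly_time_interp n d A \<and>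
    (\<exists>p0 :: nat. \<forall>(p :: nat) (\<Delta> :: real) (h :: nat) (k :: nat).
       prime p \<and> p \<ge> p0 \<and> \<Delta> \<ge> 1 \<and> 1 \<le> h \<and> real h < real p / 2 \<and> 1 \<le> k \<and> k \<le> n \<and>
       real h ^ k > \<Delta> * real p powr \<epsilon> \<and> \<Delta> < real p powr (1 - \<epsilon>) \<longrightarrow>
       (\<forall>a :: nat \<Rightarrow> int. (\<forall>j \<in> {k..n}. a j \<in> {0..<int p}) \<longrightarrow>
          measure_pmf.prob (replicate_pmf d (pmf_of_set {- int h..int h}))
            (recovery_event A n p h k \<Delta> a) \<ge> 1 - 1 / real p))"
proof -
  define sparse where "sparse \<delta> \<kappa> p0 \<longleftrightarrow> (\<forall>(p::nat) (\<Delta>::real) (h::nat) (k::nat) (c :: nat \<Rightarrow> int).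
     prime p \<and> p \<ge> p0 \<and> \<Delta> \<ge> 1 \<and> 1 \<le> h \<and> 2 * h < p \<and> 1 \<le> k \<and> k \<le> n \<and>
     real h ^ k > \<Delta> * real p powr \<epsilon> \<and> \<Delta> < real p powr (1 - \<epsilon>) \<and>
     (\<exists>j\<in>{k..n}. \<not> int p dvd c j) \<longrightarrow>
     real (card {t \<in> {- int h..int h}. near p (\<kappa> * \<Delta>) (\<Sum>j=k..n. c j * t ^ j)}) \<le> real h * real p powr - \<delta>)"
    for \<delta> \<kappa> :: real and p0 :: nat
  have "\<exists>\<delta>>0. \<forall>\<kappa>\<ge>1. \<exists>p0. sparse \<delta> \<kappa> p0"
    unfolding sparse_def by (rule small_value_fraction[OF assms])
  then obtain \<delta> where \<delta>: "0 < \<delta>" and frac: "\<And>\<kappa>. 1 \<le> \<kappa> \<Longrightarrow> \<exists>p0. sparse \<delta> \<kappa> p0"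
    by blast
  \<comment> \<open>The first summand makes p^n p^(-\<delta> d) at most 1/p. The second gives n - k
    + 1 \<le> d, so that the output cells of \<open>exec_decoder\<close> lie within the input
    area.\<close>
  define d where "d = nat \<lceil>(n + 1) / \<delta>\<rceil> + n"
  have d: "n \<le> d" "real n + 1 \<le> \<delta> * d"
  proof -
    have "(n + 1) / \<delta> \<le> d" unfolding d_def by linarith
    then show "real n + 1 \<le> \<delta> * d" using \<delta> by (simp add: field_simps)
  qed (simp add: d_def)
  define decodes where "decodes A \<kappa> Q k \<longleftrightarrow> 1 \<le> Q \<and> (\<forall>(p::nat) (h::nat) (D::int) ts ss.
     2 \<le> p \<longrightarrow> 2 * h < p \<longrightarrow> 1 \<le> D \<longrightarrow> D < int p \<longrightarrow> length ts = d \<longrightarrow> set ts \<subseteq> {- int h..int h} \<longrightarrow>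
     length ss = d \<longrightarrow> set ss \<subseteq> {0..<int p} \<longrightarrow>
     (\<exists>T M' (y :: nat \<Rightarrow> int). exec A (load (interp_input p h k D ts ss)) T M' \<and> T \<le> \<kappa> * bits (int p) ^ 3 \<and>
        (\<forall>j<n - k + 1. M' (int j) = y j mod int p) \<and>
        (\<forall>a. (\<forall>j<n - k + 1. a j \<in> {0..<int p}) \<longrightarrow> (\<forall>i<d. near p D ((\<Sum>j<n - k + 1. a j * (ts ! i) ^ (k + j)) - ss ! i)) \<longrightarrow>
           (\<forall>i<d. near p (Q * D) ((\<Sum>j<n - k + 1. y j * (ts ! i) ^ (k + j)) - ss ! i)))))"
    for A and \<kappa> :: nat and Q :: real and k :: nat
  have "\<exists>A \<kappa> Q. decodes A \<kappa> Q k" if "k \<in> {1..n}" for k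
    unfolding decodes_def using that d by (intro exec_decoder) auto
  then obtain A \<kappa> Q where dec: "\<And>k. k \<in> {1..n} \<Longrightarrow> decodes (A k) (\<kappa> k) (Q k) k" by metis
  obtain P where "\<forall>k\<in>{1..n}. \<exists>\<tau>. \<forall>M T M'. M 2 = int k \<longrightarrow> exec (A k) M T M' \<longrightarrow> exec P M (\<tau> + T) M'"
    using exec_dispatch[of n A] by blast
  then obtain \<tau> where P: "\<And>k M T M'. k \<in> {1..n} \<Longrightarrow> M 2 = int k \<Longrightarrow> exec (A k) M T M' \<Longrightarrow> exec P M (\<tau> k + T) M'"
    by metis
  have run: "\<exists>T M' (y :: nat \<Rightarrow> int). exec P (load (interp_input p h k D ts ss)) (\<tau> k + T) M' \<and> T \<le> \<kappa> k * bits (int p) ^ 3 \<and>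
        (\<forall>j<n - k + 1. M' (int j) = y j mod int p) \<and>
        (\<forall>a. (\<forall>j<n - k + 1. a j \<in> {0..<int p}) \<longrightarrow> (\<forall>i<d. near p D ((\<Sum>j<n - k + 1. a j * (ts ! i) ^ (k + j)) - ss ! i)) \<longrightarrow>
           (\<forall>i<d. near p (Q k * D) ((\<Sum>j<n - k + 1. y j * (ts ! i) ^ (k + j)) - ss ! i)))"
    if asm: "2 \<le> p" "2 * h < p" "k \<in> {1..n}" "1 \<le> D" "D < int p" "length ts = d" "set ts \<subseteq> {- int h..int h}"
      "length ss = d" "set ss \<subseteq> {0..<int p}" for p h k D ts ss
  proof -
    obtain T M' and y :: "nat \<Rightarrow> int" where *: "exec (A k) (load (interp_input p h k D ts ss)) T M'" "T \<le> \<kappa> k * bits (int p) ^ 3"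
        "\<forall>j<n - k + 1. M' (int j) = y j mod int p"
        "\<forall>a. (\<forall>j<n - k + 1. a j \<in> {0..<int p}) \<longrightarrow> (\<forall>i<d. near p D ((\<Sum>j<n - k + 1. a j * (ts ! i) ^ (k + j)) - ss ! i)) \<longrightarrow>
           (\<forall>i<d. near p (Q k * D) ((\<Sum>j<n - k + 1. y j * (ts ! i) ^ (k + j)) - ss ! i))"
      using dec[OF asm(3), unfolded decodes_def, THEN conjunct2, rule_format, OF asm(1,2,4-9)]
      by (elim exE conjE) (rule that)
    have "load (interp_input p h k D ts ss) 2 = int k" by (simp add: load_def interp_input_def)
    from P[OF asm(3) this *(1)] *(2-4) show ?thesis by (intro exI[of _ T] exI[of _ M'] exI[of _ y] conjI)
  qed
  have "poly_time_interp n d P"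
    unfolding poly_time_interp_def
  \<comment> \<open>The decoder is cubic in the length of \<open>p\<close>, which is at most 3 log p
    to base 2, hence 27; the sum serves as a bound for all \<open>k\<close> at once.\<close>
  proof (intro exI[of _ "monom (\<Sum>k\<in>{1..n}. real (\<tau> k) + 27 * real (\<kappa> k)) 3"] allI impI, elim conjE)
    fix p h k :: nat and D :: int and ts ss :: "int list"
    assume a: "prime p" "1 \<le> h" "2 * h < p" "1 \<le> k" "k \<le> n" "1 \<le> D" "D < int p" "length ts = d"
      "set ts \<subseteq> {- int h..int h}" "length ss = d" "set ss \<subseteq> {0..<int p}"
    have p: "2 \<le> p" using a(1) by (rule prime_ge_2_nat)
    have k: "k \<in> {1..n}" using a by simp
    obtain T M' where T: "exec P (load (interp_input p h k D ts ss)) (\<tau> k + T) M'" "T \<le> \<kappa> k * bits (int p) ^ 3"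
      using run[OF p a(3) k a(6-11)] by blast
    let ?L = "log 2 (real p)"
    have L: "1 \<le> ?L" "real (bits (int p)) \<le> 3 * ?L" using bits_le_log[OF p] by auto
    have "real T \<le> real (\<kappa> k * bits (int p) ^ 3)" using T(2) of_nat_le_iff by blast
    also have "\<dots> = real (\<kappa> k) * real (bits (int p)) ^ 3" by simp
    also have "\<dots> \<le> real (\<kappa> k) * (3 * ?L) ^ 3" using L by (intro mult_left_mono power_mono) auto
    also have "\<dots> = 27 * real (\<kappa> k) * ?L ^ 3" by (simp add: power_mult_distrib)
    finally have "real T \<le> 27 * real (\<kappa> k) * ?L ^ 3" .
    moreover have "real (\<tau> k) * 1 \<le> real (\<tau> k) * ?L ^ 3" using L by (intro mult_left_mono one_le_power) auto
    ultimately have "real (\<tau> k + T) \<le> (real (\<tau> k) + 27 * real (\<kappa> k)) * ?L ^ 3" by (simp add: algebra_simps)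
    also have "\<dots> \<le> (\<Sum>k\<in>{1..n}. real (\<tau> k) + 27 * real (\<kappa> k)) * ?L ^ 3"
      using k L by (intro mult_right_mono member_le_sum[of k "{1..n}" "\<lambda>k. real (\<tau> k) + 27 * real (\<kappa> k)"]) auto
    finally show "halts_within P (interp_input p h k D ts ss)
        (poly (monom (\<Sum>k\<in>{1..n}. real (\<tau> k) + 27 * real (\<kappa> k)) 3) ?L)"
      using T(1) unfolding halts_within_def poly_monom by blast
  qed
  moreover
  have "\<exists>p0. sparse \<delta> (Q k + 1) p0" if k: "k \<in> {1..n}" for k
    using dec[OF k] unfolding decodes_def by (intro frac) linarith
  then obtain p1 where p1: "\<And>k. k \<in> {1..n} \<Longrightarrow> sparse \<delta> (Q k + 1) (p1 k)" by metis
  define p0 where "p0 = (\<Sum>k\<in>{1..n}. p1 k)"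
  have "1 - 1 / real p \<le> measure_pmf.prob (replicate_pmf d (pmf_of_set {- int h..int h})) (recovery_event P n p h k \<Delta> a)"
    if p: "prime p" "p0 \<le> p" and \<Delta>: "1 \<le> \<Delta>" and h: "1 \<le> h" "real h < real p / 2" and k: "1 \<le> k" "k \<le> n"
      and hk: "\<Delta> * real p powr \<epsilon> < real h ^ k" and \<Delta>p: "\<Delta> < real p powr (1 - \<epsilon>)"
      and a: "\<forall>j\<in>{k..n}. a j \<in> {0..<int p}" for p \<Delta> h k a
  proof -
    define w where "w = n - k + 1"
    define D where "D = \<lfloor>\<Delta>\<rfloor>"
    have p2: "2 \<le> p" using p(1) by (rule prime_ge_2_nat)
    have h2: "2 * h < p" using h(2) by linarith
    have kn: "k \<in> {1..n}" using k by simp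
    have "real p powr (1 - \<epsilon>) \<le> real p powr 1" using assms(1) p2 by (intro powr_mono) auto
    then have "\<Delta> < real p" using \<Delta>p p2 by simp
    then have D: "1 \<le> D" "D < int p" "real_of_int D \<le> \<Delta>" using \<Delta> unfolding D_def by linarith+
    have Q: "1 \<le> Q k" using dec[OF kn] unfolding decodes_def by blast
    have "p1 k \<le> p0" unfolding p0_def using kn by (intro member_le_sum) auto
    then have pk: "p1 k \<le> p" using p(2) by simp
    \<comment> \<open>Possible nonzero differences of coefficient vectors modulo \<open>p\<close>,
      as extensional functions so that there are only finitely many, at most p^w.\<close>
    define Cs where "Cs = {c \<in> {k..n} \<rightarrow>\<^sub>E {0..<int p}. \<exists>j\<in>{k..n}. c j \<noteq> 0}"
    define V where "V c = {t :: int. near p ((Q k + 1) * \<Delta>) (\<Sum>j=k..n. c j * t ^ j)}" for c :: "nat \<Rightarrow> int"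
    have fC: "finite ({k..n} \<rightarrow>\<^sub>E {0..<int p})" by (intro finite_PiE) auto
    then have fCs: "finite Cs" unfolding Cs_def by simp
    have "card Cs \<le> card ({k..n} \<rightarrow>\<^sub>E {0..<int p})" unfolding Cs_def using fC by (intro card_mono) auto
    also have "\<dots> = p ^ w" using k by (simp add: card_PiE w_def Suc_diff_le)
    also have "\<dots> \<le> p ^ n" using p2 k by (intro power_increasing) (auto simp: w_def)
    finally have cCs: "card Cs \<le> p ^ n" .
    have V_card: "real (card ({- int h..int h} \<inter> V c)) \<le> real h * real p powr - \<delta>" if "c \<in> Cs" for c
    proof -
      obtain j where j: "j \<in> {k..n}" "c j \<noteq> 0" using \<open>c \<in> Cs\<close> unfolding Cs_def by blast
      have "c j \<in> {0..<int p}" using \<open>c \<in> Cs\<close> j(1) unfolding Cs_def by (blast dest: PiE_mem)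
      then have "\<not> int p dvd c j" using j(2) by (auto dest: zdvd_imp_le)
      then have "\<exists>j\<in>{k..n}. \<not> int p dvd c j" using j by blast
      moreover have "{- int h..int h} \<inter> V c = {t \<in> {- int h..int h}. near p ((Q k + 1) * \<Delta>) (\<Sum>j=k..n. c j * t ^ j)}"
        unfolding V_def by auto
      ultimately show ?thesis
        using p1[OF kn, unfolded sparse_def, rule_format, of p \<Delta> h k c] p(1) pk \<Delta> h(1) h2 hk \<Delta>p k by simp
    qed
    \<comment> \<open>The exceptional points: on them some nonzero polynomial is small everywhere.
      Neither \<open>a\<close> nor the approximations enter.\<close>
    define U where "U = (\<Union>c\<in>Cs. {ts. set ts \<subseteq> V c})"
    have "measure_pmf.prob (replicate_pmf d (pmf_of_set {- int h..int h})) U \<le> card Cs * (real p powr - \<delta>) ^ d"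
      unfolding U_def by (rule prob_ex_all_near_le[OF fCs V_card]) auto
    also have "\<dots> \<le> real p ^ n * (real p powr - \<delta>) ^ d"
    proof -
      have "real (card Cs) \<le> real (p ^ n)" using cCs of_nat_le_iff by blast
      then show ?thesis by (intro mult_right_mono) auto
    qed
    also have "\<dots> = real p powr (n - \<delta> * d)"
    proof -
      have "(real p powr - \<delta>) ^ d = real p powr (- \<delta> * d)"
        using p2 powr_realpow[of "real p powr - \<delta>" d] by (simp add: powr_powr)
      moreover have "real p ^ n = real p powr n" using p2 by (simp add: powr_realpow)
      ultimately show ?thesis by (simp flip: powr_add)
    qed
    also have "\<dots> \<le> real p powr - 1" using d(2) p2 by (intro powr_mono) auto
    also have "\<dots> = 1 / real p" using p2 by (simp add: powr_minus_divide)
    finally have prob_U: "measure_pmf.prob (replicate_pmf d (pmf_of_set {- int h..int h})) U \<le> 1 / real p" .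
    have "ts \<in> recovery_event P n p h k \<Delta> a"
      if ts: "ts \<in> set_pmf (replicate_pmf d (pmf_of_set {- int h..int h}))" "ts \<notin> U" for ts
    proof -
      have len: "length ts = d" "set ts \<subseteq> {- int h..int h}"
        using ts(1) by (auto simp: set_replicate_pmf set_pmf_of_set lists_eq_set)
      show ?thesis
        unfolding recovery_event_def mem_Collect_eq
      proof (intro allI impI, elim conjE)
        fix ss assume ss: "length ss = length ts" "set ss \<subseteq> {0..<int p}"
          and close: "\<forall>i<length ts. real_of_int (mult_dist (poly_mod_eval p k n a (ts ! i) - ss ! i) p) \<le> \<Delta>"
        have ssl: "length ss = d" using ss(1) len by simp
        from run[OF p2 h2 kn D(1,2) len ssl ss(2), folded w_def]
        obtain T M' and y :: "nat \<Rightarrow> int" where T: "exec P (load (interp_input p h k D ts ss)) (\<tau> k + T) M'"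
          "\<forall>j<w. M' (int j) = y j mod int p"
          "\<forall>a. (\<forall>j<w. a j \<in> {0..<int p}) \<longrightarrow> (\<forall>i<d. near p D ((\<Sum>j<w. a j * (ts ! i) ^ (k + j)) - ss ! i)) \<longrightarrow>
           (\<forall>i<d. near p (Q k * D) ((\<Sum>j<w. y j * (ts ! i) ^ (k + j)) - ss ! i))"
          by (elim exE conjE) (rule that)
        have near_a: "near p D ((\<Sum>j<w. a (k + j) * (ts ! i) ^ (k + j)) - ss ! i)" if "i < d" for i
        proof (rule near_cong)
          have "real_of_int (mult_dist (poly_mod_eval p k n a (ts ! i) - ss ! i) p) \<le> \<Delta>" using close that len by simp
          \<comment> \<open>The distance is an integer, so nothing is lost when the program is given
            only the integral part of \<Delta>.\<close>
          then have "mult_dist (poly_mod_eval p k n a (ts ! i) - ss ! i) p \<le> D" unfolding D_def by (simp add: le_floor_iff)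
          then show "near p D (poly_mod_eval p k n a (ts ! i) - ss ! i)" by (intro near_mult_dist) simp
          show "int p dvd (\<Sum>j<w. a (k + j) * (ts ! i) ^ (k + j)) - ss ! i - (poly_mod_eval p k n a (ts ! i) - ss ! i)"
            unfolding w_def sum_lessThan_shift[OF k(2), of "\<lambda>j. a j * (ts ! i) ^ j"] poly_mod_eval_def
            by (simp add: mod_eq_dvd_iff[symmetric])
        qed
        have "\<forall>j<w. a (k + j) \<in> {0..<int p}" using a k by (auto simp: w_def)
        with near_a have near_y: "\<And>i. i < d \<Longrightarrow> near p (Q k * D) ((\<Sum>j<w. y j * (ts ! i) ^ (k + j)) - ss ! i)"
          by (intro T(3)[rule_format, where a = "\<lambda>j. a (k + j)"]) blast+
        \<comment> \<open>The difference of the true and the decoded coefficients, reduced and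
          restricted so as to belong to the function set counted above. Both fit the approximations,
          so it is small at all points with \<kappa> = \<open>Q k + 1\<close>, and then it must
          vanish.\<close>
        define c where "c = restrict (\<lambda>j. (a j - y (j - k)) mod int p) {k..n}"
        have c_ext: "c \<in> {k..n} \<rightarrow>\<^sub>E {0..<int p}" unfolding c_def using p2 by auto
        have near_c: "near p ((Q k + 1) * \<Delta>) (\<Sum>j=k..n. c j * (ts ! i) ^ j)" if "i < d" for i
        proof -
          have "near p (D + Q k * D) (((\<Sum>j<w. a (k + j) * (ts ! i) ^ (k + j)) - ss ! i) - ((\<Sum>j<w. y j * (ts ! i) ^ (k + j)) - ss ! i))"
            by (rule near_diff[OF near_a[OF that] near_y[OF that]])
          moreover have "((\<Sum>j<w. a (k + j) * (ts ! i) ^ (k + j)) - ss ! i) - ((\<Sum>j<w. y j * (ts ! i) ^ (k + j)) - ss ! i)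
              = (\<Sum>j=k..n. (a j - y (j - k)) * (ts ! i) ^ j)"
            using sum_lessThan_shift[OF k(2), of "\<lambda>j. (a j - y (j - k)) * (ts ! i) ^ j"]
            unfolding w_def by (simp add: left_diff_distrib sum_subtractf)
          moreover have "real_of_int D + Q k * D \<le> (Q k + 1) * \<Delta>"
          proof -
            have "(Q k + 1) * D \<le> (Q k + 1) * \<Delta>" using D(3) Q by (intro mult_left_mono) auto
            then show ?thesis by (simp add: algebra_simps)
          qed
          ultimately have "near p ((Q k + 1) * \<Delta>) (\<Sum>j=k..n. (a j - y (j - k)) * (ts ! i) ^ j)"
            using near_mono by metis
          then show ?thesis
          proof (rule near_cong)
            have "(\<Sum>j=k..n. c j * (ts ! i) ^ j) - (\<Sum>j=k..n. (a j - y (j - k)) * (ts ! i) ^ j)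
                = (\<Sum>j=k..n. (c j - (a j - y (j - k))) * (ts ! i) ^ j)"
              by (simp add: left_diff_distrib sum_subtractf)
            also have "int p dvd \<dots>"
              by (intro dvd_sum dvd_mult2) (auto simp: c_def mod_eq_dvd_iff[symmetric])
            finally show "int p dvd (\<Sum>j=k..n. c j * (ts ! i) ^ j) - (\<Sum>j=k..n. (a j - y (j - k)) * (ts ! i) ^ j)" .
          qed
        qed
        have "c j = 0" if "j \<in> {k..n}" for j
        proof (rule ccontr)
          assume "c j \<noteq> 0"
          then have "c \<in> Cs" using c_ext that unfolding Cs_def by blast
          moreover have "set ts \<subseteq> V c" using near_c len unfolding V_def by (auto simp: in_set_conv_nth)
          ultimately show False using ts(2) unfolding U_def by blast
        qed
        then have ya: "y (j - k) mod int p = a j" if "j \<in> {k..n}" for j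
        proof -
          have "(a j - y (j - k)) mod int p = 0" using \<open>\<And>j. j \<in> {k..n} \<Longrightarrow> c j = 0\<close>[OF that] that by (simp add: c_def)
          then have "y (j - k) mod int p = a j mod int p" by (simp add: mod_eq_dvd_iff dvd_diff_commute mod_0_imp_dvd)
          also have "\<dots> = a j" using a that by auto
          finally show ?thesis .
        qed
        show "outputs P (interp_input p h k \<lfloor>\<Delta>\<rfloor> ts ss) (map a [k..<Suc n])"
          unfolding outputs_def D_def[symmetric]
        proof (intro exI conjI allI impI)
          show "exec P (load (interp_input p h k D ts ss)) (\<tau> k + T) M'" by (rule T(1))
          fix i assume i: "i < length (map a [k..<Suc n])"
          then have "M' (int i) = y i mod int p" using T(2) k by (simp add: w_def Suc_diff_le)
          also have "\<dots> = a (k + i)" using ya[of "k + i"] i k by simp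
          also have "\<dots> = map a [k..<Suc n] ! i" using i by (simp del: upt_Suc)
          finally show "M' (int i) = map a [k..<Suc n] ! i" .
        qed
      qed
    qed
    \<comment> \<open>Lists of a wrong length or with entries out of range are not covered by the
      argument; intersecting with the support removes them without changing the probability.\<close>
    then have sub: "(UNIV - U) \<inter> set_pmf (replicate_pmf d (pmf_of_set {- int h..int h})) \<subseteq> recovery_event P n p h k \<Delta> a"
      by blast
    have "1 - 1 / real p \<le> measure_pmf.prob (replicate_pmf d (pmf_of_set {- int h..int h})) (UNIV - U)"
      using prob_U measure_pmf.prob_compl[of U] by simp
    also have "\<dots> = measure_pmf.prob (replicate_pmf d (pmf_of_set {- int h..int h})) ((UNIV - U) \<inter> set_pmf (replicate_pmf d (pmf_of_set {- int h..int h})))"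
      by (simp add: measure_Int_set_pmf)
    also have "\<dots> \<le> measure_pmf.prob (replicate_pmf d (pmf_of_set {- int h..int h})) (recovery_event P n p h k \<Delta> a)"
      using sub by (intro measure_pmf.finite_measure_mono) auto
    finally show ?thesis .
  qed
  then have "\<exists>p0 :: nat. \<forall>(p :: nat) (\<Delta> :: real) (h :: nat) (k :: nat).
       prime p \<and> p \<ge> p0 \<and> \<Delta> \<ge> 1 \<and> 1 \<le> h \<and> real h < real p / 2 \<and> 1 \<le> k \<and> k \<le> n \<and>
       real h ^ k > \<Delta> * real p powr \<epsilon> \<and> \<Delta> < real p powr (1 - \<epsilon>) \<longrightarrow>
       (\<forall>a :: nat \<Rightarrow> int. (\<forall>j \<in> {k..n}. a j \<in> {0..<int p}) \<longrightarrow>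
          measure_pmf.prob (replicate_pmf d (pmf_of_set {- int h..int h}))
            (recovery_event P n p h k \<Delta> a) \<ge> 1 - 1 / real p)"
    by (intro exI[of _ p0]) auto
  ultimately show ?thesis by blast
qed

end
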